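(* Suppose $F : I^m \to \mathbb{R}$, where $m \geq 1$ is an integer and $I = (-\rho,\rho)$ with $0 < \rho \leq \infty$. The following are equivalent. (1) For some $\delta > 0$, the function $F$, when applied entrywise, maps $\widetilde{\mathcal{M}^\rho}([-1,1+\delta])^m$ into the set of possibly truncated moment sequences of measures on $\mathbb{R}$. (2) For every $\delta > 0$, the function $F$, when applied entrywise, maps $\widetilde{\mathcal{M}^\rho}([-1,1+\delta])^m$ into the set of possibly truncated moment sequences of measures on $\mathbb{R}$. (3) Applied entrywise, the function $F$ maps $\mathcal{P}_N(I)^m$ into $\mathcal{P}_N(\mathbb{R})$ for any $N \geq 1$. (4) The function $F$ is absolutely monotonic on $[0,\rho)^m$ and agrees on $I^m$ with an analytic function.
   Context: An admissible measure is a non-negative measure $\mu$ on $\mathbb{R}$ possessing moments of all orders; its moments are $s_k(\mu) := \int_{\mathbb{R}} x^k \, d\mu$ ($k \geq 0$), where $s_0(\mu)$ is the total mass. All measures considered are admissible. A possibly truncated moment sequence of a measure $\mu$ is either the full sequence $(s_k(\mu))_{k\geq 0}$ or an initial segment of it. For $K \subset \mathbb{R}$, $\widetilde{\mathcal{M}^\rho}(K)$ is the collection of possibly truncated moment sequences for all admissible measures $\mu$ supported on $K$, where each sequence is truncated prior to the first moment of $\mu$ that lies outside $(-\rho,\rho)$, or is not truncated if no such moment exists. $F$ acts on an $m$-tuple of such sequences entrywise: the $k$th term of the result is $F$ evaluated at the $m$-tuple of $k$th terms, for every $k$ for which all $m$ sequences have a $k$th term. $\mathcal{P}_N(I)$ is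 the set of real symmetric positive semidefinite $N\times N$ matrices with entries in $I$, and $F$ acts on $m$-tuples of matrices by $F[A_1,\dots,A_m]_{ij} := F(a_{1,ij},\dots,a_{m,ij})$. $F$ is absolutely monotonic on $[0,\rho)^m$ if it is continuous on $[0,\rho)^m$ and, at every interior point of $[0,\rho)^m$ and for all multi-indices $\alpha \in \mathbb{Z}_+^m$ ($\mathbb{Z}_+=\{0,1,2,\dots\}$), the mixed partial derivative $D^\alpha F$ exists and is non-negative. *)

theory Defs
  imports "HOL-Analysis.Analysis" "Jordan_Normal_Form.Matrix"
begin

(* Both libraries declare these infixes. Keep "$" for real ^ 'm and "\<bullet>" for Matrix.vec. *)
no_notation Matrix.vec_index (infixl "$" 100)
no_notation inner (infixl "\<bullet>" 70)

subsection \<open>Moment sequences\<close>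

definition admissible :: "real measure \<Rightarrow> bool" where
  "admissible \<mu> \<longleftrightarrow> sets \<mu> = sets borel \<and> (\<forall>k::nat. integrable \<mu> (\<lambda>x. x ^ k))"

definition moment :: "real measure \<Rightarrow> nat \<Rightarrow> real" where
  "moment \<mu> k = (\<integral>x. x ^ k \<partial>\<mu>)"

definition symm_interval :: "ereal \<Rightarrow> real set" where
  "symm_interval \<rho> = {x. - \<rho> < ereal x \<and> ereal x < \<rho>}"

text \<open>
  A possibly truncated sequence is a partial function on the naturals. It is \<^const>\<open>None\<close> from
  the truncation point on. Truncation may leave the empty sequence.
\<close>

definition truncated_moment_seqs :: "(nat \<rightharpoonup> real) set" where
  "truncated_moment_seqs =
     {\<sigma>. \<exists>\<mu> (L::enat). admissible \<mu> \<and>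
          \<sigma> = (\<lambda>k. if enat k < L then Some (moment \<mu> k) else None)}"

text \<open>
  Truncation happens just before the first moment outside the open interval. For closed \<open>K\<close>, almost
  sure membership in \<open>K\<close> says that the support of the measure is contained in \<open>K\<close>.
\<close>

definition bounded_moment_seqs :: "ereal \<Rightarrow> real set \<Rightarrow> (nat \<rightharpoonup> real) set" where
  "bounded_moment_seqs \<rho> K =
     {\<sigma>. \<exists>\<mu>. admissible \<mu> \<and> (AE x in \<mu>. x \<in> K) \<and>
          \<sigma> = (\<lambda>k. if \<forall>j\<le>k. moment \<mu> j \<in> symm_interval \<rho> then Some (moment \<mu> k) else None)}"

definition seq_transform :: "(real ^ 'm \<Rightarrow> real) \<Rightarrow> ('m \<Rightarrow> nat \<rightharpoonup> real) \<Rightarrow> nat \<rightharpoonup> real" where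
  "seq_transform F \<sigma> =
     (\<lambda>k. if \<forall>i. \<sigma> i k \<noteq> None then Some (F (\<chi> i. the (\<sigma> i k))) else None)"


subsection \<open>Positive semidefinite matrices\<close>

definition psd_mats :: "nat \<Rightarrow> real set \<Rightarrow> real Matrix.mat set" where
  "psd_mats N I =
     {A \<in> carrier_mat N N. transpose_mat A = A \<and> elements_mat A \<subseteq> I \<and>
          (\<forall>v \<in> carrier_vec N. v \<bullet> (A *\<^sub>v v) \<ge> 0)}"

definition mat_transform ::
    "nat \<Rightarrow> (real ^ 'm \<Rightarrow> real) \<Rightarrow> ('m \<Rightarrow> real Matrix.mat) \<Rightarrow> real Matrix.mat" where
  "mat_transform N F A = Matrix.mat N N (\<lambda>(i, j). F (\<chi> l. A l $$ (i, j)))"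


subsection \<open>Absolute monotonicity and real analyticity\<close>

definition partial_deriv :: "'m::finite \<Rightarrow> (real ^ 'm \<Rightarrow> real) \<Rightarrow> real ^ 'm \<Rightarrow> real" where
  "partial_deriv i F x = deriv (\<lambda>t. F (x + t *\<^sub>R axis i 1)) 0"

text \<open>
  A list of variable indices, with the last one differentiated first, encodes a multi-index
  together with an order of differentiation.
\<close>

primrec mixed_partial :: "'m::finite list \<Rightarrow> (real ^ 'm \<Rightarrow> real) \<Rightarrow> real ^ 'm \<Rightarrow> real" where
  "mixed_partial [] F = F"
| "mixed_partial (i # is) F = partial_deriv i (mixed_partial is F)"

primrec mixed_partial_exists ::
    "'m::finite list \<Rightarrow> (real ^ 'm \<Rightarrow> real) \<Rightarrow> real ^ 'm \<Rightarrow> bool" where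
  "mixed_partial_exists [] F x \<longleftrightarrow> True"
| "mixed_partial_exists (i # is) F x \<longleftrightarrow>
     (\<forall>\<^sub>F y in nhds x. mixed_partial_exists is F y) \<and>
     (\<lambda>t. mixed_partial is F (x + t *\<^sub>R axis i 1)) field_differentiable at 0"

text \<open>
  Quantifying over all lists covers every multi-index, in every order of differentiation.
\<close>

definition absolutely_monotonic_on :: "(real ^ 'm::finite) set \<Rightarrow> (real ^ 'm \<Rightarrow> real) \<Rightarrow> bool" where
  "absolutely_monotonic_on S F \<longleftrightarrow>
     continuous_on S F \<and>
     (\<forall>x \<in> interior S. \<forall>is. mixed_partial_exists is F x \<and> mixed_partial is F x \<ge> 0)"

text \<open>
  The power series is indexed by multi-indices, and \<open>has_sum\<close> is unconditional convergence.
\<close>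

definition real_analytic_on :: "(real ^ 'm::finite) set \<Rightarrow> (real ^ 'm \<Rightarrow> real) \<Rightarrow> bool" where
  "real_analytic_on U G \<longleftrightarrow>
     (\<forall>a \<in> U. \<exists>c :: ('m \<Rightarrow> nat) \<Rightarrow> real. \<forall>\<^sub>F x in nhds a.
        ((\<lambda>\<alpha>. c \<alpha> * (\<Prod>i\<in>UNIV. (x $ i - a $ i) ^ \<alpha> i)) has_sum G x) UNIV)"

end

theory Submission
  imports Defs "HOL-Complex_Analysis.Great_Picard" "HOL-Probability.Giry_Monad" "HOL-Computational_Algebra.Primes"
begin

text \<open>
  Each of the four conditions is equivalent to a single one: on the whole box of points with all
  \<open>\<bar>x\<^sub>i\<bar> < \<rho>\<close>, the function \<open>F\<close> is the sum of a power series \<open>\<Sum> f\<^sub>\<alpha> x\<^sup>\<alpha>\<close> with coefficients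
  \<open>f\<^sub>\<alpha> \<ge> 0\<close> (\<open>pos_series\<close>, \<open>power_sum\<close>).

  \<^bold>\<open>From the series to the conditions.\<close> A monomial preserves positivity: entrywise products of positive
  semidefinite matrices are positive semidefinite (\<open>psd_kernel_mult\<close>), and products of moment
  sequences of probability measures are moment sequences of products of independent random
  variables (\<open>prob_moments_mult\<close>). Positivity passes to nonnegative combinations. For truncated
  sequences the combination may converge only in the first \<open>L\<close> entries; in the finite-dimensional
  space \<open>\<real>\<^sup>L\<close> it is then replaced by a finite one (\<open>convergent_conic_combination\<close>). Expanding the
  series around another point gives analyticity and shows that partial derivatives are again
  series of this kind (\<open>power_sum_analytic\<close>, \<open>power_sum_absolutely_monotonic\<close>).

  \<^bold>\<open>From moments or matrices to the series.\<close> The conditions on measures and on matrices are used only for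
  measures with two atoms in \<open>[-1, 1]\<close> and for their Hankel matrices. They give
  \<open>two_atom_positive\<close>: \<open>F\<close> maps the moments of such measures to a sequence \<open>\<tau>\<close> whose Hankel
  matrices are positive semidefinite, that is, \<open>L(p\<^sup>2) \<ge> 0\<close> for every polynomial \<open>p\<close>, where \<open>L\<close> is
  the functional \<open>x\<^sup>k \<mapsto> \<tau>\<^sub>k\<close>.
  On the positive orthant this is exploited along rays. In one variable (\<open>two_point_positive_power_series\<close>)
  Bernstein's theorem applies first in the logarithmic scale, where it yields smoothness, and then
  in the original scale, where test polynomials with prescribed zeros isolate the sign of one Taylor
  coefficient. Hence \<open>F\<close> has an expansion into homogeneous parts along each ray. Lagrange
  interpolation on segments shows that these parts are polynomials (\<open>ray_series_coeffs\<close>), and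
  test polynomials that vanish at all but one of the numbers \<open>t\<^sup>\<alpha>\<close> show that the coefficients are
  nonnegative (\<open>two_atom_coeff_nonneg\<close>).

  For arguments of arbitrary sign an atom at a negative point is used. The even moments then lie in
  the positive orthant, where \<open>F\<close> is known, and the bound \<open>2 \<bar>L(x s(x\<^sup>2)\<^sup>2)\<bar> \<le> L(s(x\<^sup>2)\<^sup>2) + L(x\<^sup>2 s(x\<^sup>2)\<^sup>2)\<close>
  transfers this knowledge to the first odd moment, provided that the later odd moments are under
  control (\<open>odd_moment_determined\<close>). This is applied first near the origin, where the later odd
  moments can be arranged to lie in the positive orthant, and then on the whole box, where
  they are eventually close to the origin (\<open>two_atom_power_series\<close>).

  \<^bold>\<open>From absolute monotonicity to the series.\<close> Nonnegative mixed partial derivatives make all iterated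
  forward differences nonnegative. Bernstein's theorem on rays, the interpolation argument, and
  differences that single out one coefficient give the series on the positive orthant; analytic
  continuation along segments extends it to the box (\<open>absolutely_monotonic_power_series\<close>).
\<close>

section \<open>Uniqueness of power series\<close>

lemma power_series_zero_coeffs:
  fixes e :: "nat \<Rightarrow> real"
  assumes r: "0 < r" and e: "\<And>x. \<lbrakk>0 \<le> x; x < r\<rbrakk> \<Longrightarrow> (\<lambda>n. e n * x ^ n) sums 0"
  shows "e n = 0"
proof (rule ccontr)
  assume n: "e n \<noteq> 0"
  have e0: "e 0 = 0"
    using e[of 0] r sums_unique2[OF powser_sums_zero, of e 0] by simp
  have "n > 0"
    using n e0 by (cases n) auto
  have summ: "summable (\<lambda>n. e n * x ^ n)" if "norm x < r / 2" for x :: real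
    using powser_inside[OF sums_summable[OF e[of "r / 2"]], of x] that r by simp
  define f where "f x = (\<Sum>n. e n * x ^ n)" for x
  obtain s where s: "0 < s" "\<And>z. z \<in> cball 0 s - {0} \<Longrightarrow> f z \<noteq> 0"
  proof (rule powser_0_nonzero[of "r / 2" 0 e f n])
    show "(\<lambda>n. e n * (x - 0) ^ n) sums f x" if "norm (x - 0) < r / 2" for x
      using summ[of x] that by (simp add: f_def summable_sums)
    show "f 0 = 0"
      using e0 by (simp add: f_def)
  qed (use r n \<open>n > 0\<close> in auto)
  define z where "z = min s (r / 2)"
  have "f z = 0"
    using e[of z] r s(1) by (auto simp: f_def z_def sums_iff min_def split: if_splits)
  then show False
    using s r by (auto simp: z_def dist_norm)
qed

lemma power_series_unique:
  fixes c d :: "nat \<Rightarrow> real"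
  assumes r: "0 < r"
    and "\<And>x. \<lbrakk>0 \<le> x; x < r\<rbrakk> \<Longrightarrow> (\<lambda>n. c n * x ^ n) sums f x"
    and "\<And>x. \<lbrakk>0 \<le> x; x < r\<rbrakk> \<Longrightarrow> (\<lambda>n. d n * x ^ n) sums f x"
  shows "c = d"
proof
  fix n
  have "(\<lambda>n. (c n - d n) * x ^ n) sums 0" if "0 \<le> x" "x < r" for x
    using sums_diff[OF assms(2,3)[OF that]] by (simp add: left_diff_distrib)
  from power_series_zero_coeffs[OF r this] show "c n = d n"
    by simp
qed

section \<open>Forward differences and Bernstein's theorem\<close>

primrec fdiff :: "nat \<Rightarrow> real \<Rightarrow> (real \<Rightarrow> real) \<Rightarrow> real \<Rightarrow> real" where
  "fdiff 0 h f u = f u"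
| "fdiff (Suc n) h f u = fdiff n h f (u + h) - fdiff n h f u"

text \<open>
  Pascal's rule, in the form in which inductions on \<open>n\<close> consume it.
\<close>

lemma binomial_sum_Suc:
  fixes a :: "nat \<Rightarrow> 'a::comm_ring_1"
  shows "(\<Sum>k\<le>Suc n. of_nat (Suc n choose k) * a k)
    = (\<Sum>k\<le>n. of_nat (n choose k) * a k) + (\<Sum>k\<le>n. of_nat (n choose k) * a (Suc k))"
proof -
  have "(\<Sum>k\<le>Suc n. of_nat (Suc n choose k) * a k)
      = a 0 + (\<Sum>k\<le>n. of_nat (Suc n choose Suc k) * a (Suc k))"
    by (subst sum.atMost_Suc_shift) simp
  also have "\<dots> = a 0 + (\<Sum>k\<le>n. of_nat (n choose Suc k) * a (Suc k))
      + (\<Sum>k\<le>n. of_nat (n choose k) * a (Suc k))"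
    by (simp add: distrib_right sum.distrib)
  also have "a 0 + (\<Sum>k\<le>n. of_nat (n choose Suc k) * a (Suc k)) = (\<Sum>k\<le>Suc n. of_nat (n choose k) * a k)"
    unfolding sum.atMost_Suc_shift[of "\<lambda>k. of_nat (n choose k) * a k"] by simp
  also have "\<dots> = (\<Sum>k\<le>n. of_nat (n choose k) * a k)"
    by (simp add: binomial_eq_0)
  finally show ?thesis .
qed

lemma fdiff_eq_sum:
  "fdiff n h f u = (\<Sum>k\<le>n. real (n choose k) * ((-1) ^ (n + k) * f (u + real k * h)))"
proof (induction n arbitrary: u)
  case (Suc n)
  show ?case
    unfolding fdiff.simps Suc binomial_sum_Suc
    by (simp add: sum_negf algebra_simps)
qed simp

text \<open>
  Both sides are \<open>((1 - x) + x E)\<^sup>n f\<close> at \<open>u\<close>, where \<open>E\<close> is the shift by \<open>h\<close> and \<open>E - 1\<close> is the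
  forward difference. For \<open>u = 0\<close> and \<open>h = 1 / n\<close> the right-hand side is the Bernstein polynomial
  of \<open>f\<close>, so its coefficients in powers of \<open>x\<close> are multiples of forward differences.
\<close>

lemma fdiff_binomial_expansion:
  "(\<Sum>k\<le>n. real (n choose k) * (x ^ k * fdiff k h f u))
    = (\<Sum>k\<le>n. real (n choose k) * (x ^ k * (1 - x) ^ (n - k) * f (u + real k * h)))"
proof (induction n arbitrary: u)
  case (Suc n)
  let ?S = "\<lambda>u. \<Sum>k\<le>n. real (n choose k) * (x ^ k * (1 - x) ^ (n - k) * f (u + real k * h))"
  have "(\<Sum>k\<le>Suc n. real (Suc n choose k) * (x ^ k * fdiff k h f u))
    = (1 - x) * ?S u + x * ?S (u + h)"
    unfolding binomial_sum_Suc Suc[symmetric]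
    by (simp add: algebra_simps sum_distrib_left sum_subtractf)
  also have "\<dots> = (\<Sum>k\<le>n. real (n choose k) * (x ^ k * (1 - x) ^ (Suc n - k) * f (u + real k * h)))
     + (\<Sum>k\<le>n. real (n choose k) * (x ^ Suc k * (1 - x) ^ (Suc n - Suc k) * f (u + real (Suc k) * h)))"
    unfolding sum_distrib_left
    by (intro arg_cong2[where f = "(+)"] sum.cong) (auto simp: algebra_simps Suc_diff_le)
  finally show ?case
    unfolding binomial_sum_Suc .
qed simp

lemma fdiff_scale: "fdiff n h (\<lambda>x. f (r * x)) u = fdiff n (r * h) f (r * u)"
  by (induction n arbitrary: u) (simp_all add: algebra_simps)

text \<open>
  The Bernstein polynomials of \<open>g\<close> have nonnegative coefficients with sum \<open>g 1\<close>. A subsequence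
  therefore converges coefficientwise, and Tannery's theorem identifies the limit series with \<open>g\<close>
  on \<open>[0, 1)\<close>.
\<close>

lemma Bernstein_unit_interval:
  assumes cont: "continuous_on {0..1} g"
    and nn: "\<And>n k. \<lbrakk>0 < n; k \<le> n\<rbrakk> \<Longrightarrow> 0 \<le> fdiff k (1 / real n) g 0"
  obtains c where "\<And>n. 0 \<le> c n" "\<And>x. \<lbrakk>0 \<le> x; x < 1\<rbrakk> \<Longrightarrow> (\<lambda>n. c n * x ^ n) sums g x"
proof -
  define a where "a n k = (if k \<le> n \<and> 0 < n then real (n choose k) * fdiff k (1 / real n) g 0 else 0)" for n k
  define B where "B n x = (\<Sum>k\<le>n. g (real k / real n) * Bernstein n k x)" for n x
  have B: "B n x = (\<Sum>k. a n k * x ^ k)" if "0 < n" for n x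
  proof -
    have "(\<Sum>k. a n k * x ^ k) = (\<Sum>k\<le>n. a n k * x ^ k)"
      by (rule suminf_finite) (auto simp: a_def)
    also have "\<dots> = (\<Sum>k\<le>n. real (n choose k) * (x ^ k * fdiff k (1 / real n) g 0))"
      using that by (intro sum.cong) (auto simp: a_def)
    also have "\<dots> = B n x"
      unfolding fdiff_binomial_expansion B_def
      by (intro sum.cong) (auto simp: Bernstein_def)
    finally show ?thesis ..
  qed
  have a_nonneg: "0 \<le> a n k" for n k
    using nn by (auto simp: a_def)
  have g1: "0 \<le> g 1"
    using nn[of 1 1] nn[of 1 0] by auto
  have "B n 1 = g 1" if "0 < n" for n
  proof -
    have "B n 1 = (\<Sum>k\<le>n. if k = n then g 1 else 0)"
      unfolding B_def using that by (intro sum.cong) (auto simp: Bernstein_def)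
    then show ?thesis by simp
  qed
  then have suma: "(\<Sum>k. a n k) = g 1" if "0 < n" for n
    using B[of n 1] that by simp
  have a_le: "a n k \<le> g 1" for n k
  proof (cases "0 < n")
    case True
    have "summable (a n)"
      by (rule summable_finite[of "{..n}"]) (auto simp: a_def)
    then have "sum (a n) {k} \<le> (\<Sum>k. a n k)"
      by (intro sum_le_suminf) (auto simp: a_nonneg)
    with suma[OF True] show ?thesis by simp
  qed (simp add: a_def g1)
  obtain r :: "nat \<Rightarrow> nat" where r: "strict_mono r"
    and conv: "\<And>k. k \<in> (UNIV :: nat set) \<Longrightarrow> \<exists>l. (\<lambda>n. a (r n) k) \<longlonglongrightarrow> l"
    using function_convergent_subsequence[of "UNIV :: nat set" a "g 1"] a_nonneg a_le by auto
  then obtain c where c: "\<And>k. (\<lambda>n. a (r n) k) \<longlonglongrightarrow> c k"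
    by (metis UNIV_I)
  have c_nonneg: "0 \<le> c k" for k
    by (rule LIMSEQ_le_const[OF c]) (auto simp: a_nonneg)
  have c_le: "c k \<le> g 1" for k
    by (rule LIMSEQ_le_const2[OF c]) (auto simp: a_le)
  have sums: "(\<lambda>n. c n * x ^ n) sums g x" if x: "0 \<le> x" "x < 1" for x
  proof -
    have dom: "summable (\<lambda>k. g 1 * x ^ k)"
      using x by (intro summable_mult summable_geometric) auto
    have "(\<lambda>n. \<Sum>k. a (r n) k * x ^ k) \<longlonglongrightarrow> (\<Sum>k. c k * x ^ k)"
    proof (rule tannerys_theorem[OF _ _ dom, THEN conjunct2, THEN conjunct2])
      show "((\<lambda>n. a (r n) k * x ^ k) \<longlongrightarrow> c k * x ^ k) sequentially" for k
        by (intro tendsto_intros c)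
      show "\<forall>\<^sub>F (k, n) in sequentially \<times>\<^sub>F sequentially. norm (a (r n) k * x ^ k) \<le> g 1 * x ^ k"
        using x a_nonneg a_le by (auto intro!: always_eventually mult_right_mono simp: abs_mult)
    qed simp
    moreover have "(\<lambda>n. \<Sum>k. a (r n) k * x ^ k) \<longlonglongrightarrow> g x"
    proof (rule Lim_transform_eventually)
      have "(\<lambda>n. B n x) \<longlonglongrightarrow> g x"
        unfolding LIMSEQ_iff
      proof (intro allI impI)
        fix e :: real assume "0 < e"
        from Bernstein_Weierstrass[OF cont this] x
        show "\<exists>no. \<forall>n\<ge>no. norm (B n x - g x) < e"
          unfolding B_def by (fastforce simp: abs_minus_commute)
      qed
      then show "(\<lambda>n. B (r n) x) \<longlonglongrightarrow> g x"
        using r LIMSEQ_subseq_LIMSEQ[of "\<lambda>n. B n x" "g x" r] by (simp add: o_def)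
      show "\<forall>\<^sub>F n in sequentially. B (r n) x = (\<Sum>k. a (r n) k * x ^ k)"
        using eventually_gt_at_top[of 0]
      proof eventually_elim
        case (elim n)
        then have "0 < r n"
          using seq_suble[OF r, of n] by linarith
        then show ?case by (rule B)
      qed
    qed
    ultimately have "g x = (\<Sum>k. c k * x ^ k)"
      using LIMSEQ_unique by blast
    moreover have "summable (\<lambda>k. c k * x ^ k)"
      using x c_nonneg c_le by (intro summable_comparison_test'[OF dom, of 0]) (auto simp: abs_mult intro!: mult_right_mono)
    ultimately show ?thesis
      by (simp add: summable_sums)
  qed
  show ?thesis
    using that[of c] c_nonneg sums by blast
qed

text \<open>
  Nonnegative second differences make consecutive increments grow, so the first of \<open>n\<close> increments
  is at most their average. This bounds the oscillation of \<open>\<phi>\<close> and yields its continuity.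
\<close>

lemma fdiff_nonneg_imp_increments:
  assumes nn: "\<And>n h u. \<lbrakk>0 \<le> u; 0 < h; u + real n * h < Y\<rbrakk> \<Longrightarrow> 0 \<le> fdiff n h \<phi> u"
    and u: "0 \<le> u" "0 < h" "u + real n * h < Y"
  shows "real n * (\<phi> (u + h) - \<phi> u) \<le> \<phi> (u + real n * h) - \<phi> u"
  using u
proof (induction n arbitrary: u)
  case (Suc n)
  have h: "u + h + real n * h < Y"
    using Suc.prems by (simp add: algebra_simps)
  then have IH: "real n * (\<phi> (u + h + h) - \<phi> (u + h)) \<le> \<phi> (u + h + real n * h) - \<phi> (u + h)"
    using Suc.IH[of "u + h"] Suc.prems by simp
  show ?case
  proof (cases "n = 0")
    case False
    then have "h \<le> real n * h"
      using Suc.prems by simp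
    then have "u + real 2 * h < Y"
      using h by simp
    then have "0 \<le> fdiff 2 h \<phi> u"
      using Suc.prems by (intro nn) auto
    then have "\<phi> (u + h) - \<phi> u \<le> \<phi> (u + h + h) - \<phi> (u + h)"
      by (simp add: numeral_2_eq_2)
    then have "real n * (\<phi> (u + h) - \<phi> u) \<le> real n * (\<phi> (u + h + h) - \<phi> (u + h))"
      by (intro mult_left_mono) auto
    with IH show ?thesis
      by (simp add: algebra_simps)
  qed simp
qed simp

text \<open>
  Bernstein's theorem for the discrete form of absolute monotonicity. The bound on increments gives
  continuity on compact subintervals, so each \<open>[0, R]\<close> with \<open>R < Y\<close> can be rescaled to the
  unit interval; uniqueness of coefficients glues the resulting series together.
\<close>

lemma Bernstein_abs_monotone:
  assumes nn: "\<And>n h u. \<lbrakk>0 \<le> u; 0 < h; u + real n * h < Y\<rbrakk> \<Longrightarrow> 0 \<le> fdiff n h \<phi> u"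
    and Y: "0 < Y"
  obtains c where "\<And>n. 0 \<le> c n" "\<And>x. \<lbrakk>0 \<le> x; x < Y\<rbrakk> \<Longrightarrow> (\<lambda>n. c n * x ^ n) sums \<phi> x"
proof -
  have mono: "\<phi> x \<le> \<phi> y" if "0 \<le> x" "x \<le> y" "y < Y" for x y
    using nn[of x "y - x" 1] that by (cases "x = y") auto
  have cont: "continuous_on {0..R} \<phi>" if R: "0 < R" "R < Y" for R
  proof -
    define R' where "R' = (R + Y) / 2"
    have R': "R < R'" "R' < Y"
      using R by (auto simp: R'_def)
    define M where "M = \<phi> R' - \<phi> 0"
    have M: "0 \<le> M"
      using mono[of 0 R'] R R' by (simp add: M_def)
    have small: "\<phi> y - \<phi> x \<le> M / real n"
      if "0 < n" "0 \<le> x" "x \<le> y" "y \<le> R" "y - x \<le> (R' - R) / real n" for x y n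
    proof (cases "x = y")
      case False
      have "real n * (y - x) \<le> R' - R"
        using that by (simp add: field_simps)
      then have le: "x + real n * (y - x) \<le> R'"
        using that by linarith
      have "real n * (\<phi> (x + (y - x)) - \<phi> x) \<le> \<phi> (x + real n * (y - x)) - \<phi> x"
        using False that le R' by (intro fdiff_nonneg_imp_increments[OF nn]) auto
      also have "\<dots> \<le> M"
        using mono[of 0 x] mono[of "x + real n * (y - x)" R'] le that R' False
        by (simp add: M_def)
      finally show ?thesis
        using that by (simp add: field_simps)
    qed (use M in auto)
    have "uniformly_continuous_on {0..R} \<phi>"
      unfolding uniformly_continuous_on_def
    proof (intro allI impI)
      fix e :: real assume e: "0 < e"
      obtain n :: nat where n: "M / e < real n" "0 < n"
        by (metis gr_zeroI of_nat_0 of_nat_0_less_iff order_less_le_trans order_less_asym reals_Archimedean2 zero_le_divide_iff linorder_not_less M order_less_imp_le e)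
      then have Mn: "M / real n < e"
        using e by (simp add: field_simps)
      show "\<exists>d>0. \<forall>x\<in>{0..R}. \<forall>y\<in>{0..R}. dist y x < d \<longrightarrow> dist (\<phi> y) (\<phi> x) < e"
      proof (intro exI[of _ "(R' - R) / real n"] conjI ballI impI)
        fix x y assume xy: "x \<in> {0..R}" "y \<in> {0..R}" "dist y x < (R' - R) / real n"
        show "dist (\<phi> y) (\<phi> x) < e"
        proof (cases "x \<le> y")
          case True
          then show ?thesis
            using small[of n x y] mono[of x y] xy n Mn R by (auto simp: dist_real_def)
        next
          case False
          then show ?thesis
            using small[of n y x] mono[of y x] xy n Mn R by (auto simp: dist_real_def)
        qed
      qed (use R' n in auto)
    qed
    then show ?thesis
      by (rule uniformly_continuous_imp_continuous)
  qed
  have local_series: "\<exists>c. (\<forall>n. 0 \<le> c n) \<and> (\<forall>x. 0 \<le> x \<and> x < R \<longrightarrow> (\<lambda>n. c n * x ^ n) sums \<phi> x)"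
    if R: "0 < R" "R < Y" for R
  proof -
    obtain c where c: "\<And>n. 0 \<le> c n" "\<And>x. \<lbrakk>0 \<le> x; x < 1\<rbrakk> \<Longrightarrow> (\<lambda>n. c n * x ^ n) sums \<phi> (R * x)"
    proof (rule Bernstein_unit_interval[of "\<lambda>x. \<phi> (R * x)"])
      show "continuous_on {0..1} (\<lambda>x. \<phi> (R * x))"
        using R by (intro continuous_on_compose2[OF cont[OF R]] continuous_intros)
          (auto intro: mult_left_le)
      show "0 \<le> fdiff k (1 / real n) (\<lambda>x. \<phi> (R * x)) 0" if "0 < n" "k \<le> n" for n k
      proof -
        have "R * real k / real n \<le> R"
          using R that by (simp add: field_simps)
        then have "real k * (R * (1 / real n)) < Y"
          using R by (simp add: mult.commute)
        then have "0 \<le> fdiff k (R * (1 / real n)) \<phi> (R * 0)"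
          using R that by (intro nn) auto
        then show ?thesis
          by (simp only: fdiff_scale)
      qed
    qed blast
    have "(\<lambda>n. (c n / R ^ n) * x ^ n) sums \<phi> x" if "0 \<le> x" "x < R" for x
      using c(2)[of "x / R"] R that by (simp add: power_divide)
    then show ?thesis
      using c(1) R by (intro exI[of _ "\<lambda>n. c n / R ^ n"]) auto
  qed
  obtain c where c: "\<And>n. 0 \<le> c n" "\<And>x. \<lbrakk>0 \<le> x; x < Y / 2\<rbrakk> \<Longrightarrow> (\<lambda>n. c n * x ^ n) sums \<phi> x"
    using local_series[of "Y / 2"] Y by auto
  have "(\<lambda>n. c n * x ^ n) sums \<phi> x" if x: "0 \<le> x" "x < Y" for x
  proof -
    define R where "R = max (Y / 2) ((x + Y) / 2)"
    have R: "0 < R" "R < Y" "x < R" "Y / 2 \<le> R"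
      using x Y by (auto simp: R_def)
    obtain d where d: "\<And>x. \<lbrakk>0 \<le> x; x < R\<rbrakk> \<Longrightarrow> (\<lambda>n. d n * x ^ n) sums \<phi> x"
      using local_series[of R] R by auto
    have "c = d"
      using Y R by (intro power_series_unique[of "Y / 2" c \<phi> d] c d) auto
    then show ?thesis
      using d x R by simp
  qed
  with c(1) show ?thesis
    using that by blast
qed

section \<open>Hankel-positive sequences\<close>

text \<open>
  The Riesz functional of \<open>\<tau>\<close>: the linear functional that sends \<open>x\<^sup>k\<close> to \<open>\<tau> k\<close>. It turns
  manipulations of Hankel quadratic forms into polynomial identities.
\<close>

definition riesz :: "(nat \<Rightarrow> real) \<Rightarrow> real poly \<Rightarrow> real" where
  "riesz \<tau> p = (\<Sum>k\<le>degree p. coeff p k * \<tau> k)"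

text \<open>
  For the coefficient vector of \<open>p\<close> this is the quadratic form of the Hankel matrix \<open>\<tau> (i + j)\<close>;
  see \<open>riesz_square\<close>.
\<close>

definition hankel_psd :: "(nat \<Rightarrow> real) \<Rightarrow> bool" where
  "hankel_psd \<tau> \<longleftrightarrow> (\<forall>p. 0 \<le> riesz \<tau> (p * p))"

lemma riesz_upto: "degree p \<le> n \<Longrightarrow> riesz \<tau> p = (\<Sum>k\<le>n. coeff p k * \<tau> k)"
  unfolding riesz_def by (rule sum.mono_neutral_left) (auto simp: coeff_eq_0)

lemma riesz_0 [simp]: "riesz \<tau> 0 = 0"
  by (simp add: riesz_def)

lemma riesz_add: "riesz \<tau> (p + q) = riesz \<tau> p + riesz \<tau> q"
proof -
  let ?n = "max (degree p) (degree q)"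
  have "degree (p + q) \<le> ?n"
    by (rule degree_add_le) auto
  then show ?thesis
    by (simp add: riesz_upto[of _ ?n] distrib_right sum.distrib)
qed

lemma riesz_smult: "riesz \<tau> (Polynomial.smult a p) = a * riesz \<tau> p"
  by (simp add: riesz_upto[of _ "degree p"] sum_distrib_left mult.assoc)

lemma riesz_diff: "riesz \<tau> (p - q) = riesz \<tau> p - riesz \<tau> q"
  using riesz_add[of \<tau> p "Polynomial.smult (-1) q"] by (simp only: riesz_smult) simp

lemma riesz_pCons: "riesz \<tau> (pCons a p) = a * \<tau> 0 + riesz (\<lambda>k. \<tau> (Suc k)) p"
proof -
  have "riesz \<tau> (pCons a p) = (\<Sum>k\<le>Suc (degree p). coeff (pCons a p) k * \<tau> k)"
    by (rule riesz_upto) (rule degree_pCons_le)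
  also have "\<dots> = a * \<tau> 0 + riesz (\<lambda>k. \<tau> (Suc k)) p"
    by (subst sum.atMost_Suc_shift) (simp add: riesz_def)
  finally show ?thesis .
qed

lemma riesz_monom_mult: "riesz \<tau> (monom 1 d * p) = riesz (\<lambda>k. \<tau> (k + d)) p"
  by (induction d arbitrary: \<tau>) (simp_all add: monom_Suc riesz_pCons)

lemma riesz_sum: "riesz \<tau> (\<Sum>i\<in>A. p i) = (\<Sum>i\<in>A. riesz \<tau> (p i))"
  by (induction A rule: infinite_finite_induct) (auto simp: riesz_add)

lemma riesz_seq_diff: "riesz (\<lambda>k. \<tau> k - \<sigma> k) p = riesz \<tau> p - riesz \<sigma> p"
  by (simp add: riesz_def right_diff_distrib sum_subtractf)

lemma riesz_seq_cmult: "riesz (\<lambda>k. a * \<tau> k) p = a * riesz \<tau> p"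
  by (simp add: riesz_def sum_distrib_left algebra_simps)

lemma riesz_seq_sum: "riesz (\<lambda>k. \<Sum>i\<in>A. \<tau> i k) p = (\<Sum>i\<in>A. riesz (\<tau> i) p)"
  unfolding riesz_def sum_distrib_left by (rule sum.swap)

lemma riesz_powers: "riesz (\<lambda>k. \<xi> ^ k) p = poly p \<xi>"
  by (simp add: riesz_def poly_altdef)

lemma riesz_seq_sums:
  assumes "\<And>k. (\<lambda>n. w n * \<xi> n ^ k) sums \<tau> k"
  shows "(\<lambda>n. w n * poly p (\<xi> n)) sums riesz \<tau> p"
proof -
  have "(\<lambda>n. \<Sum>k\<le>degree p. coeff p k * (w n * \<xi> n ^ k)) sums (\<Sum>k\<le>degree p. coeff p k * \<tau> k)"
    by (intro sums_sum sums_mult assms)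
  then show ?thesis
    by (simp add: riesz_def poly_altdef sum_distrib_left algebra_simps)
qed

lemma riesz_abs_le:
  assumes "\<And>k. \<bar>\<tau> k\<bar> \<le> M"
  shows "\<bar>riesz \<tau> p\<bar> \<le> M * (\<Sum>k\<le>degree p. \<bar>coeff p k\<bar>)"
proof -
  have "\<bar>riesz \<tau> p\<bar> \<le> (\<Sum>k\<le>degree p. \<bar>coeff p k * \<tau> k\<bar>)"
    unfolding riesz_def by (rule sum_abs)
  also have "\<dots> \<le> (\<Sum>k\<le>degree p. \<bar>coeff p k\<bar> * M)"
    by (intro sum_mono) (auto simp: abs_mult intro!: mult_left_mono assms)
  finally show ?thesis
    by (simp add: sum_distrib_left mult.commute)
qed

text \<open>
  A convex sequence with one positive increment grows at least linearly.
\<close>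

lemma convex_bounded_imp_decreasing:
  fixes A :: "nat \<Rightarrow> real"
  assumes conv: "\<And>n. 0 \<le> A n - 2 * A (Suc n) + A (Suc (Suc n))" and bd: "\<And>n. A n \<le> M"
  shows "A 1 \<le> A 0"
proof (rule ccontr)
  assume "\<not> A 1 \<le> A 0"
  then have d: "A 1 - A 0 > 0" by simp
  have step: "A 1 - A 0 \<le> A (Suc n) - A n" for n
  proof (induction n)
    case (Suc n)
    then show ?case using conv[of n] by linarith
  qed simp
  have grow: "A 0 + real n * (A 1 - A 0) \<le> A n" for n
  proof (induction n)
    case (Suc n)
    then show ?case using step[of n] by (simp add: algebra_simps)
  qed simp
  obtain n :: nat where "(M - A 0) / (A 1 - A 0) < real n"
    using reals_Archimedean2 by blast
  then have "M < A 0 + real n * (A 1 - A 0)"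
    using d by (simp add: field_simps)
  then show False
    using grow[of n] bd[of n] by linarith
qed

text \<open>
  For fixed \<open>p\<close>, positivity at the squares of \<open>x\<^sup>n (1 - x\<^sup>2) p\<close> says that \<open>n \<mapsto> L(x\<^sup>2\<^sup>n p\<^sup>2)\<close> is
  convex. It is also bounded, hence decreasing, so \<open>L((1 - x\<^sup>2) p\<^sup>2) \<ge> 0\<close>. A bounded positive
  sequence thus behaves like the moments of a measure on \<open>[-1, 1]\<close>.
\<close>

lemma hankel_psd_diff2:
  assumes psd: "hankel_psd \<tau>" and bd: "\<And>k. \<bar>\<tau> k\<bar> \<le> M"
  shows "hankel_psd (\<lambda>k. \<tau> k - \<tau> (k + 2))"
  unfolding hankel_psd_def
proof
  fix p :: "real poly"
  define A where "A n = riesz \<tau> (monom 1 (2 * n) * (p * p))" for n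
  have conv: "0 \<le> A n - 2 * A (Suc n) + A (Suc (Suc n))" for n
  proof -
    let ?x = "\<lambda>k. monom (1::real) k"
    let ?q = "?x n * p - ?x (n + 2) * p"
    have m: "?x (i + j) = ?x i * ?x j" for i j
      by (simp add: mult_monom)
    have e: "2 * n = n + n" "2 * Suc n = n + n + 2" "2 * Suc (Suc n) = n + n + 2 + 2"
      by auto
    have "?q * ?q = ?x (2 * n) * (p * p) - (?x (2 * Suc n) * (p * p) + ?x (2 * Suc n) * (p * p))
        + ?x (2 * Suc (Suc n)) * (p * p)"
      unfolding e m by (simp only: algebra_simps)
    then have "riesz \<tau> (?q * ?q) = A n - 2 * A (Suc n) + A (Suc (Suc n))"
      by (simp only: A_def riesz_add riesz_diff)
    then show ?thesis
      using psd unfolding hankel_psd_def by metis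
  qed
  have "A n \<le> M * (\<Sum>k\<le>degree (p * p). \<bar>coeff (p * p) k\<bar>)" for n
    unfolding A_def riesz_monom_mult
    using riesz_abs_le[of "\<lambda>k. \<tau> (k + 2 * n)" M "p * p"] bd by fastforce
  then have "A 1 \<le> A 0"
    using convex_bounded_imp_decreasing[of A] conv by blast
  then show "0 \<le> riesz (\<lambda>k. \<tau> k - \<tau> (k + 2)) (p * p)"
    by (simp add: A_def riesz_seq_diff riesz_monom_mult)
qed

text \<open>
  This is \<open>L((1 - x\<^sup>2)\<^sup>n) \<ge> 0\<close>, by iterating \<open>hankel_psd_diff2\<close>.
\<close>

lemma hankel_psd_alternating:
  assumes "hankel_psd \<tau>" "\<And>k. \<bar>\<tau> k\<bar> \<le> M"
  shows "0 \<le> (\<Sum>i\<le>n. real (n choose i) * ((-1) ^ i * \<tau> (2 * i)))"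
  using assms
proof (induction n arbitrary: \<tau> M)
  case 0
  have "0 \<le> riesz \<tau> (1 * 1)"
    using 0(1) unfolding hankel_psd_def by blast
  then show ?case
    by (simp add: riesz_def)
next
  case (Suc n)
  have "(\<Sum>i\<le>Suc n. real (Suc n choose i) * ((-1) ^ i * \<tau> (2 * i)))
    = (\<Sum>i\<le>n. real (n choose i) * ((-1) ^ i * (\<tau> (2 * i) - \<tau> (2 * i + 2))))"
    unfolding binomial_sum_Suc by (simp add: algebra_simps sum_subtractf sum_negf)
  also have "0 \<le> \<dots>"
  proof (rule Suc.IH[of _ "2 * M"])
    show "\<bar>\<tau> k - \<tau> (k + 2)\<bar> \<le> 2 * M" for k
      using Suc.prems(2)[of k] Suc.prems(2)[of "k + 2"] by linarith
  qed (rule hankel_psd_diff2[OF Suc.prems])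
  finally show ?case .
qed

section \<open>Positivity preservers in one variable\<close>

text \<open>
  The sequence \<open>c + d t\<^sup>k\<close> consists of the moments of a measure with mass \<open>c\<close> at \<open>1\<close> and mass \<open>d\<close>
  at \<open>t\<close>.
\<close>

definition two_point_positive :: "(real \<Rightarrow> real) \<Rightarrow> real \<Rightarrow> bool" where
  "two_point_positive f R \<longleftrightarrow>
     (\<forall>c d t. 0 \<le> c \<and> 0 \<le> d \<and> c + d < R \<and> \<bar>t\<bar> \<le> 1 \<longrightarrow> hankel_psd (\<lambda>k. f (c + d * t ^ k)))"

lemma two_point_positiveD:
  "\<lbrakk>two_point_positive f R; 0 \<le> c; 0 \<le> d; c + d < R; \<bar>t\<bar> \<le> 1\<rbrakk> \<Longrightarrow> hankel_psd (\<lambda>k. f (c + d * t ^ k))"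
  by (simp add: two_point_positive_def)

text \<open>
  With \<open>t = -1\<close> the moments alternate between \<open>y\<close> and \<open>x\<close>; test with \<open>(1 + s x)\<^sup>2\<close> for \<open>s = 1\<close> and
  \<open>s = -1\<close>.
\<close>

lemma two_point_positive_abs_le:
  assumes f: "two_point_positive f R" and xy: "\<bar>x\<bar> \<le> y" "y < R"
  shows "\<bar>f x\<bar> \<le> f y"
proof -
  have "hankel_psd (\<lambda>k. f ((x + y) / 2 + (y - x) / 2 * (-1) ^ k))"
    using xy by (intro two_point_positiveD[OF f]) (auto simp: field_simps)
  then have "0 \<le> riesz (\<lambda>k. f ((x + y) / 2 + (y - x) / 2 * (-1) ^ k)) ([:1, s:] * [:1, s:])" for s
    by (simp only: hankel_psd_def)
  from this[of 1] this[of "-1"] show ?thesis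
    by (simp add: riesz_pCons field_simps)
qed

text \<open>
  The even powers of \<open>t = exp (- h / 2)\<close> are the values of the exponential function at steps of
  length \<open>h\<close>. The alternating sums of \<open>hankel_psd_alternating\<close> for \<open>f (B t\<^sup>k)\<close> are therefore forward
  differences of \<open>f\<close> in the logarithmic scale.
\<close>

lemma exp_scale_fdiff_nonneg:
  assumes f: "two_point_positive f R" and b: "0 < b" "b < R" and u: "0 < h" "u + real n * h < Y"
  shows "0 \<le> fdiff n h (\<lambda>u. f (b * exp (u - Y))) u"
proof -
  define B where "B = b * exp (u + real n * h - Y)"
  define t where "t = exp (- h / 2)"
  have B: "0 < B" "B \<le> b"
    using b u by (auto simp: B_def)
  have t: "0 < t" "t \<le> 1"
    using u by (auto simp: t_def)
  have "fdiff n h (\<lambda>u. f (b * exp (u - Y))) u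
    = (\<Sum>i\<le>n. real (n choose i) * ((-1) ^ i * f (0 + B * t ^ (2 * i))))"
    unfolding fdiff_eq_sum
  proof (rule sum.reindex_bij_witness[of _ "\<lambda>i. n - i" "\<lambda>i. n - i"], goal_cases)
    case (5 k)
    have "B * t ^ (2 * (n - k)) = b * exp (u + real k * h - Y)"
      using 5 by (simp add: B_def t_def exp_of_nat_mult[symmetric] exp_add[symmetric] of_nat_diff algebra_simps)
    moreover have "(-1 :: real) ^ (n + k) = (-1) ^ (n - k)"
      using 5 by (simp add: minus_one_power_iff)
    moreover have "n choose k = n choose (n - k)"
      using 5 binomial_symmetric[of k n] by simp
    ultimately show ?case
      by simp
  qed auto
  also have "0 \<le> \<dots>"
  proof (rule hankel_psd_alternating)
    show "hankel_psd (\<lambda>k. f (0 + B * t ^ k))"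
      using B b t by (intro two_point_positiveD[OF f]) auto
    show "\<bar>f (0 + B * t ^ k)\<bar> \<le> f b" for k
    proof -
      have "B * t ^ k \<le> b * 1"
        using B b t by (intro mult_mono power_le_one) auto
      then show ?thesis
        using B b t by (intro two_point_positive_abs_le[OF f]) auto
    qed
  qed
  finally show ?thesis .
qed

text \<open>
  The functions obtained from \<open>\<phi> j \<circ> lg\<close> by subtraction and by division by \<open>x\<close>. When \<open>\<phi> (Suc j)\<close> is the
  derivative of \<open>\<phi> j\<close> and \<open>lg\<close> has derivative \<open>1 / x\<close>, this class is closed under differentiation,
  which provides derivatives of all orders without formulas for them.
\<close>

inductive log_smooth :: "(nat \<Rightarrow> real \<Rightarrow> real) \<Rightarrow> (real \<Rightarrow> real) \<Rightarrow> (real \<Rightarrow> real) \<Rightarrow> bool"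
  for \<phi> lg where
  comp: "log_smooth \<phi> lg (\<lambda>x. \<phi> j (lg x))"
| over: "log_smooth \<phi> lg f \<Longrightarrow> log_smooth \<phi> lg (\<lambda>x. f x / x)"
| diff: "\<lbrakk>log_smooth \<phi> lg f; log_smooth \<phi> lg g\<rbrakk> \<Longrightarrow> log_smooth \<phi> lg (\<lambda>x. f x - g x)"

lemma log_smooth_deriv:
  assumes "log_smooth \<phi> lg f"
    and \<phi>: "\<And>j x. x \<in> J \<Longrightarrow> (\<phi> j has_real_derivative \<phi> (Suc j) (lg x)) (at (lg x))"
    and lg: "\<And>x. x \<in> J \<Longrightarrow> (lg has_real_derivative 1 / x) (at x)"
    and J: "0 \<notin> J"
  shows "\<exists>f'. log_smooth \<phi> lg f' \<and> (\<forall>x\<in>J. (f has_real_derivative f' x) (at x))"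
  using assms(1)
proof (induction)
  case (comp j)
  show ?case
  proof (intro exI[of _ "\<lambda>x. \<phi> (Suc j) (lg x) / x"] conjI ballI)
    show "log_smooth \<phi> lg (\<lambda>x. \<phi> (Suc j) (lg x) / x)"
      by (intro log_smooth.intros)
    show "((\<lambda>x. \<phi> j (lg x)) has_real_derivative \<phi> (Suc j) (lg x) / x) (at x)" if "x \<in> J" for x
      using DERIV_chain2[OF \<phi> lg, OF that that] by simp
  qed
next
  case (over f)
  then obtain f' where f': "log_smooth \<phi> lg f'" "\<And>x. x \<in> J \<Longrightarrow> (f has_real_derivative f' x) (at x)"
    by blast
  show ?case
  proof (intro exI[of _ "\<lambda>x. f' x / x - f x / x / x"] conjI ballI)
    show "log_smooth \<phi> lg (\<lambda>x. f' x / x - f x / x / x)"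
      by (intro log_smooth.intros f' over)
    show "((\<lambda>x. f x / x) has_real_derivative f' x / x - f x / x / x) (at x)" if "x \<in> J" for x
    proof -
      have "x \<noteq> 0" using that J by auto
      then have "((\<lambda>x. f x / x) has_real_derivative (f' x * x - f x * 1) / (x * x)) (at x)"
        by (rule DERIV_divide[OF f'(2)[OF that] DERIV_ident])
      also have "(f' x * x - f x * 1) / (x * x) = f' x / x - f x / x / x"
        using \<open>x \<noteq> 0\<close> by (simp add: diff_divide_distrib)
      finally show ?thesis .
    qed
  qed
next
  case (diff f g)
  then obtain f' g' where f': "log_smooth \<phi> lg f'" "\<forall>x\<in>J. (f has_real_derivative f' x) (at x)"
    and g': "log_smooth \<phi> lg g'" "\<forall>x\<in>J. (g has_real_derivative g' x) (at x)"
    by blast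
  then show ?case
    by (intro exI[of _ "\<lambda>x. f' x - g' x"] conjI log_smooth.diff ballI DERIV_diff) auto
qed

text \<open>
  By Bernstein's theorem \<open>f\<close> is a power series in the logarithmic variable. The series itself is not
  the desired one, but it shows that \<open>f\<close> has derivatives of all orders.
\<close>

lemma two_point_positive_smooth:
  assumes f: "two_point_positive f R" and I: "0 < lo" "lo < hi" "hi < R"
  obtains g where "\<And>x. x \<in> {lo<..<hi} \<Longrightarrow> g 0 x = f x"
    "\<And>n x. x \<in> {lo<..<hi} \<Longrightarrow> (g n has_real_derivative g (Suc n) x) (at x)"
proof -
  \<comment> \<open>\<open>u = Y + ln (x / b)\<close> maps \<open>(lo, hi)\<close> into \<open>(0, Y)\<close>, inside the interval of convergence.\<close>
  define b where "b = (hi + R) / 2"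
  define Y where "Y = ln (b / lo)"
  have b: "0 < b" "hi < b" "b < R"
    using I by (auto simp: b_def)
  have Y: "0 < Y"
    using b I by (simp add: Y_def)
  obtain c where c: "\<And>u. \<lbrakk>0 \<le> u; u < Y\<rbrakk> \<Longrightarrow> (\<lambda>n. c n * u ^ n) sums f (b * exp (u - Y))"
  proof (rule Bernstein_abs_monotone[of Y "\<lambda>u. f (b * exp (u - Y))"])
    show "0 \<le> fdiff n h (\<lambda>u. f (b * exp (u - Y))) u"
      if "0 \<le> u" "0 < h" "u + real n * h < Y" for n h u
      using exp_scale_fdiff_nonneg[OF f b(1,3) that(2,3)] .
  qed (use Y in auto)
  define \<phi> where "\<phi> j u = (\<Sum>n. (diffs ^^ j) c n * u ^ n)" for j u
  define lg where "lg x = Y + ln (x / b)" for x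
  have lg_range: "0 < lg x" "lg x < Y" if "x \<in> {lo<..<hi}" for x
  proof -
    have "ln (lo / b) < ln (x / b)" "ln (x / b) < 0"
      using that b I by (auto simp: divide_strict_right_mono)
    moreover have "ln (lo / b) = - Y"
      using b I by (simp add: Y_def ln_div)
    ultimately show "0 < lg x" "lg x < Y"
      by (auto simp: lg_def)
  qed
  have summ: "summable (\<lambda>n. (diffs ^^ j) c n * u ^ n)" if "norm u < Y" for j and u :: real
    using that
  proof (induction j arbitrary: u)
    case 0
    obtain v where v: "norm u < v" "v < Y"
      using dense 0 by blast
    then show ?case
      using powser_inside[OF sums_summable[OF c[of v]], of u] by simp
  next
    case (Suc j)
    obtain v where v: "norm u < v" "v < Y"
      using dense Suc.prems by blast
    have "summable (\<lambda>n. diffs ((diffs ^^ j) c) n * u ^ n)"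
    proof (rule termdiff_converges[OF v(1)])
      show "summable (\<lambda>n. (diffs ^^ j) c n * x ^ n)" if "norm x < v" for x :: real
        by (rule Suc.IH[OF less_trans[OF that v(2)]])
    qed
    then show ?case
      unfolding funpow.simps(2) o_apply .
  qed
  have \<phi>': "(\<phi> j has_real_derivative \<phi> (Suc j) u) (at u)" if "norm u < Y" for j u
  proof -
    obtain v where v: "norm u < v" "v < Y"
      using dense[OF \<open>norm u < Y\<close>] by blast
    show ?thesis
      unfolding \<phi>_def[abs_def] funpow.simps(2) o_apply
    proof (rule termdiffs_strong)
      have "norm v = v"
        using le_less_trans[OF norm_ge_zero v(1)] by simp
      with v show "summable (\<lambda>n. (diffs ^^ j) c n * v ^ n)" "norm u < norm v"
        using summ[of v j] by simp_all
    qed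
  qed
  let ?J = "{lo<..<hi}"
  have lg': "(lg has_real_derivative 1 / x) (at x)" if "x \<in> ?J" for x
    unfolding lg_def[abs_def] using that I b by (auto intro!: derivative_eq_intros simp: field_simps)
  have "\<exists>g. \<forall>n. (log_smooth \<phi> lg (g n) \<and> (n = 0 \<longrightarrow> g n = (\<lambda>x. \<phi> 0 (lg x))))
      \<and> (\<forall>x\<in>?J. (g n has_real_derivative g (Suc n) x) (at x))"
  proof (rule dependent_nat_choice)
    show "\<exists>g. log_smooth \<phi> lg g \<and> (0 = (0::nat) \<longrightarrow> g = (\<lambda>x. \<phi> 0 (lg x)))"
      using log_smooth.comp by auto
    show "\<exists>h. (log_smooth \<phi> lg h \<and> (Suc n = 0 \<longrightarrow> h = (\<lambda>x. \<phi> 0 (lg x))))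
        \<and> (\<forall>x\<in>?J. (g has_real_derivative h x) (at x))"
      if "log_smooth \<phi> lg g \<and> (n = 0 \<longrightarrow> g = (\<lambda>x. \<phi> 0 (lg x)))" for g n
    proof -
      have "\<exists>h. log_smooth \<phi> lg h \<and> (\<forall>x\<in>?J. (g has_real_derivative h x) (at x))"
      proof (rule log_smooth_deriv)
        show "(\<phi> j has_real_derivative \<phi> (Suc j) (lg x)) (at (lg x))" if "x \<in> ?J" for j x
          using \<phi>' lg_range[OF that] by simp
      qed (use that lg' I in auto)
      then show ?thesis by auto
    qed
  qed
  then obtain g where "\<forall>n. (log_smooth \<phi> lg (g n) \<and> (n = 0 \<longrightarrow> g n = (\<lambda>x. \<phi> 0 (lg x))))
      \<and> (\<forall>x\<in>?J. (g n has_real_derivative g (Suc n) x) (at x))" ..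
  then have g: "g 0 = (\<lambda>x. \<phi> 0 (lg x))"
    "\<And>n x. x \<in> ?J \<Longrightarrow> (g n has_real_derivative g (Suc n) x) (at x)"
    by blast+
  have "g 0 x = f x" if x: "x \<in> ?J" for x
  proof -
    have "b * exp (lg x - Y) = x"
      using x b I by (simp add: lg_def)
    then show ?thesis
      using c[of "lg x"] lg_range[OF x] by (simp add: g \<phi>_def sums_iff)
  qed
  with g(2) show ?thesis
    using that by blast
qed

text \<open>
  Divide by \<open>\<epsilon>\<^sup>n\<close> and let \<open>\<epsilon>\<close> tend to \<open>0\<close>. Every sign of a Taylor coefficient below is obtained in
  this way.
\<close>

lemma leading_coeff_nonneg:
  fixes A :: real
  assumes \<eta>: "0 < \<eta>" and nn: "\<And>\<epsilon>. \<lbrakk>0 < \<epsilon>; \<epsilon> \<le> \<eta>\<rbrakk> \<Longrightarrow> 0 \<le> A * \<epsilon> ^ n + C * \<epsilon> ^ Suc n"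
  shows "0 \<le> A"
proof (rule tendsto_lowerbound)
  show "((\<lambda>\<epsilon>. A + C * \<epsilon>) \<longlongrightarrow> A) (at_right 0)"
    by (auto intro!: tendsto_eq_intros)
  show "\<forall>\<^sub>F \<epsilon> in at_right 0. 0 \<le> A + C * \<epsilon>"
    unfolding eventually_at_right_field
  proof (intro exI[of _ \<eta>] conjI allI impI)
    fix \<epsilon> assume \<epsilon>: "0 < \<epsilon>" "\<epsilon> < \<eta>"
    have "0 \<le> \<epsilon> ^ n * (A + C * \<epsilon>)"
      using nn[of \<epsilon>] \<epsilon> by (simp add: algebra_simps)
    then show "0 \<le> A + C * \<epsilon>"
      using mult_le_cancel_left_pos[of "\<epsilon> ^ n" 0 "A + C * \<epsilon>"] \<epsilon> by simp
  qed (use \<eta> in auto)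
qed simp

lemma power_exponents_commute: "(x ^ m) ^ n = (x ^ n) ^ m" for x :: "'a::monoid_mult"
  by (metis power_mult mult.commute)

text \<open>
  Let \<open>q\<close> vanish at \<open>2\<^sup>-\<^sup>j\<close> for \<open>j < n\<close>, and test the sequence \<open>f (a + \<epsilon> 2\<^sup>-\<^sup>k)\<close> with \<open>q\<^sup>2\<close>. In the
  Taylor expansion at \<open>a\<close> the term of order \<open>m\<close> contributes \<open>\<epsilon>\<^sup>m q(2\<^sup>-\<^sup>m)\<^sup>2\<close>, so the terms of order below
  \<open>n\<close> disappear and the sign of the \<open>n\<close>-th derivative decides for small \<open>\<epsilon>\<close>.
\<close>

lemma two_point_positive_derivs_nonneg:
  assumes f: "two_point_positive f R" and I: "0 < lo" "lo < hi" "hi < R"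
    and g0: "\<And>x. x \<in> {lo<..<hi} \<Longrightarrow> g 0 x = f x"
    and g': "\<And>n x. x \<in> {lo<..<hi} \<Longrightarrow> (g n has_real_derivative g (Suc n) x) (at x)"
    and a: "a \<in> {lo<..<hi}"
  shows "0 \<le> g n a"
proof -
  define \<eta> where "\<eta> = (hi - a) / 2"
  have \<eta>: "0 < \<eta>" "a + \<eta> < hi"
    using a by (auto simp: \<eta>_def field_simps)
  have "continuous_on {a..a + \<eta>} (g (Suc n))"
    using a \<eta> by (intro continuous_at_imp_continuous_on ballI DERIV_isCont[OF g']) auto
  then have "bounded (g (Suc n) ` {a..a + \<eta>})"
    using compact_continuous_image compact_imp_bounded by blast
  then obtain M where M: "\<And>x. x \<in> {a..a + \<eta>} \<Longrightarrow> \<bar>g (Suc n) x\<bar> \<le> M"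
    by (metis bounded_iff imageI real_norm_def)
  have M0: "0 \<le> M"
    using M[of a] \<eta> by force
  have taylor: "\<bar>f (a + y) - (\<Sum>m<Suc n. g m a / fact m * y ^ m)\<bar> \<le> M * y ^ Suc n"
    if y: "0 < y" "y \<le> \<eta>" for y
  proof -
    have "\<exists>t. (if a + y < a then a + y < t \<and> t < a else a < t \<and> t < a + y) \<and>
        g 0 (a + y) = (\<Sum>m<Suc n. g m a / fact m * (a + y - a) ^ m) + g (Suc n) t / fact (Suc n) * (a + y - a) ^ Suc n"
      using a y \<eta> by (intro Taylor[where a = a and b = "a + \<eta>"] allI impI g') auto
    moreover have "g 0 (a + y) = f (a + y)"
      using a y \<eta> by (intro g0) auto
    ultimately obtain t where t: "a < t" "t < a + y"
      and eq: "f (a + y) = (\<Sum>m<Suc n. g m a / fact m * y ^ m) + g (Suc n) t / fact (Suc n) * y ^ Suc n"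
      using y by (auto simp del: sum.lessThan_Suc power_Suc fact_Suc)
    have "\<bar>g (Suc n) t / fact (Suc n)\<bar> \<le> \<bar>g (Suc n) t\<bar> / 1"
      unfolding abs_divide by (intro divide_left_mono) (auto simp: fact_ge_1 simp del: fact_Suc)
    also have "\<dots> \<le> M"
      using M[of t] t y by simp
    finally have "\<bar>g (Suc n) t / fact (Suc n)\<bar> \<le> M" .
    then have "\<bar>g (Suc n) t / fact (Suc n)\<bar> * y ^ Suc n \<le> M * y ^ Suc n"
      using y by (intro mult_right_mono) auto
    then show ?thesis
      using y unfolding eq by (simp add: abs_mult del: power_Suc fact_Suc)
  qed
  define q where "q = (\<Prod>j<n. [:- ((1 / 2) ^ j), 1:] :: real poly)"
  define S where "S = (\<Sum>k\<le>degree (q * q). \<bar>coeff (q * q) k\<bar>)"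
  have q0: "poly q ((1 / 2) ^ m) = 0" if "m < n" for m
    using that by (auto simp: q_def poly_prod)
  have qn: "poly q ((1 / 2) ^ n) \<noteq> 0"
  proof -
    have "(1 / 2 :: real) ^ n < (1 / 2) ^ j" if "j < n" for j
      using that by (intro power_strict_decreasing) auto
    then have "(1 / 2 :: real) ^ n \<noteq> (1 / 2) ^ j" if "j < n" for j
      using that by force
    then show ?thesis
      by (simp add: q_def poly_prod)
  qed
  define A where "A = g n a / fact n * (poly q ((1 / 2) ^ n))\<^sup>2"
  have "0 \<le> A"
  proof (rule leading_coeff_nonneg[OF \<eta>(1), of _ n "M * S"])
    fix \<epsilon> :: real assume \<epsilon>: "0 < \<epsilon>" "\<epsilon> \<le> \<eta>"
    define \<tau> where "\<tau> k = f (a + \<epsilon> * (1 / 2) ^ k)" for k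
    define T where "T k = (\<Sum>m<Suc n. g m a / fact m * \<epsilon> ^ m * ((1 / 2) ^ m) ^ k)" for k :: nat
    have "hankel_psd \<tau>"
      unfolding \<tau>_def using a I \<epsilon> \<eta> by (intro two_point_positiveD[OF f]) auto
    then have "0 \<le> riesz \<tau> (q * q)"
      by (simp add: hankel_psd_def)
    also have "riesz \<tau> (q * q) = riesz T (q * q) + riesz (\<lambda>k. \<tau> k - T k) (q * q)"
      by (simp add: riesz_seq_diff)
    also have "riesz T (q * q) = (\<Sum>m<Suc n. g m a / fact m * \<epsilon> ^ m * poly (q * q) ((1 / 2) ^ m))"
      unfolding T_def[abs_def] riesz_seq_sum riesz_seq_cmult riesz_powers ..
    also have "\<dots> = A * \<epsilon> ^ n"
      unfolding poly_mult sum.lessThan_Suc by (simp add: q0 A_def power2_eq_square)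
    also have "riesz (\<lambda>k. \<tau> k - T k) (q * q) \<le> M * \<epsilon> ^ Suc n * S"
    proof -
      have "\<bar>\<tau> k - T k\<bar> \<le> M * \<epsilon> ^ Suc n" for k
      proof -
        have le1: "(1 / 2 :: real) ^ k \<le> 1"
          by (simp add: power_le_one)
        have le: "\<epsilon> * (1 / 2) ^ k \<le> \<epsilon> * 1"
          using \<epsilon> by (intro mult_left_mono le1) auto
        have "T k = (\<Sum>m<Suc n. g m a / fact m * (\<epsilon> * (1 / 2) ^ k) ^ m)"
          unfolding T_def by (intro sum.cong refl) (metis power_mult_distrib power_exponents_commute mult.assoc)
        then have "\<bar>\<tau> k - T k\<bar> \<le> M * (\<epsilon> * (1 / 2) ^ k) ^ Suc n"
          using taylor[of "\<epsilon> * (1 / 2) ^ k"] \<epsilon> le unfolding \<tau>_def by simp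
        also have "\<dots> \<le> M * \<epsilon> ^ Suc n"
          using \<epsilon> le M0 by (intro mult_left_mono power_mono) auto
        finally show ?thesis .
      qed
      then have "\<bar>riesz (\<lambda>k. \<tau> k - T k) (q * q)\<bar> \<le> M * \<epsilon> ^ Suc n * S"
        unfolding S_def by (rule riesz_abs_le)
      then show ?thesis
        by linarith
    qed
    finally show "0 \<le> A * \<epsilon> ^ n + M * S * \<epsilon> ^ Suc n"
      by (simp add: mult_ac)
  qed
  moreover have "A = g n a * ((poly q ((1 / 2) ^ n))\<^sup>2 / fact n)"
    by (simp add: A_def)
  moreover have "0 < (poly q ((1 / 2) ^ n))\<^sup>2 / fact n"
    using qn by simp
  ultimately show ?thesis
    by (metis mult_le_cancel_right_pos mult_zero_left)
qed

lemma fdiff_Suc_left: "fdiff (Suc n) h f u = fdiff n h (\<lambda>x. f (x + h) - f x) u"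
proof -
  have "fdiff n h (\<lambda>x. f (x + h) - f x) u = fdiff n h f (u + h) - fdiff n h f u"
    by (induction n arbitrary: u) simp_all
  then show ?thesis
    by simp
qed

text \<open>
  If all derivatives of \<open>f\<close> are nonnegative, then so are those of \<open>f (x + h) - f x\<close>, on an interval that is
  shorter by \<open>h\<close>.
\<close>

lemma fdiff_nonneg_of_derivs:
  assumes "\<And>n x. x \<in> {lo<..<hi} \<Longrightarrow> (g n has_real_derivative g (Suc n) x) (at x)"
    and "\<And>n x. x \<in> {lo<..<hi} \<Longrightarrow> 0 \<le> g n x"
    and "lo < u" "0 < h" "u + real n * h < hi"
  shows "0 \<le> fdiff n h (g 0) u"
  using assms
proof (induction n arbitrary: g hi)
  case (Suc n)
  show ?case
    unfolding fdiff_Suc_left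
  proof (rule Suc.IH[of "hi - h" "\<lambda>n x. g n (x + h) - g n x"])
    show "((\<lambda>x. g n (x + h) - g n x) has_real_derivative g (Suc n) (x + h) - g (Suc n) x) (at x)"
      if "x \<in> {lo<..<hi - h}" for n x
    proof (rule DERIV_diff)
      show "((\<lambda>x. g n (x + h)) has_real_derivative g (Suc n) (x + h)) (at x)"
        using Suc.prems(1)[of "x + h" n] that Suc.prems(4) by (simp add: DERIV_shift)
    qed (use Suc.prems that in auto)
    show "0 \<le> g n (x + h) - g n x" if "x \<in> {lo<..<hi - h}" for n x
    proof -
      have "g n x \<le> g n (x + h)"
      proof (rule DERIV_nonneg_imp_nondecreasing[where f = "g n"])
        show "\<exists>y. (g n has_real_derivative y) (at z) \<and> 0 \<le> y" if "x \<le> z" "z \<le> x + h" for z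
          using Suc.prems(1,2)[of z] that \<open>x \<in> _\<close> by (intro exI[of _ "g (Suc n) z"]) auto
      qed (use Suc.prems in auto)
      then show ?thesis by simp
    qed
  qed (use Suc.prems in \<open>auto simp: algebra_simps\<close>)
qed auto

text \<open>
  Let \<open>A\<close> be the limit from the right, which exists by monotonicity. The sequence
  \<open>f (c + 2 c (-1/2)\<^sup>k)\<close> has the entry \<open>f 0\<close> at \<open>k = 1\<close>, and its entries at \<open>k = 0, 2, 3, 4\<close> tend to \<open>A\<close>
  as \<open>c\<close> tends to \<open>0\<close>. Testing with \<open>(1 + \<epsilon> x - x\<^sup>2)\<^sup>2\<close> gives \<open>0 \<le> 2 \<epsilon> (f 0 - A) + \<epsilon>\<^sup>2 A\<close> in
  the limit, hence \<open>A \<le> f 0\<close>.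
\<close>

lemma two_point_positive_right_continuous:
  assumes f: "two_point_positive f R" and R: "0 < R"
  shows "(f \<longlongrightarrow> f 0) (at_right 0)"
proof -
  define A where "A = (INF x\<in>{0<..<R}. f x)"
  have mono: "f x \<le> f y" if "0 \<le> x" "x \<le> y" "y < R" for x y
    using two_point_positive_abs_le[OF f, of x y] that by simp
  have bdd: "bdd_below (f ` {0<..<R})"
    using mono[of 0] by (intro bdd_belowI[of _ "f 0"]) auto
  have A_le: "A \<le> f x" if "0 < x" "x < R" for x
    unfolding A_def using that by (intro cINF_lower bdd) auto
  have lim: "(f \<longlongrightarrow> A) (at_right 0)"
  proof (rule order_tendstoI)
    fix a assume "a < A"
    then show "\<forall>\<^sub>F x in at_right 0. a < f x"
      unfolding eventually_at_right_field using A_le R by (intro exI[of _ R]) force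
  next
    fix a assume "A < a"
    then obtain x where x: "0 < x" "x < R" "f x < a"
      unfolding A_def using R by (subst (asm) cINF_less_iff[OF _ bdd]) auto
    then show "\<forall>\<^sub>F y in at_right 0. f y < a"
      unfolding eventually_at_right_field
    proof (intro exI[of _ x] conjI allI impI)
      show "f y < a" if "0 < y" "y < x" for y
        using mono[of y x] that x by simp
    qed
  qed
  have lim_scale: "((\<lambda>c. f (s * c)) \<longlongrightarrow> A) (at_right 0)" if "0 < s" for s
  proof (rule filterlim_compose[OF lim])
    show "filterlim (\<lambda>c. s * c) (at_right 0) (at_right 0)"
      using that filterlim_times_pos[of "\<lambda>c. c" 0 "at_right 0" s "s * 0"]
      by (simp add: filterlim_ident mult.commute)
  qed
  have key: "0 \<le> A + 2 * \<epsilon> * f 0 + (\<epsilon>\<^sup>2 - 2) * A - 2 * \<epsilon> * A + A" for \<epsilon>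
  proof (rule tendsto_lowerbound)
    show "((\<lambda>c. f (3 * c) + 2 * \<epsilon> * f 0 + (\<epsilon>\<^sup>2 - 2) * f (3 / 2 * c) - 2 * \<epsilon> * f (3 / 4 * c) + f (9 / 8 * c))
        \<longlongrightarrow> A + 2 * \<epsilon> * f 0 + (\<epsilon>\<^sup>2 - 2) * A - 2 * \<epsilon> * A + A) (at_right 0)"
      by (intro tendsto_intros lim_scale) auto
    show "\<forall>\<^sub>F c in at_right 0.
        0 \<le> f (3 * c) + 2 * \<epsilon> * f 0 + (\<epsilon>\<^sup>2 - 2) * f (3 / 2 * c) - 2 * \<epsilon> * f (3 / 4 * c) + f (9 / 8 * c)"
      unfolding eventually_at_right_field
    proof (intro exI[of _ "R / 3"] conjI allI impI)
      fix c assume c: "0 < c" "c < R / 3"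
      have "hankel_psd (\<lambda>k. f (c + (2 * c) * (- (1 / 2)) ^ k))"
        using c by (intro two_point_positiveD[OF f]) auto
      moreover define \<tau> where "\<tau> k = f (c + (2 * c) * (- (1 / 2)) ^ k)" for k
      ultimately have "hankel_psd \<tau>"
        by (simp only: \<tau>_def[abs_def])
      then have "0 \<le> riesz \<tau> ([:1, \<epsilon>, -1:] * [:1, \<epsilon>, -1:])"
        unfolding hankel_psd_def by blast
      also have "\<dots> = \<tau> 0 + 2 * \<epsilon> * \<tau> (Suc 0) + (\<epsilon> * \<epsilon> - 2) * \<tau> (Suc (Suc 0))
          - 2 * \<epsilon> * \<tau> (Suc (Suc (Suc 0))) + \<tau> (Suc (Suc (Suc (Suc 0))))"
        by (simp add: riesz_pCons)
      finally have "0 \<le> \<tau> 0 + 2 * \<epsilon> * \<tau> (Suc 0) + (\<epsilon>\<^sup>2 - 2) * \<tau> (Suc (Suc 0))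
          - 2 * \<epsilon> * \<tau> (Suc (Suc (Suc 0))) + \<tau> (Suc (Suc (Suc (Suc 0))))"
        unfolding power2_eq_square .
      moreover have "\<tau> 0 = f (3 * c)" "\<tau> (Suc 0) = f 0" "\<tau> (Suc (Suc 0)) = f (3 / 2 * c)"
        "\<tau> (Suc (Suc (Suc 0))) = f (3 / 4 * c)" "\<tau> (Suc (Suc (Suc (Suc 0)))) = f (9 / 8 * c)"
        by (auto simp: \<tau>_def intro!: arg_cong[of _ _ f])
      ultimately show "0 \<le> f (3 * c) + 2 * \<epsilon> * f 0 + (\<epsilon>\<^sup>2 - 2) * f (3 / 2 * c) - 2 * \<epsilon> * f (3 / 4 * c) + f (9 / 8 * c)"
        by simp
    qed (use R in auto)
  qed simp
  have "0 \<le> f 0 - A"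
  proof (rule leading_coeff_nonneg[of 1 _ 1 "A / 2"])
    show "0 \<le> (f 0 - A) * \<epsilon> ^ 1 + A / 2 * \<epsilon> ^ Suc 1" if "0 < \<epsilon>" "\<epsilon> \<le> 1" for \<epsilon>
      using key[of \<epsilon>] by (simp add: algebra_simps power2_eq_square)
  qed simp
  moreover have "f 0 \<le> A"
    unfolding A_def using R mono[of 0] by (intro cINF_greatest) auto
  ultimately show ?thesis
    using lim by simp
qed

text \<open>
  Inside the interval all derivatives are nonnegative, so all forward differences are; right
  continuity carries this to differences that start at \<open>0\<close>, and Bernstein's theorem applies.
\<close>

theorem two_point_positive_power_series:
  assumes f: "two_point_positive f R" and R: "0 < R"
  obtains c where "\<And>n. 0 \<le> c n" "\<And>x. \<lbrakk>0 \<le> x; x < R\<rbrakk> \<Longrightarrow> (\<lambda>n. c n * x ^ n) sums f x"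
proof -
  have pos: "0 \<le> fdiff n h f u \<and> isCont f (u + real k * h)" if u: "0 < u" "0 < h" "u + real n * h < R" "k \<le> n" for n h u k
  proof -
    define lo where "lo = u / 2"
    define hi where "hi = (u + real n * h + R) / 2"
    have nh: "0 \<le> real n * h"
      using u by simp
    have I: "0 < lo" "lo < hi" "hi < R" and u': "lo < u" "u + real n * h < hi"
      using u nh unfolding lo_def hi_def by argo+
    obtain g where g: "\<And>x. x \<in> {lo<..<hi} \<Longrightarrow> g 0 x = f x"
      "\<And>n x. x \<in> {lo<..<hi} \<Longrightarrow> (g n has_real_derivative g (Suc n) x) (at x)"
      using two_point_positive_smooth[OF f I] by metis
    have nn: "0 \<le> g n x" if "x \<in> {lo<..<hi}" for n x
      using two_point_positive_derivs_nonneg[OF f I g that] .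
    have ran: "u + real j * h \<in> {lo<..<hi}" if "j \<le> n" for j
    proof -
      have "real j * h \<le> real n * h"
        using that u by (intro mult_right_mono) auto
      moreover have "0 \<le> real j * h"
        using u by simp
      ultimately show ?thesis
        using u' unfolding greaterThanLessThan_iff by linarith
    qed
    have "0 \<le> fdiff n h (g 0) u"
      by (rule fdiff_nonneg_of_derivs[where lo = lo and hi = hi]) (use u u' g(2) nn in auto)
    also have "fdiff n h (g 0) u = fdiff n h f u"
      unfolding fdiff_eq_sum using ran by (intro sum.cong) (auto simp: g(1))
    moreover have "isCont f (u + real k * h)"
    proof -
      have "isCont (g 0) (u + real k * h)"
        using DERIV_isCont[OF g(2)[OF ran[OF \<open>k \<le> n\<close>]]] .
      moreover have "\<forall>\<^sub>F x in nhds (u + real k * h). g 0 x = f x"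
        using g(1) ran[OF \<open>k \<le> n\<close>] by (intro eventually_nhds_in_open[THEN eventually_mono, of "{lo<..<hi}"]) auto
      ultimately show ?thesis
        by (metis isCont_cong)
    qed
    ultimately show ?thesis by simp
  qed
  show ?thesis
  proof (rule Bernstein_abs_monotone[OF _ R])
    fix n h u assume u: "0 \<le> u" "0 < h" "u + real n * h < R"
    show "0 \<le> fdiff n h f u"
    proof (cases "u = 0")
      case True
      have "((\<lambda>v. fdiff n h f v) \<longlongrightarrow> fdiff n h f 0) (at_right 0)"
        unfolding fdiff_eq_sum
      proof (intro tendsto_intros)
        fix k assume k: "k \<in> {..n}"
        show "((\<lambda>v. f (v + real k * h)) \<longlongrightarrow> f (0 + real k * h)) (at_right 0)"
        proof (cases k)
          case 0
          then show ?thesis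
            using two_point_positive_right_continuous[OF f R] by simp
        next
          case (Suc j)
          have "real k * h \<le> real n * h"
            using k u by (intro mult_right_mono) auto
          then have "h + real j * h < R"
            using u True Suc by (simp add: algebra_simps)
          then have "isCont f (h + real j * h)"
            using pos[of h h j j] u by auto
          then have "isCont f (0 + real k * h)"
            by (simp add: Suc algebra_simps)
          then show ?thesis
            by (rule isCont_tendsto_compose) (auto intro!: tendsto_eq_intros)
        qed
      qed
      moreover have "\<forall>\<^sub>F v in at_right 0. 0 \<le> fdiff n h f v"
        unfolding eventually_at_right_field
      proof (intro exI[of _ "R - real n * h"] conjI allI impI)
        show "0 \<le> fdiff n h f v" if "0 < v" "v < R - real n * h" for v
          using pos[of v h n 0] that u by auto
      qed (use u True in auto)
      ultimately show ?thesis
        unfolding True by (intro tendsto_lowerbound) auto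
    next
      case False
      then show ?thesis
        using pos[of u h n 0] u by auto
    qed
  qed (use that in blast)
qed

section \<open>Power series along rays\<close>

definition mpow :: "real ^ 'm::finite \<Rightarrow> ('m \<Rightarrow> nat) \<Rightarrow> real" where
  "mpow x \<alpha> = (\<Prod>i\<in>UNIV. x $ i ^ \<alpha> i)"

definition orthant_box :: "ereal \<Rightarrow> (real ^ 'm::finite) set" where
  "orthant_box \<rho> = {x. \<forall>i. 0 \<le> x $ i \<and> ereal (x $ i) < \<rho>}"

text \<open>
  The common outcome of Hankel positivity and of absolute monotonicity on which the multivariate
  expansion rests: on every nonnegative ray inside the box, \<open>F\<close> is a power series with nonnegative
  coefficients. Rays with any starting point \<open>a\<close> are included; interpolation on segments relies on them.
\<close>

definition ray_series :: "ereal \<Rightarrow> (real ^ 'm::finite \<Rightarrow> real) \<Rightarrow> bool" where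
  "ray_series \<rho> F \<longleftrightarrow> (\<forall>a b R. (\<forall>i. 0 \<le> a $ i \<and> 0 \<le> b $ i) \<and> 0 < R \<and>
      (\<forall>z. 0 \<le> z \<and> z < R \<longrightarrow> a + z *\<^sub>R b \<in> orthant_box \<rho>) \<longrightarrow>
      (\<exists>c. (\<forall>n. 0 \<le> c n) \<and> (\<forall>z. 0 \<le> z \<and> z < R \<longrightarrow> (\<lambda>n. c n * z ^ n) sums F (a + z *\<^sub>R b))))"

lemma orthant_box_slack:
  fixes x b :: "real ^ 'm::finite"
  assumes nn: "\<And>i. 0 \<le> x $ i" "\<And>i. 0 \<le> b $ i" and xb: "x + b \<in> orthant_box \<rho>"
  obtains R where "1 < R" "\<And>z. \<lbrakk>0 \<le> z; z < R\<rbrakk> \<Longrightarrow> x + z *\<^sub>R b \<in> orthant_box \<rho>"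
proof -
  have "\<exists>R>1. \<forall>z. 0 \<le> z \<and> z < R \<longrightarrow> ereal (x $ i + z * b $ i) < \<rho>" for i
  proof -
    have "ereal (x $ i + b $ i) < \<rho>"
      using xb by (simp add: orthant_box_def)
    then obtain s where s: "ereal (x $ i + b $ i) < ereal s" "ereal s < \<rho>"
      using ereal_dense2 by blast
    define d where "d = s - (x $ i + b $ i)"
    have d: "0 < d"
      using s by (simp add: d_def)
    show ?thesis
    proof (intro exI[of _ "1 + d / (b $ i + 1)"] conjI allI impI)
      show "1 < 1 + d / (b $ i + 1)"
        using d nn(2)[of i] by simp
      fix z assume z: "0 \<le> z \<and> z < 1 + d / (b $ i + 1)"
      then have "z * b $ i \<le> (1 + d / (b $ i + 1)) * b $ i"
        using nn(2)[of i] by (intro mult_right_mono) auto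
      also have "\<dots> = b $ i + d * (b $ i / (b $ i + 1))"
        by (simp add: distrib_right)
      also have "d * (b $ i / (b $ i + 1)) \<le> d * 1"
        using d nn(2)[of i] by (intro mult_left_mono) auto
      finally have "x $ i + z * b $ i \<le> s"
        by (simp add: d_def)
      then show "ereal (x $ i + z * b $ i) < \<rho>"
        using s(2) by (metis ereal_less_eq(3) le_less_trans)
    qed
  qed
  then obtain R where R: "\<And>i. 1 < R i" "\<And>i z. \<lbrakk>0 \<le> z; z < R i\<rbrakk> \<Longrightarrow> ereal (x $ i + z * b $ i) < \<rho>"
    by metis
  have "1 < Min (range R)"
    using R(1) by (subst Min_gr_iff) auto
  moreover have "x + z *\<^sub>R b \<in> orthant_box \<rho>" if "0 \<le> z" "z < Min (range R)" for z
  proof -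
    have "z < R i" for i
      using that(2) by (subst (asm) Min_gr_iff) auto
    then show ?thesis
      using R(2) that(1) nn by (auto simp: orthant_box_def)
  qed
  ultimately show ?thesis
    using that by blast
qed

lemma ray_series_unit:
  assumes F: "ray_series \<rho> F" and nn: "\<And>i. 0 \<le> x $ i" "\<And>i. 0 \<le> b $ i" and xb: "x + b \<in> orthant_box \<rho>"
  obtains c where "\<And>n. 0 \<le> c n" "\<And>z. \<lbrakk>0 \<le> z; z \<le> 1\<rbrakk> \<Longrightarrow> (\<lambda>n. c n * z ^ n) sums F (x + z *\<^sub>R b)"
proof -
  obtain R where R: "1 < R" "\<And>z. \<lbrakk>0 \<le> z; z < R\<rbrakk> \<Longrightarrow> x + z *\<^sub>R b \<in> orthant_box \<rho>"
    using orthant_box_slack[OF nn xb] by blast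
  then have "\<exists>c. (\<forall>n. 0 \<le> c n) \<and> (\<forall>z. 0 \<le> z \<and> z < R \<longrightarrow> (\<lambda>n. c n * z ^ n) sums F (x + z *\<^sub>R b))"
    using F[unfolded ray_series_def, rule_format, of x b R] nn by simp
  then obtain c where "\<And>n. 0 \<le> c n" "\<And>z. \<lbrakk>0 \<le> z; z < R\<rbrakk> \<Longrightarrow> (\<lambda>n. c n * z ^ n) sums F (x + z *\<^sub>R b)"
    by blast
  then show ?thesis
    using that[of c] R(1) by simp
qed

lemma ray_series_mono:
  assumes F: "ray_series \<rho> F" and nn: "\<And>i. 0 \<le> x $ i" "\<And>i. 0 \<le> b $ i" and xb: "x + b \<in> orthant_box \<rho>"
  shows "F x \<le> F (x + b)"
proof -
  obtain c where c: "\<And>n. 0 \<le> c n" "\<And>z. \<lbrakk>0 \<le> z; z \<le> 1\<rbrakk> \<Longrightarrow> (\<lambda>n. c n * z ^ n) sums F (x + z *\<^sub>R b)"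
    using ray_series_unit[OF F nn xb] by blast
  have "c 0 = F x"
    using sums_unique2[OF powser_sums_zero, of c "F x"] c(2)[of 0] by simp
  moreover have "sum c {0} \<le> F (x + b)"
    using c(2)[of 1] c(1) by (intro sum_le_suminf[THEN order_trans]) (auto simp: sums_iff)
  ultimately show ?thesis
    by simp
qed

text \<open>
  The homogeneous part of degree \<open>n\<close> of \<open>F\<close>, read off as the coefficient of \<open>z\<^sup>n\<close> on the ray through
  \<open>b\<close>.
\<close>

definition hom_part :: "(real ^ 'm::finite \<Rightarrow> real) \<Rightarrow> nat \<Rightarrow> real ^ 'm \<Rightarrow> real" where
  "hom_part F n b = (SOME c. (\<forall>n. 0 \<le> c n) \<and>
      (\<forall>z. 0 \<le> z \<and> z \<le> 1 \<longrightarrow> (\<lambda>n. c n * z ^ n) sums F (z *\<^sub>R b))) n"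

lemma hom_part:
  assumes F: "ray_series \<rho> F" and b: "b \<in> orthant_box \<rho>"
  shows "0 \<le> hom_part F n b" "\<lbrakk>0 \<le> z; z \<le> 1\<rbrakk> \<Longrightarrow> (\<lambda>n. hom_part F n b * z ^ n) sums F (z *\<^sub>R b)"
proof -
  obtain c where "\<And>n. 0 \<le> c n" "\<And>z. \<lbrakk>0 \<le> z; z \<le> 1\<rbrakk> \<Longrightarrow> (\<lambda>n. c n * z ^ n) sums F (0 + z *\<^sub>R b)"
    using ray_series_unit[OF F, of 0 b] b by (auto simp: orthant_box_def)
  then have "\<exists>c. (\<forall>n. 0 \<le> c n) \<and> (\<forall>z. 0 \<le> z \<and> z \<le> 1 \<longrightarrow> (\<lambda>n. c n * z ^ n) sums F (z *\<^sub>R b))"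
    by (intro exI[of _ c]) auto
  from someI_ex[OF this] show "0 \<le> hom_part F n b"
    "\<lbrakk>0 \<le> z; z \<le> 1\<rbrakk> \<Longrightarrow> (\<lambda>n. hom_part F n b * z ^ n) sums F (z *\<^sub>R b)"
    unfolding hom_part_def by blast+
qed

lemma orthant_box_le:
  assumes "y \<in> orthant_box \<rho>" "\<And>i. 0 \<le> x $ i" "\<And>i. x $ i \<le> y $ i"
  shows "x \<in> orthant_box \<rho>"
  unfolding orthant_box_def mem_Collect_eq
proof (intro allI conjI)
  fix i
  have "ereal (y $ i) < \<rho>"
    using assms(1) by (simp add: orthant_box_def)
  moreover have "ereal (x $ i) \<le> ereal (y $ i)"
    using assms(3) by simp
  ultimately show "ereal (x $ i) < \<rho>"
    by (rule le_less_trans[rotated])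
qed (use assms(2) in auto)

lemma orthant_box_scale:
  assumes b: "b \<in> orthant_box \<rho>" and s: "0 \<le> s" "s \<le> 1"
  shows "s *\<^sub>R b \<in> orthant_box \<rho>"
  unfolding orthant_box_def mem_Collect_eq
proof (intro allI conjI)
  fix i
  have b': "0 \<le> b $ i" "ereal (b $ i) < \<rho>"
    using b by (auto simp: orthant_box_def)
  then show "0 \<le> (s *\<^sub>R b) $ i"
    using s by simp
  have "s * b $ i \<le> b $ i"
    using b' s by (simp add: mult_left_le_one_le)
  then show "ereal ((s *\<^sub>R b) $ i) < \<rho>"
    using b'(2) by (simp add: le_less_trans[of _ "ereal (b $ i)"])
qed

lemma hom_part_scale:
  assumes F: "ray_series \<rho> F" and b: "b \<in> orthant_box \<rho>" and s: "0 \<le> s" "s \<le> 1"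
  shows "hom_part F n (s *\<^sub>R b) = s ^ n * hom_part F n b"
proof -
  have "(\<lambda>n. hom_part F n (s *\<^sub>R b)) = (\<lambda>n. hom_part F n b * s ^ n)"
  proof (rule power_series_unique[of 1])
    fix z :: real assume z: "0 \<le> z" "z < 1"
    show "(\<lambda>n. hom_part F n (s *\<^sub>R b) * z ^ n) sums F (z *\<^sub>R s *\<^sub>R b)"
      using hom_part(2)[OF F orthant_box_scale[OF b s]] z by simp
    have "s * z \<le> 1"
      using s z by (simp add: mult_le_one)
    then have "(\<lambda>n. hom_part F n b * (s * z) ^ n) sums F ((s * z) *\<^sub>R b)"
      using hom_part(2)[OF F b, of "s * z"] s z by simp
    then show "(\<lambda>n. hom_part F n b * s ^ n * z ^ n) sums F (z *\<^sub>R s *\<^sub>R b)"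
      by (simp add: power_mult_distrib mult_ac)
  qed simp
  then show ?thesis
    by (metis mult.commute)
qed

text \<open>
  A power series of size \<open>O(z\<^sup>N)\<close> at \<open>0\<close> has no coefficients of index below \<open>N\<close>.
\<close>

lemma power_series_coeffs_below_order:
  fixes e :: "nat \<Rightarrow> real"
  assumes G: "\<And>z. \<lbrakk>0 \<le> z; z \<le> 1\<rbrakk> \<Longrightarrow> (\<lambda>n. e n * z ^ n) sums G z"
    and bd: "\<And>z. \<lbrakk>0 < z; z \<le> 1\<rbrakk> \<Longrightarrow> \<bar>G z\<bar> \<le> C * z ^ N" and k: "k < N"
  shows "e k = 0"
  using k
proof (induction k rule: less_induct)
  case (less k)
  have zero: "e j = 0" if "j < k" for j
    using less that by simp
  define h where "h z = (\<Sum>n. e (n + k) * z ^ n)" for z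
  have shift: "(\<lambda>n. e (n + k) * z ^ n * z ^ k) sums G z" if "0 \<le> z" "z \<le> 1" for z
    using sums_zero_iff_shift[of k "\<lambda>n. e n * z ^ n" "G z"] zero G[OF that]
    by (simp add: power_add mult.assoc)
  have hG: "h z * z ^ k = G z" if "0 < z" "z \<le> 1" for z
  proof -
    have "(\<lambda>n. e (n + k) * z ^ n * z ^ k / z ^ k) sums (G z / z ^ k)"
      using shift[of z] that by (intro sums_divide) auto
    then have "h z = G z / z ^ k"
      using that by (simp add: h_def sums_iff)
    then show ?thesis
      using that by simp
  qed
  have "summable (\<lambda>n. e (n + k) * 1 ^ n)"
    using shift[of 1] by (simp add: sums_iff)
  then have "isCont h 0"
    unfolding h_def[abs_def] by (rule isCont_powser) simp
  then have lim: "(h \<longlongrightarrow> e k) (at_right 0)"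
  proof -
    have "h 0 = e k"
      by (simp add: h_def)
    moreover have "(h \<longlongrightarrow> h 0) (at_right 0)"
      by (rule tendsto_mono[OF _ isContD[OF \<open>isCont h 0\<close>]]) (simp add: at_le)
    ultimately show ?thesis
      by simp
  qed
  have "((\<lambda>z. C * z ^ (N - k)) \<longlongrightarrow> 0) (at_right 0)"
    using less.prems by (auto intro!: tendsto_eq_intros)
  moreover have "\<forall>\<^sub>F z in at_right 0. norm (h z) \<le> C * z ^ (N - k)"
    unfolding eventually_at_right_field
  proof (intro exI[of _ 1] conjI allI impI)
    fix z :: real assume z: "0 < z" "z < 1"
    have "\<bar>h z\<bar> * z ^ k \<le> C * z ^ (N - k) * z ^ k"
    proof -
      have "\<bar>h z\<bar> * z ^ k = \<bar>G z\<bar>"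
        using hG[of z] z by (simp add: abs_mult flip: hG)
      also have "\<dots> \<le> C * z ^ N"
        using bd z by simp
      also have "z ^ N = z ^ (N - k) * z ^ k"
        using less.prems by (simp flip: power_add)
      finally show ?thesis
        by (simp add: mult.assoc)
    qed
    then show "norm (h z) \<le> C * z ^ (N - k)"
      using z by simp
  qed simp
  ultimately have "(h \<longlongrightarrow> 0) (at_right 0)"
    by (rule Lim_null_comparison[rotated])
  then show ?case
    using tendsto_unique[OF _ lim] by simp
qed

subsection \<open>The homogeneous parts are polynomials\<close>

definition lagrange_poly :: "real set \<Rightarrow> real \<Rightarrow> real poly" where
  "lagrange_poly Z w = (\<Prod>v\<in>Z - {w}. Polynomial.smult (1 / (w - v)) [:- v, 1:])"

lemma lagrange_poly_at:
  assumes "finite Z" "w \<in> Z" "v \<in> Z"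
  shows "poly (lagrange_poly Z w) v = (if v = w then 1 else 0)"
proof (cases "v = w")
  case True
  then show ?thesis
    unfolding lagrange_poly_def poly_prod
    by (auto intro!: prod.neutral simp: diff_divide_distrib[symmetric])
next
  case False
  then have "poly (lagrange_poly Z w) v = 0"
    unfolding lagrange_poly_def poly_prod using assms by (intro prod_zero) auto
  then show ?thesis
    using False by simp
qed

lemma degree_lagrange_poly:
  assumes "finite Z" "w \<in> Z"
  shows "degree (lagrange_poly Z w) < card Z"
proof -
  have "degree (lagrange_poly Z w) \<le> (\<Sum>v\<in>Z - {w}. degree (Polynomial.smult (1 / (w - v)) [:- v, 1:]))"
    unfolding lagrange_poly_def using assms by (intro degree_prod_sum_le[THEN order_trans]) (auto simp: o_def)
  also have "\<dots> \<le> (\<Sum>v\<in>Z - {w}. 1)"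
    by (intro sum_mono) (auto intro: degree_smult_le[THEN order_trans])
  also have "\<dots> = card Z - 1"
    using assms by simp
  finally show ?thesis
    using assms card_gt_0_iff[of Z] by auto
qed

lemma lagrange_exact:
  assumes Z: "finite Z" and n: "n < card Z"
  shows "(\<Sum>w\<in>Z. w ^ n * poly (lagrange_poly Z w) z) = z ^ n"
proof -
  define q where "q = (\<Sum>w\<in>Z. Polynomial.smult (w ^ n) (lagrange_poly Z w))"
  have "q = monom 1 n"
  proof (rule poly_eqI_degree[of Z])
    show "poly q v = poly (monom 1 n) v" if v: "v \<in> Z" for v
    proof -
      have "poly q v = (\<Sum>w\<in>Z. if v = w then w ^ n else 0)"
        unfolding q_def poly_sum using Z v by (intro sum.cong) (auto simp: lagrange_poly_at)
      then show ?thesis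
        using Z v by (simp add: poly_monom)
    qed
    have "degree q \<le> card Z - 1"
      unfolding q_def using degree_lagrange_poly[OF Z]
      by (intro degree_sum_le Z degree_smult_le[THEN order_trans]) fastforce
    then show "degree q < card Z"
      using n by simp
    show "degree (monom (1::real) n) < card Z"
      using n by (simp add: degree_monom_eq)
  qed
  then have "poly q z = z ^ n"
    by (simp add: poly_monom)
  then show ?thesis
    by (simp add: q_def poly_sum)
qed

text \<open>
  Fix \<open>s\<close>. As a function of \<open>z\<close>, \<open>F (s (x + z b))\<close> is a power series in \<open>s z\<close> with nonnegative
  coefficients, and Lagrange interpolation is exact on its first \<open>N = card Z\<close> terms. The
  interpolation error is therefore \<open>O(s\<^sup>N)\<close>. Expanded in powers of \<open>s\<close>, it has as its \<open>k\<close>-th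
  coefficient the interpolation error of the \<open>k\<close>-th homogeneous part, which must vanish for \<open>k < N\<close>.
\<close>

lemma hom_part_interpolation:
  fixes F :: "real ^ 'm::finite \<Rightarrow> real"
  assumes F: "ray_series \<rho> F" and nn: "\<And>i. 0 \<le> x $ i" "\<And>i. 0 \<le> b $ i" and xb: "x + b \<in> orthant_box \<rho>"
    and Z: "finite Z" "Z \<subseteq> {0..1}" and k: "k < card Z" and z: "0 \<le> z" "z \<le> 1"
  shows "hom_part F k (x + z *\<^sub>R b) = (\<Sum>w\<in>Z. hom_part F k (x + w *\<^sub>R b) * poly (lagrange_poly Z w) z)"
proof -
  let ?L = "\<lambda>w. poly (lagrange_poly Z w) z"
  have mem: "x + w *\<^sub>R b \<in> orthant_box \<rho>" if w: "0 \<le> w" "w \<le> 1" for w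
  proof -
    have "x $ i + w * b $ i \<le> x $ i + b $ i" for i
      using nn(2)[of i] w by (simp add: mult_left_le_one_le)
    then show ?thesis
      using nn w by (intro orthant_box_le[OF xb]) auto
  qed
  define e where "e n = hom_part F n (x + z *\<^sub>R b) - (\<Sum>w\<in>Z. hom_part F n (x + w *\<^sub>R b) * ?L w)" for n
  define G where "G s = F (s *\<^sub>R (x + z *\<^sub>R b)) - (\<Sum>w\<in>Z. F (s *\<^sub>R (x + w *\<^sub>R b)) * ?L w)" for s
  define C where "C = 1 + (\<Sum>w\<in>Z. \<bar>?L w\<bar>)"
  \<comment> \<open>\<open>G s\<close> is the interpolation error at scale \<open>s\<close>, and \<open>e\<close> lists its coefficients in powers of \<open>s\<close>.\<close>
  have "e k = 0"
  proof (rule power_series_coeffs_below_order[of e G "C * F (x + b)" "card Z"])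
    fix s :: real assume s: "0 \<le> s" "s \<le> 1"
    have "(\<lambda>n. hom_part F n (x + z *\<^sub>R b) * s ^ n - (\<Sum>w\<in>Z. hom_part F n (x + w *\<^sub>R b) * s ^ n * ?L w)) sums G s"
      unfolding G_def using Z s z
      by (intro sums_diff sums_sum sums_mult2 hom_part(2)[OF F] mem) auto
    then show "(\<lambda>n. e n * s ^ n) sums G s"
      by (simp add: e_def algebra_simps sum_distrib_left)
  next
    fix s :: real assume s: "0 < s" "s \<le> 1"
    have sx: "\<And>i. 0 \<le> (s *\<^sub>R x) $ i"
      using nn s by simp
    have sxb: "s *\<^sub>R x + b \<in> orthant_box \<rho>"
    proof -
      have "s * x $ i + b $ i \<le> x $ i + b $ i" for i
        using nn(1)[of i] s by (simp add: mult_left_le_one_le)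
      then show ?thesis
        using nn s by (intro orthant_box_le[OF xb]) auto
    qed
    obtain R where R: "\<And>n. 0 \<le> R n" "\<And>w. \<lbrakk>0 \<le> w; w \<le> 1\<rbrakk> \<Longrightarrow> (\<lambda>n. R n * w ^ n) sums F (s *\<^sub>R x + w *\<^sub>R b)"
      using ray_series_unit[OF F sx nn(2) sxb] by blast
    have R': "(\<lambda>n. R n * (s * w) ^ n) sums F (s *\<^sub>R (x + w *\<^sub>R b))" if "0 \<le> w" "w \<le> 1" for w
    proof -
      have "s * w \<le> 1"
        using s that by (simp add: mult_le_one)
      then show ?thesis
        using R(2)[of "s * w"] s that by (simp add: scaleR_add_right)
    qed
    \<comment> \<open>The interpolation error of the monomial \<open>z\<^sup>n\<close>; it vanishes below \<open>card Z\<close>.\<close>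
    define \<delta> where "\<delta> n = z ^ n - (\<Sum>w\<in>Z. w ^ n * ?L w)" for n
    have \<delta>0: "\<delta> n = 0" if "n < card Z" for n
      using lagrange_exact[OF Z(1) that] by (simp add: \<delta>_def)
    have \<delta>C: "\<bar>\<delta> n\<bar> \<le> C" for n
    proof -
      have "\<bar>\<delta> n\<bar> \<le> \<bar>z ^ n\<bar> + \<bar>\<Sum>w\<in>Z. w ^ n * ?L w\<bar>"
        unfolding \<delta>_def by (rule abs_triangle_ineq4)
      also have "\<bar>\<Sum>w\<in>Z. w ^ n * ?L w\<bar> \<le> (\<Sum>w\<in>Z. \<bar>w ^ n * ?L w\<bar>)"
        by (rule sum_abs)
      also have "\<dots> \<le> (\<Sum>w\<in>Z. \<bar>?L w\<bar>)"
      proof (intro sum_mono)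
        fix w assume "w \<in> Z"
        then have "0 \<le> w ^ n" "w ^ n \<le> 1"
          using Z by (auto intro!: power_le_one)
        then show "\<bar>w ^ n * ?L w\<bar> \<le> \<bar>?L w\<bar>"
          by (simp add: abs_mult mult_left_le_one_le)
      qed
      also have "\<bar>z ^ n\<bar> \<le> 1"
        using z by (simp add: power_le_one)
      finally show ?thesis
        by (simp add: C_def)
    qed
    have C0: "0 \<le> C"
      using \<delta>C[of 0] by linarith
    have "(\<lambda>n. R n * (s * z) ^ n - (\<Sum>w\<in>Z. R n * (s * w) ^ n * ?L w)) sums G s"
      unfolding G_def using Z z by (intro sums_diff sums_sum sums_mult2 R') auto
    moreover have "R n * (s * z) ^ n - (\<Sum>w\<in>Z. R n * (s * w) ^ n * ?L w) = R n * s ^ n * \<delta> n" for n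
      by (simp add: \<delta>_def power_mult_distrib right_diff_distrib sum_distrib_left mult_ac)
    ultimately have G: "(\<lambda>n. R n * s ^ n * \<delta> n) sums G s"
      by simp
    have RF: "R sums F (s *\<^sub>R x + b)"
      using R(2)[of 1] by simp
    have "\<bar>R n * s ^ n * \<delta> n\<bar> \<le> s ^ card Z * C * R n" for n
    proof (cases "n < card Z")
      case False
      then have "s ^ n \<le> s ^ card Z"
        using s by (intro power_decreasing) auto
      then have "(s ^ n * R n) * \<bar>\<delta> n\<bar> \<le> (s ^ card Z * R n) * C"
        using s R(1) \<delta>C by (intro mult_mono mult_right_mono) auto
      then show ?thesis
        using s R(1) by (simp add: abs_mult mult_ac)
    qed (use s R(1) C0 in \<open>simp add: \<delta>0\<close>)
    then have "\<bar>G s\<bar> \<le> s ^ card Z * C * F (s *\<^sub>R x + b)"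
      using norm_sums_le[OF G sums_mult[OF RF, of "s ^ card Z * C"]] by simp
    also have "\<dots> \<le> s ^ card Z * C * F (x + b)"
    proof -
      have "F (s *\<^sub>R x + b) \<le> F ((s *\<^sub>R x + b) + (1 - s) *\<^sub>R x)"
        using nn s xb by (intro ray_series_mono[OF F]) (auto simp: algebra_simps simp flip: scaleR_add_left intro!: mult_left_le_one_le)
      then have "F (s *\<^sub>R x + b) \<le> F (x + b)"
        by (simp add: algebra_simps)
      then show ?thesis
        using s C0 by (intro mult_left_mono) auto
    qed
    finally show "\<bar>G s\<bar> \<le> C * F (x + b) * s ^ card Z"
      by (simp add: mult_ac)
  qed (rule k)
  then show ?thesis
    by (simp add: e_def)
qed

definition multi_deg :: "nat \<Rightarrow> ('m::finite \<Rightarrow> nat) set" where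
  "multi_deg k = {\<alpha>. sum \<alpha> UNIV = k}"

lemma finite_multi_deg: "finite (multi_deg k :: ('m::finite \<Rightarrow> nat) set)"
proof (rule finite_subset)
  show "multi_deg k \<subseteq> (PiE (UNIV :: 'm set) (\<lambda>_. {..k}))"
  proof
    fix \<alpha> :: "'m \<Rightarrow> nat" assume "\<alpha> \<in> multi_deg k"
    then have "\<alpha> i \<le> k" for i
      using member_le_sum[of i UNIV \<alpha>] by (simp add: multi_deg_def)
    then show "\<alpha> \<in> (PiE (UNIV :: 'm set) (\<lambda>_. {..k}))"
      by (simp add: PiE_iff)
  qed
qed (intro finite_PiE; simp)

lemma mpow_add: "mpow x (\<lambda>i. \<alpha> i + \<beta> i) = mpow x \<alpha> * mpow x \<beta>"
  by (simp add: mpow_def power_add prod.distrib)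

lemma mpow_scaleR: "mpow (s *\<^sub>R x) \<alpha> = s ^ sum \<alpha> UNIV * mpow x \<alpha>"
  by (simp add: mpow_def power_mult_distrib prod.distrib power_sum)

lemma mpow_nonneg: "(\<And>i. 0 \<le> x $ i) \<Longrightarrow> 0 \<le> mpow x \<alpha>"
  unfolding mpow_def by (intro prod_nonneg) auto

lemma real_polynomial_function_update:
  assumes "real_polynomial_function p"
  shows "real_polynomial_function (\<lambda>x :: real ^ 'm::finite. p (\<chi> j. if j = i then c else x $ j))"
  using assms
proof induction
  case (linear f)
  have "(\<chi> j. if j = i then c else x $ j) = x + (c - x $ i) *\<^sub>R axis i 1" for x :: "real ^ 'm"
    by (simp add: Finite_Cartesian_Product.vec_eq_iff axis_def)
  then have "f (\<chi> j. if j = i then c else x $ j) = f x + (c - x $ i) * f (axis i 1)" for x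
    using linear by (simp add: bounded_linear.linear linear_add linear_scale)
  moreover have "real_polynomial_function (\<lambda>x. f x + (c - x $ i) * f (axis i 1))"
    using linear by (intro real_polynomial_function.intros(3,4) real_polynomial_function_diff
        real_polynomial_function.intros(1) real_polynomial_function.intros(2) bounded_linear_vec_nth)
  ultimately show ?case
    by simp
qed auto

lemma real_polynomial_function_monomials:
  assumes "real_polynomial_function p"
  shows "\<exists>A c. finite A \<and> (\<forall>x :: real ^ 'm::finite. p x = (\<Sum>\<alpha>\<in>A. c \<alpha> * mpow x \<alpha>))"
  using assms
proof induction
  case (linear f)
  define e where "e i = (\<lambda>j :: 'm. if j = i then 1 else 0 :: nat)" for i
  have inj: "inj e"
    by (rule injI) (metis (mono_tags) e_def zero_neq_one)
  have me: "mpow x (e i) = x $ i" for x :: "real ^ 'm" and i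
    by (simp add: mpow_def e_def if_distrib[of "\<lambda>k. _ ^ k"] cong: if_cong)
  have f_eq: "f x = (\<Sum>i\<in>UNIV. x $ i * f (axis i 1))" for x
  proof -
    have "f x = f (\<Sum>i\<in>UNIV. x $ i *\<^sub>R axis i 1)"
      using basis_expansion[of x] by (simp add: scalar_mult_eq_scaleR)
    then show ?thesis
      using linear by (simp add: bounded_linear.linear linear_sum linear_scale)
  qed
  show ?case
  proof (intro exI[of _ "range e"] exI[of _ "\<lambda>\<alpha>. f (axis (inv_into UNIV e \<alpha>) 1)"] conjI allI)
    show "f x = (\<Sum>\<alpha>\<in>range e. f (axis (inv_into UNIV e \<alpha>) 1) * mpow x \<alpha>)" for x
      unfolding f_eq[of x] by (subst sum.reindex) (auto simp: inj me mult.commute)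
  qed simp
next
  case (const k)
  show ?case
    by (intro exI[of _ "{\<lambda>_. 0}"] exI[of _ "\<lambda>_. k"]) (simp add: mpow_def)
next
  case (add f g)
  then obtain A c B d where A: "finite A" "\<And>x. f x = (\<Sum>\<alpha>\<in>A. c \<alpha> * mpow x \<alpha>)"
    and B: "finite B" "\<And>x. g x = (\<Sum>\<alpha>\<in>B. d \<alpha> * mpow x \<alpha>)"
    by metis
  show ?case
  proof (intro exI[of _ "A \<union> B"] exI[of _ "\<lambda>\<alpha>. (if \<alpha> \<in> A then c \<alpha> else 0) + (if \<alpha> \<in> B then d \<alpha> else 0)"] conjI allI)
    fix x
    have "(\<Sum>\<alpha>\<in>A \<union> B. (if \<alpha> \<in> A then c \<alpha> else 0) * mpow x \<alpha>) = f x"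
      unfolding A(2) using A(1) B(1) by (intro sum.mono_neutral_cong_right) auto
    moreover have "(\<Sum>\<alpha>\<in>A \<union> B. (if \<alpha> \<in> B then d \<alpha> else 0) * mpow x \<alpha>) = g x"
      unfolding B(2) using A(1) B(1) by (intro sum.mono_neutral_cong_right) auto
    ultimately show "f x + g x = (\<Sum>\<alpha>\<in>A \<union> B. ((if \<alpha> \<in> A then c \<alpha> else 0) + (if \<alpha> \<in> B then d \<alpha> else 0)) * mpow x \<alpha>)"
      by (simp add: distrib_right sum.distrib)
  qed (use A B in auto)
next
  case (mult f g)
  then obtain A c B d where A: "finite A" "\<And>x. f x = (\<Sum>\<alpha>\<in>A. c \<alpha> * mpow x \<alpha>)"
    and B: "finite B" "\<And>x. g x = (\<Sum>\<alpha>\<in>B. d \<alpha> * mpow x \<alpha>)"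
    by metis
  define pl where "pl ab = (\<lambda>i. fst ab i + snd ab i)" for ab :: "('m \<Rightarrow> nat) \<times> ('m \<Rightarrow> nat)"
  define S where "S \<gamma> = {ab \<in> A \<times> B. pl ab = \<gamma>}" for \<gamma>
  show ?case
  proof (intro exI[of _ "pl ` (A \<times> B)"] exI[of _ "\<lambda>\<gamma>. \<Sum>ab\<in>S \<gamma>. c (fst ab) * d (snd ab)"] conjI allI)
    fix x
    have "f x * g x = (\<Sum>ab\<in>A \<times> B. c (fst ab) * d (snd ab) * mpow x (pl ab))"
      unfolding A(2) B(2) sum_product sum.cartesian_product
      by (intro sum.cong) (auto simp: pl_def mpow_add)
    also have "\<dots> = (\<Sum>\<gamma>\<in>pl ` (A \<times> B). \<Sum>ab\<in>S \<gamma>. c (fst ab) * d (snd ab) * mpow x (pl ab))"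
      unfolding S_def using A B by (intro sum.image_gen) auto
    also have "\<dots> = (\<Sum>\<gamma>\<in>pl ` (A \<times> B). (\<Sum>ab\<in>S \<gamma>. c (fst ab) * d (snd ab)) * mpow x \<gamma>)"
      unfolding sum_distrib_right by (intro sum.cong) (auto simp: S_def)
    finally show "f x * g x = (\<Sum>\<gamma>\<in>pl ` (A \<times> B). (\<Sum>ab\<in>S \<gamma>. c (fst ab) * d (snd ab)) * mpow x \<gamma>)" .
  qed (use A B in auto)
qed

text \<open>
  The set \<open>S\<close> consists of the coordinates that may vary. To add a coordinate, interpolate in it:
  this expresses the function by its restrictions to finitely many slices on which
  only the coordinates in \<open>S\<close> vary.
\<close>

lemma hom_part_polynomial_in_coordinates:
  fixes F :: "real ^ 'm::finite \<Rightarrow> real"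
  assumes F: "ray_series \<rho> F" and r: "0 < r" "ereal r < \<rho>" and S: "finite S"
  shows "\<forall>y. (\<forall>i. y $ i \<in> {0..r}) \<longrightarrow> (\<exists>p. real_polynomial_function p \<and>
    (\<forall>x. (\<forall>i. x $ i \<in> {0..r}) \<and> (\<forall>j. j \<notin> S \<longrightarrow> x $ j = y $ j) \<longrightarrow> hom_part F k x = p x))"
  using S
proof (induction S rule: finite_induct)
  case empty
  show ?case
  proof (intro allI impI)
    fix y :: "real ^ 'm"
    show "\<exists>p. real_polynomial_function p \<and>
        (\<forall>x. (\<forall>i. x $ i \<in> {0..r}) \<and> (\<forall>j. j \<notin> {} \<longrightarrow> x $ j = y $ j) \<longrightarrow> hom_part F k x = p x)"
      by (intro exI[of _ "\<lambda>_. hom_part F k y"]) (auto simp flip: Finite_Cartesian_Product.vec_eq_iff)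
  qed
next
  case (insert i S)
  define upd where "upd x c = (\<chi> j. if j = i then c else x $ j)" for x :: "real ^ 'm" and c
  \<comment> \<open>Any \<open>k + 1\<close> distinct nodes in \<open>[0, 1]\<close> would do.\<close>
  define Z where "Z = (\<lambda>j. real j / real (Suc k)) ` {..k}"
  have Z: "finite Z" "Z \<subseteq> {0..1}" "card Z = Suc k"
    by (auto simp: Z_def card_image inj_on_def)
  show ?case
  proof (intro allI impI)
    fix y :: "real ^ 'm" assume y: "\<forall>i. y $ i \<in> {0..r}"
    have "\<forall>w. \<exists>p. w \<in> Z \<longrightarrow> real_polynomial_function p \<and>
        (\<forall>x. (\<forall>i. x $ i \<in> {0..r}) \<and> (\<forall>j. j \<notin> S \<longrightarrow> x $ j = upd y (w * r) $ j) \<longrightarrow> hom_part F k x = p x)"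
    proof
      fix w
      show "\<exists>p. w \<in> Z \<longrightarrow> real_polynomial_function p \<and>
        (\<forall>x. (\<forall>i. x $ i \<in> {0..r}) \<and> (\<forall>j. j \<notin> S \<longrightarrow> x $ j = upd y (w * r) $ j) \<longrightarrow> hom_part F k x = p x)"
      proof (cases "w \<in> Z")
        case True
        then have "\<forall>i. upd y (w * r) $ i \<in> {0..r}"
          using y Z(2) r by (auto simp: upd_def mult_left_le_one_le)
        with insert.IH True show ?thesis
          by blast
      qed auto
    qed
    then obtain p where p: "\<And>w. w \<in> Z \<Longrightarrow> real_polynomial_function (p w)"
      "\<And>w x. \<lbrakk>w \<in> Z; \<forall>i. x $ i \<in> {0..r}; \<forall>j. j \<notin> S \<longrightarrow> x $ j = upd y (w * r) $ j\<rbrakk> \<Longrightarrow> hom_part F k x = p w x"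
      by metis
    define P where "P x = (\<Sum>w\<in>Z. p w (upd x (w * r)) * poly (lagrange_poly Z w) (x $ i / r))" for x
    show "\<exists>p. real_polynomial_function p \<and> (\<forall>x. (\<forall>i. x $ i \<in> {0..r}) \<and>
        (\<forall>j. j \<notin> insert i S \<longrightarrow> x $ j = y $ j) \<longrightarrow> hom_part F k x = p x)"
    proof (intro exI[of _ P] conjI allI impI)
      have "real_polynomial_function (\<lambda>x. p w (upd x (w * r)))" if "w \<in> Z" for w
        unfolding upd_def by (rule real_polynomial_function_update[OF p(1)[OF that]])
      moreover have "real_polynomial_function (\<lambda>x :: real ^ 'm. poly q (x $ i / r))" for q
        unfolding poly_altdef
        by (intro real_polynomial_function_sum real_polynomial_function.intros(4) real_polynomial_function.intros(2)
          real_polynomial_function_power real_polynomial_function_divide real_polynomial_function.intros(1)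
          bounded_linear_vec_nth) auto
      ultimately show "real_polynomial_function P"
        unfolding P_def[abs_def] using Z(1)
        by (intro real_polynomial_function_sum real_polynomial_function.intros(4)) auto
      fix x :: "real ^ 'm" assume x: "(\<forall>i. x $ i \<in> {0..r}) \<and> (\<forall>j. j \<notin> insert i S \<longrightarrow> x $ j = y $ j)"
      have upd_eq: "upd x 0 + z *\<^sub>R axis i r = upd x (z * r)" for z
        by (auto simp: upd_def Finite_Cartesian_Product.vec_eq_iff axis_def)
      have upd_box: "\<forall>j. upd x (z * r) $ j \<in> {0..r}" if "0 \<le> z" "z \<le> 1" for z
        using x that r by (auto simp: upd_def mult_left_le_one_le)
      have "hom_part F k (upd x 0 + (x $ i / r) *\<^sub>R axis i r)
        = (\<Sum>w\<in>Z. hom_part F k (upd x 0 + w *\<^sub>R axis i r) * poly (lagrange_poly Z w) (x $ i / r))"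
      proof (rule hom_part_interpolation[OF F _ _ _ Z(1,2)])
        have "upd x 0 + axis i r = upd x (1 * r)"
          using upd_eq[of 1] by simp
        then show "upd x 0 + axis i r \<in> orthant_box \<rho>"
          using upd_box[of 1] r(2) unfolding orthant_box_def
          by (auto intro: le_less_trans[of _ "ereal r"])
        show "0 \<le> axis i r $ j" for j
          using r by (simp add: axis_def)
        show "0 \<le> upd x 0 $ j" for j
          using x by (simp add: upd_def)
      qed (use Z x r in \<open>auto simp: divide_simps\<close>)
      also have "upd x 0 + (x $ i / r) *\<^sub>R axis i r = x"
        unfolding upd_eq using r by (auto simp: upd_def Finite_Cartesian_Product.vec_eq_iff)
      also have "(\<Sum>w\<in>Z. hom_part F k (upd x 0 + w *\<^sub>R axis i r) * poly (lagrange_poly Z w) (x $ i / r)) = P x"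
        unfolding P_def upd_eq
      proof (intro sum.cong refl)
        fix w assume w: "w \<in> Z"
        have "\<forall>j. upd x (w * r) $ j \<in> {0..r}"
          using w Z(2) by (intro upd_box) auto
        then have "hom_part F k (upd x (w * r)) = p w (upd x (w * r))"
          using w x by (intro p(2)) (auto simp: upd_def)
        then show "hom_part F k (upd x (w * r)) * poly (lagrange_poly Z w) (x $ i / r)
          = p w (upd x (w * r)) * poly (lagrange_poly Z w) (x $ i / r)"
          by simp
      qed
      finally show "hom_part F k x = P x" .
    qed
  qed
qed

lemma orthant_box_shrink:
  fixes x :: "real ^ 'm::finite"
  assumes x: "x \<in> orthant_box \<rho>" and r: "0 < r"
  obtains s where "0 < s" "s \<le> 1" "\<forall>i. (s *\<^sub>R x) $ i \<in> {0..r}"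
proof -
  define M where "M = (\<Sum>i\<in>UNIV. x $ i)"
  have nn: "0 \<le> x $ i" for i
    using x by (simp add: orthant_box_def)
  have le: "x $ i \<le> M" for i
    unfolding M_def using nn by (intro member_le_sum) auto
  have M: "0 \<le> M"
    using nn le order_trans by blast
  have *: "r / (M + r) * x $ i \<le> r" for i
  proof -
    have "r * x $ i \<le> r * (M + r)"
      using le[of i] r by (intro mult_left_mono) auto
    then show ?thesis
      using M r by (simp add: field_simps)
  qed
  show ?thesis
  proof (rule that[of "r / (M + r)"])
    show "\<forall>i. ((r / (M + r)) *\<^sub>R x) $ i \<in> {0..r}"
      using * nn M r by simp
  qed (use M r in auto)
qed

text \<open>
  On a small cube the homogeneous part agrees with a polynomial. Being homogeneous of degree \<open>k\<close>, it involves
  only monomials of degree \<open>k\<close>, and homogeneity extends the formula to the whole orthant box.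
\<close>

lemma hom_part_coeffs:
  fixes F :: "real ^ 'm::finite \<Rightarrow> real"
  assumes F: "ray_series \<rho> F" and r: "0 < r" "ereal r < \<rho>"
  shows "\<exists>f. \<forall>x\<in>orthant_box \<rho>. hom_part F k x = (\<Sum>\<alpha>\<in>multi_deg k. f \<alpha> * mpow x \<alpha>)"
proof -
  have box: "x \<in> orthant_box \<rho>" if "\<forall>i. x $ i \<in> {0..r}" for x :: "real ^ 'm"
    using that r(2) unfolding orthant_box_def by (auto intro: le_less_trans[of _ "ereal r"])
  obtain p where p: "real_polynomial_function p" "\<And>x. \<forall>i. x $ i \<in> {0..r} \<Longrightarrow> hom_part F k x = p x"
    using hom_part_polynomial_in_coordinates[OF F r, of UNIV k, rule_format, of 0] r by auto
  obtain A c where A: "finite A" "\<And>x. p x = (\<Sum>\<alpha>\<in>A. c \<alpha> * mpow x \<alpha>)"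
    using real_polynomial_function_monomials[OF p(1)] by blast
  define f where "f \<alpha> = (if \<alpha> \<in> A then c \<alpha> else 0)" for \<alpha>
  have hom: "hom_part F k x = (\<Sum>\<alpha>\<in>multi_deg k. f \<alpha> * mpow x \<alpha>)" if x: "\<forall>i. x $ i \<in> {0..r}" for x
  proof -
    define e where "e n = (\<Sum>\<alpha>\<in>{\<alpha>\<in>A. sum \<alpha> UNIV = n}. c \<alpha> * mpow x \<alpha>)" for n
    have "e = (\<lambda>n. if n = k then hom_part F k x else 0)"
    proof (rule power_series_unique[of 1])
      fix z :: real assume z: "0 \<le> z" "z < 1"
      have "(\<lambda>n. if n = k then hom_part F k x * z ^ k else 0) sums (hom_part F k x * z ^ k)"
        using sums_single[of k "\<lambda>_. hom_part F k x * z ^ k"] .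
      also have "(\<lambda>n. if n = k then hom_part F k x * z ^ k else 0)
          = (\<lambda>n. (if n = k then hom_part F k x else 0) * z ^ n)"
        by auto
      finally show "(\<lambda>n. (if n = k then hom_part F k x else 0) * z ^ n) sums (hom_part F k x * z ^ k)" .
      have "(\<lambda>n. \<Sum>\<alpha>\<in>A. if n = sum \<alpha> UNIV then c \<alpha> * mpow x \<alpha> * z ^ n else 0) sums
          (\<Sum>\<alpha>\<in>A. c \<alpha> * mpow x \<alpha> * z ^ sum \<alpha> UNIV)"
        by (intro sums_sum) (rule sums_single)
      also have "(\<lambda>n. \<Sum>\<alpha>\<in>A. if n = sum \<alpha> UNIV then c \<alpha> * mpow x \<alpha> * z ^ n else 0) = (\<lambda>n. e n * z ^ n)"
        unfolding e_def sum_distrib_right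
        by (intro ext sum.mono_neutral_cong_right) (use A(1) in auto)
      also have "(\<Sum>\<alpha>\<in>A. c \<alpha> * mpow x \<alpha> * z ^ sum \<alpha> UNIV) = p (z *\<^sub>R x)"
        unfolding A(2) mpow_scaleR by (simp add: mult_ac)
      also have "\<dots> = hom_part F k (z *\<^sub>R x)"
        using x z by (intro p(2)[symmetric]) (auto intro: mult_le_one[THEN order_trans] simp: mult_le_cancel_right1 mult_left_le_one_le intro!: order_trans[OF mult_left_le_one_le])
      also have "\<dots> = hom_part F k x * z ^ k"
        using hom_part_scale[OF F box[OF x], of z k] z by simp
      finally show "(\<lambda>n. e n * z ^ n) sums (hom_part F k x * z ^ k)" .
    qed simp
    then have "hom_part F k x = e k"
      by simp
    also have "\<dots> = (\<Sum>\<alpha>\<in>multi_deg k. f \<alpha> * mpow x \<alpha>)"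
      unfolding e_def f_def
      by (rule sum.mono_neutral_cong_left) (auto simp: multi_deg_def finite_multi_deg[unfolded multi_deg_def])
    finally show ?thesis .
  qed
  show ?thesis
  proof (intro exI[of _ f] ballI)
    fix x :: "real ^ 'm" assume x: "x \<in> orthant_box \<rho>"
    obtain s where s: "0 < s" "s \<le> 1" "\<forall>i. (s *\<^sub>R x) $ i \<in> {0..r}"
      using orthant_box_shrink[OF x r(1)] by blast
    have "s ^ k * hom_part F k x = hom_part F k (s *\<^sub>R x)"
      using hom_part_scale[OF F x] s by simp
    also have "\<dots> = (\<Sum>\<alpha>\<in>multi_deg k. f \<alpha> * mpow (s *\<^sub>R x) \<alpha>)"
      using hom s(3) by blast
    also have "\<dots> = (\<Sum>\<alpha>\<in>multi_deg k. s ^ k * (f \<alpha> * mpow x \<alpha>))"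
      unfolding mpow_scaleR by (intro sum.cong) (auto simp: multi_deg_def)
    finally show "hom_part F k x = (\<Sum>\<alpha>\<in>multi_deg k. f \<alpha> * mpow x \<alpha>)"
      using s(1) by (simp flip: sum_distrib_left)
  qed
qed

lemma ray_series_coeffs:
  fixes F :: "real ^ 'm::finite \<Rightarrow> real"
  assumes F: "ray_series \<rho> F" and \<rho>: "0 < \<rho>"
  obtains f where "\<And>k x. x \<in> orthant_box \<rho> \<Longrightarrow> hom_part F k x = (\<Sum>\<alpha>\<in>multi_deg k. f \<alpha> * mpow x \<alpha>)"
proof -
  obtain r where "0 < ereal r" "ereal r < \<rho>"
    using ereal_dense2[OF \<rho>] by blast
  then have "\<forall>k. \<exists>f. \<forall>x\<in>orthant_box \<rho>. hom_part F k x = (\<Sum>\<alpha>\<in>multi_deg k. f \<alpha> * mpow x \<alpha>)"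
    using hom_part_coeffs[OF F, of r] by simp
  then obtain f where f: "\<And>k x. x \<in> orthant_box \<rho> \<Longrightarrow> hom_part F k x = (\<Sum>\<alpha>\<in>multi_deg k. f k \<alpha> * mpow x \<alpha>)"
    by metis
  have "hom_part F k x = (\<Sum>\<alpha>\<in>multi_deg k. f (sum \<alpha> UNIV) \<alpha> * mpow x \<alpha>)" if "x \<in> orthant_box \<rho>" for k x
    unfolding f[OF that] by (intro sum.cong) (auto simp: multi_deg_def)
  then show ?thesis
    by (rule that)
qed

lemma has_sum_multi_deg:
  fixes f :: "('m::finite \<Rightarrow> nat) \<Rightarrow> real"
  assumes "\<And>\<alpha>. 0 \<le> f \<alpha>" "(\<lambda>k. \<Sum>\<alpha>\<in>multi_deg k. f \<alpha>) sums S"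
  shows "(f has_sum S) UNIV"
proof -
  have inner: "((\<lambda>\<alpha>. case (k, \<alpha>) of (_, \<alpha>) \<Rightarrow> f \<alpha>) has_sum (\<Sum>\<alpha>\<in>multi_deg k. f \<alpha>)) (multi_deg k)" for k
    using has_sum_finite[OF finite_multi_deg, of f] by simp
  have outer: "((\<lambda>k. \<Sum>\<alpha>\<in>multi_deg k. f \<alpha>) has_sum S) UNIV"
    using assms by (intro sums_nonneg_imp_has_sum sum_nonneg) auto
  have "((\<lambda>(_, \<alpha>). f \<alpha>) has_sum S) (Sigma UNIV multi_deg)"
  proof (rule has_sum_SigmaI[OF inner outer])
    show "(\<lambda>(_, \<alpha>). f \<alpha>) summable_on Sigma UNIV multi_deg"
      using has_sum_imp_summable[OF outer] assms(1) by (intro summable_on_SigmaI[OF inner]) auto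
  qed
  moreover have "bij_betw snd (Sigma UNIV multi_deg) (UNIV :: ('m \<Rightarrow> nat) set)"
    by (rule bij_betwI[of _ _ _ "\<lambda>\<alpha>. (sum \<alpha> UNIV, \<alpha>)"]) (auto simp: multi_deg_def)
  ultimately show ?thesis
    using has_sum_reindex_bij_betw[of snd "Sigma UNIV multi_deg" UNIV f S] by (simp add: case_prod_unfold)
qed

lemma ray_series_has_sum:
  assumes F: "ray_series \<rho> F" and x: "x \<in> orthant_box \<rho>"
    and f: "\<And>k x. x \<in> orthant_box \<rho> \<Longrightarrow> hom_part F k x = (\<Sum>\<alpha>\<in>multi_deg k. f \<alpha> * mpow x \<alpha>)"
    and nn: "\<And>\<alpha>. 0 \<le> f \<alpha>"
  shows "((\<lambda>\<alpha>. f \<alpha> * mpow x \<alpha>) has_sum F x) UNIV"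
proof (rule has_sum_multi_deg)
  show "0 \<le> f \<alpha> * mpow x \<alpha>" for \<alpha>
    using nn x by (intro mult_nonneg_nonneg mpow_nonneg) (auto simp: orthant_box_def)
  show "(\<lambda>k. \<Sum>\<alpha>\<in>multi_deg k. f \<alpha> * mpow x \<alpha>) sums F x"
    using hom_part(2)[OF F x, of 1] f[OF x] by simp
qed

text \<open>
  All coefficients on the ray are nonnegative, so the remainder at \<open>s\<close> is at most \<open>s\<^sup>n\<close> times the
  remainder at \<open>1\<close>.
\<close>

lemma hom_part_truncation:
  assumes F: "ray_series \<rho> F" and x: "x \<in> orthant_box \<rho>" and s: "0 \<le> s" "s \<le> 1"
  shows "\<bar>F (s *\<^sub>R x) - (\<Sum>l<n. hom_part F l x * s ^ l)\<bar> \<le> F x * s ^ n"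
proof -
  note nn = hom_part(1)[OF F x]
  have tail: "(\<lambda>l. hom_part F (l + n) x * s ^ (l + n)) sums (F (s *\<^sub>R x) - (\<Sum>l<n. hom_part F l x * s ^ l))"
    by (rule sums_split_initial_segment[OF hom_part(2)[OF F x s]])
  have "(\<lambda>l. hom_part F l x) sums F x"
    using hom_part(2)[OF F x, of 1] by simp
  from sums_split_initial_segment[OF this, of n]
  have tail1: "(\<lambda>l. hom_part F (l + n) x * s ^ n) sums ((F x - (\<Sum>l<n. hom_part F l x)) * s ^ n)"
    by (rule sums_mult2)
  have "norm (F (s *\<^sub>R x) - (\<Sum>l<n. hom_part F l x * s ^ l)) \<le> (F x - (\<Sum>l<n. hom_part F l x)) * s ^ n"
  proof (rule norm_sums_le[OF tail tail1])
    show "norm (hom_part F (l + n) x * s ^ (l + n)) \<le> hom_part F (l + n) x * s ^ n" for l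
    proof -
      have "s ^ (l + n) \<le> s ^ n"
        using s by (intro power_decreasing) auto
      then show ?thesis
        using s nn by (simp add: mult_left_mono)
    qed
  qed
  also have "\<dots> \<le> F x * s ^ n"
    using nn s by (intro mult_right_mono) (auto simp: sum_nonneg)
  finally show ?thesis
    by simp
qed

section \<open>Nonnegative coefficients from two-atom measures\<close>

text \<open>
  In coordinate \<open>i\<close> the sequence consists of the moments of a measure with mass \<open>a\<^sub>i\<close> at \<open>u\<^sub>i\<close> and mass
  \<open>b\<^sub>i\<close> at \<open>v\<^sub>i\<close>, both atoms in \<open>[-1, 1]\<close>. All moments then lie in \<open>(-\<rho>, \<rho>)\<close>.
\<close>

definition two_atom_positive :: "ereal \<Rightarrow> (real ^ 'm::finite \<Rightarrow> real) \<Rightarrow> bool" where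
  "two_atom_positive \<rho> F \<longleftrightarrow> (\<forall>a b u v.
      (\<forall>i. 0 \<le> a $ i \<and> 0 \<le> b $ i \<and> ereal (a $ i + b $ i) < \<rho> \<and> \<bar>u $ i\<bar> \<le> 1 \<and> \<bar>v $ i\<bar> \<le> 1) \<longrightarrow>
      hankel_psd (\<lambda>k. F (\<chi> i. a $ i * u $ i ^ k + b $ i * v $ i ^ k)))"

lemma two_atom_ray_series:
  fixes F :: "real ^ 'm::finite \<Rightarrow> real"
  assumes F: "two_atom_positive \<rho> F"
  shows "ray_series \<rho> F"
  unfolding ray_series_def
proof (intro allI impI)
  fix a b :: "real ^ 'm" and R :: real
  assume H: "(\<forall>i. 0 \<le> a $ i \<and> 0 \<le> b $ i) \<and> 0 < R \<and> (\<forall>z. 0 \<le> z \<and> z < R \<longrightarrow> a + z *\<^sub>R b \<in> orthant_box \<rho>)"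
  have "two_point_positive (\<lambda>z. F (a + z *\<^sub>R b)) R"
    unfolding two_point_positive_def
  proof (intro allI impI)
    fix c d t :: real assume t: "0 \<le> c \<and> 0 \<le> d \<and> c + d < R \<and> \<bar>t\<bar> \<le> 1"
    have "a + (c + d) *\<^sub>R b \<in> orthant_box \<rho>"
      using H t by simp
    then have "ereal (a $ i + (c + d) * b $ i) < \<rho>" for i
      by (simp add: orthant_box_def)
    then have "ereal ((a + c *\<^sub>R b) $ i + (d *\<^sub>R b) $ i) < \<rho>" for i
      by (simp add: algebra_simps)
    then have "hankel_psd (\<lambda>k. F (\<chi> i. (a + c *\<^sub>R b) $ i * (\<chi> j. 1) $ i ^ k + (d *\<^sub>R b) $ i * (\<chi> j. t) $ i ^ k))"
      using H t by (intro F[unfolded two_atom_positive_def, rule_format]) auto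
    also have "(\<lambda>k. F (\<chi> i. (a + c *\<^sub>R b) $ i * (\<chi> j. 1) $ i ^ k + (d *\<^sub>R b) $ i * (\<chi> j. t) $ i ^ k))
        = (\<lambda>k. F (a + (c + d * t ^ k) *\<^sub>R b))"
      by (intro ext arg_cong[of _ _ F]) (simp add: Finite_Cartesian_Product.vec_eq_iff algebra_simps)
    finally show "hankel_psd (\<lambda>k. F (a + (c + d * t ^ k) *\<^sub>R b))" .
  qed
  from two_point_positive_power_series[OF this] H
  show "\<exists>c. (\<forall>n. 0 \<le> c n) \<and> (\<forall>z. 0 \<le> z \<and> z < R \<longrightarrow> (\<lambda>n. c n * z ^ n) sums F (a + z *\<^sub>R b))"
    by metis
qed

text \<open>
  Take for the coordinates of \<open>t\<close> the reciprocals of distinct primes. By unique factorization the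
  monomials take different values at \<open>t\<close>.
\<close>

lemma separating_point:
  "\<exists>t :: real ^ 'm::finite. (\<forall>i. 0 < t $ i \<and> t $ i \<le> 1) \<and> inj (mpow t)"
proof -
  obtain B :: "nat set" where B: "B \<subseteq> {p. prime p}" "finite B" "card B = CARD('m)"
    using infinite_arbitrarily_large[OF primes_infinite] by blast
  then obtain pr :: "'m \<Rightarrow> nat" where pr: "bij_betw pr UNIV B"
    using finite_same_card_bij[of "UNIV :: 'm set" B] by auto
  have prime: "prime (pr i)" for i
    using pr B(1) by (auto simp: bij_betw_def)
  have inj: "inj pr"
    using pr by (simp add: bij_betw_def)
  define t :: "real ^ 'm" where "t = (\<chi> i. 1 / real (pr i))"
  have mt: "mpow t \<alpha> = 1 / real (\<Prod>i\<in>UNIV. pr i ^ \<alpha> i)" for \<alpha>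
    by (simp add: mpow_def t_def power_one_over prod_dividef)
  have mult: "multiplicity (pr j) (\<Prod>i\<in>UNIV. pr i ^ \<alpha> i) = \<alpha> j" for \<alpha> j
  proof -
    have "(\<Prod>i\<in>UNIV. pr i ^ \<alpha> i) = (\<Prod>p\<in>range pr. p ^ \<alpha> (inv_into UNIV pr p))"
      by (subst prod.reindex) (auto simp: inj)
    then show ?thesis
      using multiplicity_prod_prime_powers[of "range pr" "pr j" "\<lambda>p. \<alpha> (inv_into UNIV pr p)"] prime inj
      by auto
  qed
  have "inj (mpow t)"
  proof (rule injI, rule ext)
    fix \<alpha> \<beta> :: "'m \<Rightarrow> nat" and j
    assume "mpow t \<alpha> = mpow t \<beta>"
    then have "real (\<Prod>i\<in>UNIV. pr i ^ \<alpha> i) = real (\<Prod>i\<in>UNIV. pr i ^ \<beta> i)"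
      unfolding mt by (simp only: divide_cancel_left) simp
    then have "(\<Prod>i\<in>UNIV. pr i ^ \<alpha> i) = (\<Prod>i\<in>UNIV. pr i ^ \<beta> i)"
      unfolding of_nat_eq_iff .
    then show "\<alpha> j = \<beta> j"
      using mult[of j \<alpha>] mult[of j \<beta>] by simp
  qed
  moreover have "0 < t $ i" "t $ i \<le> 1" for i
    using prime_gt_0_nat[OF prime[of i]] by (auto simp: t_def)
  ultimately show ?thesis
    by (intro exI[of _ t]) auto
qed

text \<open>
  Let \<open>q\<close> vanish at the numbers \<open>t\<^sup>\<beta>\<close> for all \<open>\<beta> \<noteq> \<alpha>\<close> of degree at most \<open>|\<alpha>|\<close>, where \<open>t\<close> separates the
  monomials. Testing \<open>F (\<epsilon> r t\<^sup>k)\<close> with \<open>q\<^sup>2\<close> leaves \<open>f \<alpha>\<close>, with a positive factor, as the leading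
  coefficient in \<open>\<epsilon>\<close>.
\<close>

lemma two_atom_coeff_nonneg:
  fixes F :: "real ^ 'm::finite \<Rightarrow> real"
  assumes F: "two_atom_positive \<rho> F" and \<rho>: "0 < \<rho>"
    and f: "\<And>k x. x \<in> orthant_box \<rho> \<Longrightarrow> hom_part F k x = (\<Sum>\<alpha>\<in>multi_deg k. f \<alpha> * mpow x \<alpha>)"
  shows "0 \<le> f \<alpha>"
proof -
  note ray = two_atom_ray_series[OF F]
  obtain r where r: "0 < r" "ereal r < \<rho>"
    using ereal_dense2[OF \<rho>] by auto
  obtain t :: "real ^ 'm" where t: "\<And>i. 0 < t $ i" "\<And>i. t $ i \<le> 1" and inj: "inj (mpow t)"
    using separating_point[where 'm = 'm] by auto
  define n where "n = sum \<alpha> UNIV"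
  define B where "B = (\<Union>l\<le>n. multi_deg l) - {\<alpha>}"
  define q where "q = (\<Prod>\<beta>\<in>B. [:- mpow t \<beta>, 1:])"
  have B: "finite B"
    by (simp add: B_def finite_multi_deg)
  have q0: "poly q (mpow t \<beta>) = 0" if "\<beta> \<in> B" for \<beta>
    unfolding q_def poly_prod using B that by (intro prod_zero) auto
  have q\<alpha>: "poly q (mpow t \<alpha>) \<noteq> 0"
    unfolding q_def poly_prod using B inj by (auto simp: B_def inj_eq)
  define x where "x k = (\<chi> i. r * t $ i ^ k)" for k :: nat
  have xr: "0 \<le> x k $ i" "x k $ i \<le> (\<chi> i. r) $ i" for k i
  proof -
    have "t $ i ^ k \<le> 1"
      using t[of i] by (intro power_le_one) auto
    then show "0 \<le> x k $ i" "x k $ i \<le> (\<chi> i. r) $ i"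
      using t(1)[of i] r by (auto simp: x_def mult_left_le)
  qed
  have rb: "(\<chi> i. r) \<in> orthant_box \<rho>"
    using r by (simp add: orthant_box_def)
  have xb: "x k \<in> orthant_box \<rho>" for k
    using orthant_box_le[OF rb xr] .
  have mx: "mpow (x k) \<beta> = r ^ sum \<beta> UNIV * mpow t \<beta> ^ k" for k \<beta>
    unfolding mpow_def x_def
    by (simp add: power_mult_distrib prod.distrib power_sum prod_power_distrib power_exponents_commute[of _ k])
  define M where "M = F (\<chi> i. r)"
  have FM: "F (x k) \<le> M" for k
  proof -
    have "F (x k) \<le> F (x k + ((\<chi> i. r) - x k))"
    proof (rule ray_series_mono[OF ray])
      show "0 \<le> ((\<chi> i. r) - x k) $ i" for i
        using xr(2)[of k i] by simp
    qed (use xr rb in auto)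
    then show ?thesis
      by (simp add: M_def)
  qed
  define S where "S = (\<Sum>k\<le>degree (q * q). \<bar>coeff (q * q) k\<bar>)"
  define A where "A = f \<alpha> * (r ^ n * (poly q (mpow t \<alpha>))\<^sup>2)"
  have "0 \<le> A"
  proof (rule leading_coeff_nonneg[of 1 _ n "M * S"])
    fix \<epsilon> :: real assume \<epsilon>: "0 < \<epsilon>" "\<epsilon> \<le> 1"
    define \<tau> where "\<tau> k = F (\<epsilon> *\<^sub>R x k)" for k
    define T where "T k = (\<Sum>l<Suc n. \<epsilon> ^ l * hom_part F l (x k))" for k
    have "hankel_psd \<tau>"
    proof -
      have "\<epsilon> * r \<le> r"
        using \<epsilon> r by simp
      then have "ereal (\<epsilon> * r) < \<rho>"
        using r(2) by (metis ereal_less_eq(3) le_less_trans)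
      then have "hankel_psd (\<lambda>k. F (\<chi> i. (\<chi> i. 0) $ i * (\<chi> i. 1) $ i ^ k + (\<chi> i. \<epsilon> * r) $ i * t $ i ^ k))"
        using \<epsilon> r t by (intro F[unfolded two_atom_positive_def, rule_format]) (auto simp: less_imp_le)
      also have "(\<lambda>k. F (\<chi> i. (\<chi> i. 0) $ i * (\<chi> i. 1) $ i ^ k + (\<chi> i. \<epsilon> * r) $ i * t $ i ^ k)) = \<tau>"
        unfolding \<tau>_def
        by (intro ext arg_cong[of _ _ F]) (simp add: x_def Finite_Cartesian_Product.vec_eq_iff)
      finally show ?thesis .
    qed
    then have "0 \<le> riesz \<tau> (q * q)"
      by (simp add: hankel_psd_def)
    also have "riesz \<tau> (q * q) = riesz T (q * q) + riesz (\<lambda>k. \<tau> k - T k) (q * q)"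
      by (simp add: riesz_seq_diff)
    also have "riesz T (q * q) = A * \<epsilon> ^ n"
    proof -
      have "T = (\<lambda>k. \<Sum>l<Suc n. \<Sum>\<beta>\<in>multi_deg l. (\<epsilon> ^ l * f \<beta> * r ^ l) * mpow t \<beta> ^ k)"
        unfolding T_def f[OF xb] mx
        by (auto simp: sum_distrib_left multi_deg_def mult_ac intro!: ext sum.cong)
      then have "riesz T (q * q) = (\<Sum>l<Suc n. \<Sum>\<beta>\<in>multi_deg l. (\<epsilon> ^ l * f \<beta> * r ^ l) * poly (q * q) (mpow t \<beta>))"
        by (simp only: riesz_seq_sum riesz_seq_cmult riesz_powers)
      also have "\<dots> = (\<Sum>l<Suc n. if l = n then A * \<epsilon> ^ n else 0)"
      proof (intro sum.cong refl)
        fix l assume l: "l \<in> {..<Suc n}"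
        have "(\<Sum>\<beta>\<in>multi_deg l. (\<epsilon> ^ l * f \<beta> * r ^ l) * poly (q * q) (mpow t \<beta>))
          = (\<Sum>\<beta>\<in>multi_deg l. if \<beta> = \<alpha> then A * \<epsilon> ^ n else 0)"
        proof (intro sum.cong refl)
          fix \<beta> :: "'m \<Rightarrow> nat" assume \<beta>: "\<beta> \<in> multi_deg l"
          show "(\<epsilon> ^ l * f \<beta> * r ^ l) * poly (q * q) (mpow t \<beta>) = (if \<beta> = \<alpha> then A * \<epsilon> ^ n else 0)"
          proof (cases "\<beta> = \<alpha>")
            case True
            then have "l = n"
              using \<beta> by (simp add: multi_deg_def n_def)
            then show ?thesis
              using True by (simp add: A_def power2_eq_square)
          next
            case False
            then have "\<beta> \<in> B"
              using \<beta> l by (auto simp: B_def less_Suc_eq_le)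
            then show ?thesis
              using False q0 by simp
          qed
        qed
        also have "\<dots> = (if l = n then A * \<epsilon> ^ n else 0)"
          unfolding sum.delta[OF finite_multi_deg] by (auto simp: multi_deg_def n_def)
        finally show "(\<Sum>\<beta>\<in>multi_deg l. (\<epsilon> ^ l * f \<beta> * r ^ l) * poly (q * q) (mpow t \<beta>)) = \<dots>" .
      qed
      also have "\<dots> = A * \<epsilon> ^ n"
        by simp
      finally show ?thesis .
    qed
    also have "riesz (\<lambda>k. \<tau> k - T k) (q * q) \<le> M * \<epsilon> ^ Suc n * S"
    proof -
      have "\<bar>\<tau> k - T k\<bar> \<le> M * \<epsilon> ^ Suc n" for k
      proof -
        have "\<bar>\<tau> k - T k\<bar> \<le> F (x k) * \<epsilon> ^ Suc n"
          using hom_part_truncation[OF ray xb, of \<epsilon> k "Suc n"] \<epsilon> by (simp only: \<tau>_def T_def mult.commute)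
        also have "\<dots> \<le> M * \<epsilon> ^ Suc n"
          using FM \<epsilon> by (intro mult_right_mono) auto
        finally show ?thesis .
      qed
      then have "\<bar>riesz (\<lambda>k. \<tau> k - T k) (q * q)\<bar> \<le> M * \<epsilon> ^ Suc n * S"
        unfolding S_def by (rule riesz_abs_le)
      then show ?thesis
        by linarith
    qed
    finally show "0 \<le> A * \<epsilon> ^ n + M * S * \<epsilon> ^ Suc n"
      by (simp add: mult_ac)
  qed simp
  moreover have "0 < r ^ n * (poly q (mpow t \<alpha>))\<^sup>2"
    using r q\<alpha> by simp
  ultimately show ?thesis
    unfolding A_def by (metis mult_le_cancel_right_pos mult_zero_left)
qed

section \<open>Extension to arguments of arbitrary sign\<close>

text \<open>
  Coefficientwise majorization. It licenses the rearrangement of a power series along a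
  polynomial curve.
\<close>

definition dominated :: "real poly \<Rightarrow> real poly \<Rightarrow> bool" where
  "dominated p P \<longleftrightarrow> (\<forall>n. \<bar>coeff p n\<bar> \<le> coeff P n)"

lemma dominated_mult:
  assumes "dominated p P" "dominated q Q"
  shows "dominated (p * q) (P * Q)"
  unfolding dominated_def coeff_mult
proof
  fix n
  have "\<bar>\<Sum>i\<le>n. coeff p i * coeff q (n - i)\<bar> \<le> (\<Sum>i\<le>n. \<bar>coeff p i * coeff q (n - i)\<bar>)"
    by (rule sum_abs)
  also have "\<dots> \<le> (\<Sum>i\<le>n. coeff P i * coeff Q (n - i))"
    unfolding abs_mult using assms
    by (intro sum_mono mult_mono) (auto simp: dominated_def intro: order_trans[OF abs_ge_zero])
  finally show "\<bar>\<Sum>i\<le>n. coeff p i * coeff q (n - i)\<bar> \<le> (\<Sum>i\<le>n. coeff P i * coeff Q (n - i))" .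
qed

lemma dominated_1: "dominated 1 1"
  by (simp add: dominated_def one_pCons coeff_pCons split: nat.split)

lemma dominated_power: "dominated p P \<Longrightarrow> dominated (p ^ n) (P ^ n)"
  by (induction n) (auto simp: dominated_1 dominated_mult)

lemma dominated_prod: "(\<And>i. i \<in> A \<Longrightarrow> dominated (p i) (P i)) \<Longrightarrow> dominated (\<Prod>i\<in>A. p i) (\<Prod>i\<in>A. P i)"
  by (induction A rule: infinite_finite_induct) (auto simp: dominated_1 dominated_mult)

definition power_sum :: "(('m::finite \<Rightarrow> nat) \<Rightarrow> real) \<Rightarrow> real ^ 'm \<Rightarrow> real" where
  "power_sum f x = (\<Sum>\<^sub>\<infinity>\<alpha>. f \<alpha> * mpow x \<alpha>)"

definition pos_series :: "ereal \<Rightarrow> (('m::finite \<Rightarrow> nat) \<Rightarrow> real) \<Rightarrow> bool" where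
  "pos_series \<rho> f \<longleftrightarrow> (\<forall>\<alpha>. 0 \<le> f \<alpha>) \<and> (\<forall>x\<in>orthant_box \<rho>. (\<lambda>\<alpha>. f \<alpha> * mpow x \<alpha>) summable_on UNIV)"

text \<open>
  The monomial \<open>x\<^sup>\<alpha>\<close> along the curve with coordinates \<open>g i\<close>, as a polynomial in the parameter.
\<close>

definition curve_poly :: "('m::finite \<Rightarrow> real poly) \<Rightarrow> ('m \<Rightarrow> nat) \<Rightarrow> real poly" where
  "curve_poly g \<alpha> = (\<Prod>i\<in>UNIV. g i ^ \<alpha> i)"

lemma poly_curve_poly: "poly (curve_poly g \<alpha>) z = mpow (\<chi> i. poly (g i) z) \<alpha>"
  by (simp add: curve_poly_def mpow_def poly_prod)

lemma has_sum_poly: "((\<lambda>n. coeff p n * z ^ n) has_sum poly p z) UNIV" for p :: "real poly"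
proof -
  have "((\<lambda>n. coeff p n * z ^ n) has_sum poly p z) {..degree p}"
    unfolding poly_altdef by (rule has_sum_finite) simp
  then show ?thesis
    by (rule has_sum_cong_neutral[THEN iffD1, rotated -1]) (auto simp: coeff_eq_0)
qed

lemma summable_on_abs_dominated:
  fixes f g :: "'a \<Rightarrow> real"
  assumes "g summable_on A" "\<And>x. x \<in> A \<Longrightarrow> \<bar>f x\<bar> \<le> g x"
  shows "f summable_on A"
proof -
  have "(\<lambda>x. \<bar>f x\<bar>) summable_on A"
    using assms by (intro summable_on_comparison_test[OF assms(1)]) auto
  then show ?thesis
    using summable_on_iff_abs_summable_on_real[of f A] by simp
qed

text \<open>
  Every monomial at \<open>X\<close> is expanded into \<open>e\<close>, which is majorized termwise by a nonnegative
  expansion \<open>E\<close> of the same monomial at \<open>Y\<close>. Since the series converges at \<open>Y\<close>, the double series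
  converges absolutely and may be summed in either order.
\<close>

lemma power_sum_rearrange:
  fixes f :: "('m::finite \<Rightarrow> nat) \<Rightarrow> real"
  assumes nn: "\<And>\<alpha>. 0 \<le> f \<alpha>" and summ: "(\<lambda>\<alpha>. f \<alpha> * mpow Y \<alpha>) summable_on UNIV"
    and e: "\<And>\<alpha>. (e \<alpha> has_sum mpow X \<alpha>) UNIV" and E: "\<And>\<alpha>. (E \<alpha> has_sum mpow Y \<alpha>) UNIV"
    and le: "\<And>\<alpha> \<beta>. \<bar>e \<alpha> \<beta>\<bar> \<le> E \<alpha> \<beta>"
  shows "(\<lambda>\<alpha>. f \<alpha> * e \<alpha> \<beta>) summable_on UNIV"
    and "((\<lambda>\<beta>. \<Sum>\<^sub>\<infinity>\<alpha>. f \<alpha> * e \<alpha> \<beta>) has_sum power_sum f X) UNIV"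
proof -
  have E0: "0 \<le> E \<alpha> \<beta>" for \<alpha> \<beta>
    using le[of \<alpha> \<beta>] by linarith
  have inner: "((\<lambda>\<beta>. case (\<alpha>, \<beta>) of (\<alpha>, \<beta>) \<Rightarrow> f \<alpha> * E \<alpha> \<beta>) has_sum f \<alpha> * mpow Y \<alpha>) UNIV" for \<alpha>
    using has_sum_cmult_right[OF E, of "f \<alpha>" \<alpha>] by simp
  have sE: "(\<lambda>(\<alpha>, \<beta>). f \<alpha> * E \<alpha> \<beta>) summable_on UNIV \<times> UNIV"
    using summable_on_SigmaI[OF inner summ] nn E0 by auto
  have se: "(\<lambda>(\<alpha>, \<beta>). f \<alpha> * e \<alpha> \<beta>) summable_on UNIV \<times> UNIV"
    by (rule summable_on_abs_dominated[OF sE]) (auto simp: abs_mult nn intro!: mult_left_mono le)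
  then have se': "(\<lambda>(\<beta>, \<alpha>). f \<alpha> * e \<alpha> \<beta>) summable_on UNIV \<times> UNIV"
    by (subst summable_on_swap) simp
  show s1: "(\<lambda>\<alpha>. f \<alpha> * e \<alpha> \<beta>) summable_on UNIV" for \<beta>
    using summable_on_SigmaD1[OF se'] by simp
  have "((\<lambda>\<beta>. case (\<alpha>, \<beta>) of (\<alpha>, \<beta>) \<Rightarrow> f \<alpha> * e \<alpha> \<beta>) has_sum f \<alpha> * mpow X \<alpha>) UNIV" for \<alpha>
    using has_sum_cmult_right[OF e, of "f \<alpha>" \<alpha>] by simp
  from has_sum_SigmaD[OF has_sum_infsum[OF se] this]
  have tot: "infsum (\<lambda>(\<alpha>, \<beta>). f \<alpha> * e \<alpha> \<beta>) (UNIV \<times> UNIV) = power_sum f X"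
    unfolding power_sum_def by (rule infsumI[symmetric])
  have "((\<lambda>(\<beta>, \<alpha>). f \<alpha> * e \<alpha> \<beta>) has_sum power_sum f X) (UNIV \<times> UNIV)"
    using has_sum_infsum[OF se] unfolding tot by (subst has_sum_swap) simp
  then show "((\<lambda>\<beta>. \<Sum>\<^sub>\<infinity>\<alpha>. f \<alpha> * e \<alpha> \<beta>) has_sum power_sum f X) UNIV"
  proof (rule has_sum_SigmaD)
    show "((\<lambda>\<alpha>. case (\<beta>, \<alpha>) of (\<beta>, \<alpha>) \<Rightarrow> f \<alpha> * e \<alpha> \<beta>) has_sum (\<Sum>\<^sub>\<infinity>\<alpha>. f \<alpha> * e \<alpha> \<beta>)) UNIV" for \<beta>
      using has_sum_infsum[OF s1] by simp
  qed
qed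

lemma power_sum_along_curve:
  fixes f :: "('m::finite \<Rightarrow> nat) \<Rightarrow> real"
  assumes nn: "\<And>\<alpha>. 0 \<le> f \<alpha>" and dom: "\<And>i. dominated (g i) (G i)"
    and summ: "(\<lambda>\<alpha>. f \<alpha> * mpow (\<chi> i. poly (G i) 1) \<alpha>) summable_on UNIV"
  defines "Q \<equiv> \<lambda>h n. \<Sum>\<^sub>\<infinity>\<alpha>. f \<alpha> * coeff (curve_poly h \<alpha>) n"
  shows "\<bar>Q g n\<bar> \<le> Q G n"
    and "\<lbrakk>0 \<le> z; z \<le> 1\<rbrakk> \<Longrightarrow> (\<lambda>n. Q g n * z ^ n) sums power_sum f (\<chi> i. poly (g i) z)"
proof -
  have cd: "\<bar>coeff (curve_poly g \<alpha>) n\<bar> \<le> coeff (curve_poly G \<alpha>) n" for \<alpha> n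
    using dominated_prod[of UNIV "\<lambda>i. g i ^ \<alpha> i" "\<lambda>i. G i ^ \<alpha> i"] dominated_power[OF dom]
    by (simp add: curve_poly_def dominated_def)
  have G0: "0 \<le> coeff (curve_poly G \<alpha>) n" for \<alpha> n
    using cd[of \<alpha> n] by linarith
  have pc: "((\<lambda>n. coeff (curve_poly h \<alpha>) n * z ^ n) has_sum mpow (\<chi> i. poly (h i) z) \<alpha>) UNIV" for h :: "'m \<Rightarrow> real poly" and \<alpha> z
    using has_sum_poly[of "curve_poly h \<alpha>" z] by (simp add: poly_curve_poly)
  have re: "(\<lambda>\<alpha>. f \<alpha> * (coeff (curve_poly h \<alpha>) n * z ^ n)) summable_on UNIV"
    "((\<lambda>n. \<Sum>\<^sub>\<infinity>\<alpha>. f \<alpha> * (coeff (curve_poly h \<alpha>) n * z ^ n)) has_sum power_sum f (\<chi> i. poly (h i) z)) UNIV"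
    if h: "\<And>\<alpha> n. \<bar>coeff (curve_poly h \<alpha>) n\<bar> \<le> coeff (curve_poly G \<alpha>) n" and z: "0 \<le> z" "z \<le> 1" for h z n
  proof -
    have le: "\<bar>coeff (curve_poly h \<alpha>) n * z ^ n\<bar> \<le> coeff (curve_poly G \<alpha>) n * 1 ^ n" for \<alpha> n
      unfolding abs_mult using z h by (intro mult_mono) (auto simp: power_le_one G0)
    show "(\<lambda>\<alpha>. f \<alpha> * (coeff (curve_poly h \<alpha>) n * z ^ n)) summable_on UNIV"
      by (rule power_sum_rearrange(1)[OF nn summ pc pc le])
    show "((\<lambda>n. \<Sum>\<^sub>\<infinity>\<alpha>. f \<alpha> * (coeff (curve_poly h \<alpha>) n * z ^ n)) has_sum power_sum f (\<chi> i. poly (h i) z)) UNIV"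
      by (rule power_sum_rearrange(2)[OF nn summ pc pc le])
  qed
  have sG1: "(\<lambda>\<alpha>. f \<alpha> * coeff (curve_poly G \<alpha>) n) summable_on UNIV" for n
    using re(1)[of G 1 n] G0 by simp
  have sg1: "(\<lambda>\<alpha>. f \<alpha> * coeff (curve_poly g \<alpha>) n) summable_on UNIV" for n
    using re(1)[of g 1 n] cd by simp
  show "\<bar>Q g n\<bar> \<le> Q G n"
    unfolding Q_def
    using norm_infsum_le[OF has_sum_infsum[OF sg1[of n]] has_sum_infsum[OF sG1[of n]]] cd nn
    by (auto simp: abs_mult intro!: mult_left_mono)
  assume z: "0 \<le> z" "z \<le> 1"
  have "(\<Sum>\<^sub>\<infinity>\<alpha>. f \<alpha> * (coeff (curve_poly g \<alpha>) n * z ^ n)) = Q g n * z ^ n" for n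
    unfolding Q_def by (subst infsum_cmult_left'[symmetric]) (simp add: mult.assoc)
  then have "((\<lambda>n. Q g n * z ^ n) has_sum power_sum f (\<chi> i. poly (g i) z)) UNIV"
    using re(2)[of g z, OF cd z] by simp
  then show "(\<lambda>n. Q g n * z ^ n) sums power_sum f (\<chi> i. poly (g i) z)"
    by (rule has_sum_imp_sums)
qed

lemma riesz_pcompose_square: "riesz \<tau> (pcompose p (monom 1 2)) = riesz (\<lambda>k. \<tau> (2 * k)) p"
proof (induction p arbitrary: \<tau>)
  case (pCons a p)
  have "riesz \<tau> [:a:] = a * \<tau> 0"
    by (simp add: riesz_pCons)
  then show ?case
    by (simp add: pcompose_pCons riesz_add riesz_monom_mult riesz_pCons pCons.IH)
qed simp

text \<open>
  Test with the squares of \<open>(1 + x) s(x\<^sup>2)\<close> and \<open>(1 - x) s(x\<^sup>2)\<close>.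
\<close>

lemma hankel_psd_odd_le_even:
  assumes "hankel_psd \<tau>"
  shows "2 * \<bar>riesz (\<lambda>k. \<tau> (2 * k + 1)) (s * s)\<bar>
    \<le> riesz (\<lambda>k. \<tau> (2 * k)) (s * s) + riesz (\<lambda>k. \<tau> (2 * k + 2)) (s * s)"
proof -
  define S where "S = pcompose (s * s) (monom 1 2)"
  have S: "S = pcompose s (monom 1 2) * pcompose s (monom 1 2)"
    by (simp add: S_def pcompose_mult)
  have r0: "riesz \<tau> S = riesz (\<lambda>k. \<tau> (2 * k)) (s * s)"
    unfolding S_def by (rule riesz_pcompose_square)
  have r1: "riesz \<tau> (monom 1 1 * S) = riesz (\<lambda>k. \<tau> (2 * k + 1)) (s * s)"
    unfolding riesz_monom_mult S_def by (rule riesz_pcompose_square)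
  have r2: "riesz \<tau> (monom 1 2 * S) = riesz (\<lambda>k. \<tau> (2 * k + 2)) (s * s)"
    unfolding riesz_monom_mult S_def by (rule riesz_pcompose_square)
  have x2: "monom (1::real) 2 = monom 1 1 * monom 1 1"
    by (simp add: mult_monom numeral_2_eq_2)
  let ?x = "monom (1::real) 1"
  let ?s = "pcompose s (monom 1 2)"
  have "0 \<le> riesz \<tau> ((?s + ?x * ?s) * (?s + ?x * ?s))" "0 \<le> riesz \<tau> ((?s - ?x * ?s) * (?s - ?x * ?s))"
    using assms by (auto simp: hankel_psd_def)
  moreover have "(?s + ?x * ?s) * (?s + ?x * ?s) = S + (?x * S + ?x * S) + monom 1 2 * S"
    unfolding x2 S by (simp only: algebra_simps)
  moreover have "(?s - ?x * ?s) * (?s - ?x * ?s) = S - (?x * S + ?x * S) + monom 1 2 * S"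
    unfolding x2 S by (simp only: algebra_simps)
  ultimately show ?thesis
    by (simp only: riesz_add riesz_diff r0 r1 r2)
qed

text \<open>
  Such a polynomial reads off the entry at \<open>0\<close> of every sequence that vanishes from index \<open>K\<close> on.
\<close>

definition gap_poly :: "nat \<Rightarrow> real poly \<Rightarrow> bool" where
  "gap_poly K p \<longleftrightarrow> coeff p 0 = 1 \<and> (\<forall>k. 0 < k \<and> k < K \<longrightarrow> coeff p k = 0)"

lemma gap_poly_mult:
  assumes "gap_poly K p" "gap_poly K q"
  shows "gap_poly K (p * q)"
  unfolding gap_poly_def
proof (intro conjI allI impI)
  show "coeff (p * q) 0 = 1"
    using assms by (simp add: gap_poly_def coeff_mult)
  fix k assume k: "0 < k \<and> k < K"
  have "coeff p i * coeff q (k - i) = 0" if "i \<le> k" for i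
  proof (cases "i = 0")
    case True
    then show ?thesis
      using assms(2) k by (simp add: gap_poly_def)
  next
    case False
    then show ?thesis
      using assms(1) k that by (simp add: gap_poly_def)
  qed
  then show "coeff (p * q) k = 0"
    unfolding coeff_mult by (intro sum.neutral) auto
qed

lemma gap_poly_prod: "(\<And>i. i \<in> A \<Longrightarrow> gap_poly K (p i)) \<Longrightarrow> gap_poly K (\<Prod>i\<in>A. p i)"
proof (induction A rule: infinite_finite_induct)
  case (insert i A)
  then show ?case
    by (simp add: gap_poly_mult)
qed (auto simp: gap_poly_def one_pCons coeff_pCons split: nat.splits)

text \<open>
  The even entries of \<open>T\<close> are those of the sum of \<open>R\<^sub>n \<delta>\<close> at \<open>t\<^sup>n\<close>, and \<open>V\<close> is a signed sum
  of the same kind, dominated by \<open>R\<close>. Let \<open>D\<close> be the difference of the odd entries of \<open>T\<close> and \<open>V\<close>;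
  it vanishes from index \<open>K\<close> on. The polynomial \<open>s = \<Prod>\<^bsub>j<N\<^esub> (1 - (x / t\<^sup>2\<^sup>j)\<^sup>K)\<close> has \<open>s\<^sup>2\<close> a gap
  polynomial, so \<open>s\<^sup>2\<close> maps \<open>D\<close> to \<open>D 0\<close>. It vanishes at the nodes with \<open>n < N\<close> and is at most
  \<open>1\<close> in absolute value at the others, so the values on \<open>V\<close> and on the even entries are at most
  \<open>\<Sum>\<^bsub>n\<ge>N\<^esub> R\<^sub>n\<close>. By \<open>hankel_psd_odd_le_even\<close> so is the value on the odd entries of \<open>T\<close>. Let \<open>N\<close> tend to infinity.
\<close>

lemma odd_moment_determined:
  fixes T :: "nat \<Rightarrow> real"
  assumes psd: "hankel_psd T" and t: "0 < t" "t < 1" and K: "0 < K"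
    and R: "\<And>k. (\<lambda>n. R n * (t ^ (2 * k)) ^ n) sums T (2 * k)"
    and Q: "\<And>k. (\<lambda>n. Q n * (t ^ (2 * k + 1)) ^ n) sums V k"
    and QR: "\<And>n. \<bar>Q n\<bar> \<le> R n"
    and eq: "\<And>k. K \<le> k \<Longrightarrow> T (2 * k + 1) = V k"
  shows "T 1 = V 0"
proof -
  have R0: "0 \<le> R n" for n
    using QR[of n] by linarith
  have sumR: "summable R"
    using R[of 0] by (simp add: sums_iff)
  define D where "D k = T (2 * k + 1) - V k" for k
  have bound: "\<bar>D 0\<bar> \<le> 2 * (suminf R - sum R {..<N})" for N
  proof -
    define s where "s = (\<Prod>j<N. 1 - monom ((1 / t ^ (2 * j)) ^ K) K)"
    have gap: "gap_poly K (s * s)"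
      unfolding s_def using K
      by (intro gap_poly_mult gap_poly_prod) (auto simp: gap_poly_def one_pCons coeff_pCons split: nat.splits)
    have s_at: "poly s (t ^ (2 * n)) = (\<Prod>j<N. 1 - (t ^ (2 * n) / t ^ (2 * j)) ^ K)" for n
      by (simp add: s_def poly_prod poly_monom power_divide mult.commute)
    have s0: "poly s (t ^ (2 * n)) = 0" if "n < N" for n
      unfolding s_at using that t by (intro prod_zero) (auto intro!: bexI[of _ n])
    have s1: "(poly s (t ^ (2 * n)))\<^sup>2 \<le> 1" if "N \<le> n" for n
    proof -
      have "0 \<le> 1 - (t ^ (2 * n) / t ^ (2 * j)) ^ K \<and> 1 - (t ^ (2 * n) / t ^ (2 * j)) ^ K \<le> 1" if "j < N" for j
      proof -
        have "t ^ (2 * n) \<le> t ^ (2 * j)"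
          using t that \<open>N \<le> n\<close> by (intro power_decreasing) auto
        then have "t ^ (2 * n) / t ^ (2 * j) \<le> 1" "0 \<le> t ^ (2 * n) / t ^ (2 * j)"
          using t by auto
        then show ?thesis
          by (simp add: power_le_one)
      qed
      then have "0 \<le> poly s (t ^ (2 * n))" "poly s (t ^ (2 * n)) \<le> 1"
        unfolding s_at by (auto intro!: prod_nonneg prod_le_1)
      then show ?thesis
        by (simp add: power_le_one)
    qed
    define w where "w n = (if n < N then 0 else R n)" for n
    have w: "w sums (suminf R - sum R {..<N})"
    proof -
      have "(\<lambda>n. R n - (if n \<in> {..<N} then R n else 0)) sums (suminf R - sum R {..<N})"
        by (intro sums_diff summable_sums sumR sums_If_finite_set) simp
      also have "(\<lambda>n. R n - (if n \<in> {..<N} then R n else 0)) = w"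
        by (auto simp: w_def)
      finally show ?thesis .
    qed
    have wb: "\<bar>u * poly (s * s) (t ^ (2 * n))\<bar> \<le> w n" if "\<bar>u\<bar> \<le> R n" for u n
    proof (cases "n < N")
      case False
      then have "\<bar>u\<bar> * (poly s (t ^ (2 * n)))\<^sup>2 \<le> R n * 1"
        using that s1 by (intro mult_mono) auto
      then show ?thesis
        using False by (simp add: w_def abs_mult power2_eq_square)
    qed (simp add: s0 w_def)
    have t1: "\<bar>t ^ n\<bar> \<le> 1" for n
      using t by (simp add: power_le_one)
    have E0: "\<bar>riesz (\<lambda>k. T (2 * k)) (s * s)\<bar> \<le> suminf R - sum R {..<N}"
    proof -
      have "(\<lambda>n. R n * poly (s * s) (t ^ (2 * n))) sums riesz (\<lambda>k. T (2 * k)) (s * s)"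
      proof (rule riesz_seq_sums)
        fix k
        have "(\<lambda>n. R n * (t ^ (2 * n)) ^ k) = (\<lambda>n. R n * (t ^ (2 * k)) ^ n)"
          by (simp only: power_mult[symmetric] mult_ac)
        with R show "(\<lambda>n. R n * (t ^ (2 * n)) ^ k) sums T (2 * k)"
          by simp
      qed
      then have "norm (riesz (\<lambda>k. T (2 * k)) (s * s)) \<le> suminf R - sum R {..<N}"
        by (rule norm_sums_le[OF _ w]) (use wb[of "R _"] R0 in auto)
      then show ?thesis
        by simp
    qed
    have E2: "\<bar>riesz (\<lambda>k. T (2 * k + 2)) (s * s)\<bar> \<le> suminf R - sum R {..<N}"
    proof -
      have "(\<lambda>n. R n * t ^ (2 * n) * (t ^ (2 * n)) ^ k) sums T (2 * k + 2)" for k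
      proof -
        have "(t ^ (2 * Suc k)) ^ n = t ^ (2 * n) * (t ^ (2 * n)) ^ k" for n
          by (simp only: power_mult[symmetric] power_add[symmetric]) (simp add: algebra_simps)
        then show ?thesis
          using R[of "Suc k"] by (simp add: mult.assoc)
      qed
      then have "(\<lambda>n. R n * t ^ (2 * n) * poly (s * s) (t ^ (2 * n))) sums riesz (\<lambda>k. T (2 * k + 2)) (s * s)"
        by (rule riesz_seq_sums)
      then have "norm (riesz (\<lambda>k. T (2 * k + 2)) (s * s)) \<le> suminf R - sum R {..<N}"
      proof (rule norm_sums_le[OF _ w])
        fix n
        have "\<bar>R n * t ^ (2 * n)\<bar> \<le> R n"
          using R0[of n] t1[of "2 * n"] by (simp add: abs_mult mult_left_le)
        from wb[OF this] show "norm (R n * t ^ (2 * n) * poly (s * s) (t ^ (2 * n))) \<le> w n"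
          by (simp only: real_norm_def)
      qed
      then show ?thesis
        by simp
    qed
    have E1: "\<bar>riesz V (s * s)\<bar> \<le> suminf R - sum R {..<N}"
    proof -
      have "(\<lambda>n. Q n * t ^ n * (t ^ (2 * n)) ^ k) sums V k" for k
      proof -
        have "(t ^ (2 * k + 1)) ^ n = t ^ n * (t ^ (2 * n)) ^ k" for n
          by (simp only: power_mult[symmetric] power_add[symmetric]) (simp add: algebra_simps)
        then show ?thesis
          using Q[of k] by (simp add: mult.assoc)
      qed
      then have "(\<lambda>n. Q n * t ^ n * poly (s * s) (t ^ (2 * n))) sums riesz V (s * s)"
        by (rule riesz_seq_sums)
      then have "norm (riesz V (s * s)) \<le> suminf R - sum R {..<N}"
      proof (rule norm_sums_le[OF _ w])
        fix n
        have "\<bar>Q n\<bar> * \<bar>t ^ n\<bar> \<le> R n * 1"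
          using QR[of n] t1[of n] R0[of n] by (intro mult_mono) auto
        then have "\<bar>Q n * t ^ n\<bar> \<le> R n"
          by (simp only: abs_mult mult_1_right)
        from wb[OF this] show "norm (Q n * t ^ n * poly (s * s) (t ^ (2 * n))) \<le> w n"
          by (simp only: real_norm_def)
      qed
      then show ?thesis
        by simp
    qed
    have "D 0 = riesz D (s * s)"
    proof -
      have "riesz D (s * s) = (\<Sum>k\<le>degree (s * s). if k = 0 then D 0 else 0)"
        unfolding riesz_def
      proof (intro sum.cong refl)
        fix k
        show "coeff (s * s) k * D k = (if k = 0 then D 0 else 0)"
          using gap eq[of k] by (cases "k < K") (auto simp: gap_poly_def D_def)
      qed
      then show ?thesis
        by simp
    qed
    also have "riesz D (s * s) = riesz (\<lambda>k. T (2 * k + 1)) (s * s) - riesz V (s * s)"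
      unfolding D_def by (rule riesz_seq_diff)
    finally have "\<bar>D 0\<bar> \<le> \<bar>riesz (\<lambda>k. T (2 * k + 1)) (s * s)\<bar> + \<bar>riesz V (s * s)\<bar>"
      by simp
    moreover have "d \<le> 2 * u" if "d \<le> a + v" "2 * a \<le> e + e'" "e \<le> u" "e' \<le> u" "v \<le> u" for d u a v e e' :: real
      using that by linarith
    ultimately show ?thesis
      using hankel_psd_odd_le_even[OF psd, of s] abs_le_D1[OF E0] abs_le_D1[OF E2] E1 by blast
  qed
  have "(\<lambda>N. 2 * (suminf R - sum R {..<N})) \<longlonglongrightarrow> 2 * (suminf R - suminf R)"
    by (intro tendsto_intros summable_LIMSEQ sumR)
  then have "\<bar>D 0\<bar> \<le> 0"
    using bound by (intro LIMSEQ_le_const) auto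
  then show ?thesis
    by (simp add: D_def)
qed

definition vabs :: "real ^ 'm::finite \<Rightarrow> real ^ 'm" where
  "vabs x = (\<chi> i. \<bar>x $ i\<bar>)"

text \<open>
  Apply \<open>odd_moment_determined\<close> to the moments of \<open>b\<close> times the unit mass at \<open>\<sigma> t\<close> plus \<open>a\<close> times the
  unit mass at \<open>-t\<^sup>2\<close>. The even moments lie on the curve \<open>b z + a z\<^sup>2\<close> in the positive orthant, with
  \<open>z = t\<^sup>2\<^sup>k\<close>; the odd ones lie on \<open>\<sigma> b z - a z\<^sup>2\<close>, whose coefficients are dominated by those of the
  first curve.
\<close>

lemma curve_comparison:
  fixes F :: "real ^ 'm::finite \<Rightarrow> real"
  assumes F: "two_atom_positive \<rho> F"
    and f: "\<And>\<alpha>. 0 \<le> f \<alpha>" "\<And>x. x \<in> orthant_box \<rho> \<Longrightarrow> ((\<lambda>\<alpha>. f \<alpha> * mpow x \<alpha>) has_sum F x) UNIV"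
    and ab: "\<And>i. 0 \<le> a $ i" "\<And>i. 0 \<le> b $ i" "a + b \<in> orthant_box \<rho>"
    and t: "0 < t" "t < 1" and sg: "\<And>i. \<sigma> $ i = 1 \<or> \<sigma> $ i = -1" and K: "0 < K"
    and eq: "\<And>k. K \<le> k \<Longrightarrow> F (\<chi> i. b $ i * (\<sigma> $ i * t) ^ (2 * k + 1) - a $ i * (t\<^sup>2) ^ (2 * k + 1))
       = power_sum f (\<chi> i. b $ i * (\<sigma> $ i * t) ^ (2 * k + 1) - a $ i * (t\<^sup>2) ^ (2 * k + 1))"
  shows "F (\<chi> i. b $ i * \<sigma> $ i * t - a $ i * t\<^sup>2) = power_sum f (\<chi> i. b $ i * \<sigma> $ i * t - a $ i * t\<^sup>2)"
proof -
  define G where "G i = [:0, b $ i, a $ i:]" for i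
  define g where "g i = [:0, b $ i * \<sigma> $ i, - a $ i:]" for i
  have dom: "dominated (g i) (G i)" "dominated (G i) (G i)" for i
    using ab(1,2)[of i] sg[of i]
    by (auto simp: dominated_def g_def G_def coeff_pCons abs_mult split: nat.split)
  have box1: "(\<chi> i. poly (G i) 1) \<in> orthant_box \<rho>"
    using ab(3) by (simp add: G_def orthant_box_def add.commute)
  have box: "(\<chi> i. poly (G i) z) \<in> orthant_box \<rho>" if z: "0 \<le> z" "z \<le> 1" for z
  proof (rule orthant_box_le[OF ab(3)])
    fix i
    have "z * b $ i \<le> b $ i" "z * (z * a $ i) \<le> a $ i"
      using ab(1,2)[of i] z by (auto simp: mult_left_le_one_le intro!: order_trans[OF mult_left_le_one_le])
    then show "(\<chi> i. poly (G i) z) $ i \<le> (a + b) $ i"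
      by (simp add: G_def algebra_simps)
    show "0 \<le> (\<chi> i. poly (G i) z) $ i"
      using ab(1,2)[of i] z by (simp add: G_def)
  qed
  note summ = has_sum_imp_summable[OF f(2)[OF box1]]
  define T where "T k = F (\<chi> i. b $ i * (\<sigma> $ i * t) ^ k + a $ i * (- (t\<^sup>2)) ^ k)" for k
  define V where "V k = power_sum f (\<chi> i. b $ i * (\<sigma> $ i * t) ^ (2 * k + 1) - a $ i * (t\<^sup>2) ^ (2 * k + 1))" for k
  have t1: "0 \<le> t ^ k" "t ^ k \<le> 1" for k
    using t by (auto intro: power_le_one)
  have sg2: "(\<sigma> $ i) ^ (2 * k) = 1" for i k
    using sg[of i] by (auto simp: power_mult)
  have "T 1 = V 0"
  proof (rule odd_moment_determined[OF _ t K])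
    have "\<bar>\<sigma> $ i * t\<bar> \<le> 1" "\<bar>- (t\<^sup>2)\<bar> \<le> 1" for i
      using sg[of i] t t1(2)[of 2] by (auto simp: abs_mult)
    then have "hankel_psd (\<lambda>k. F (\<chi> i. b $ i * (\<chi> i. \<sigma> $ i * t) $ i ^ k + a $ i * (\<chi> i. - (t\<^sup>2)) $ i ^ k))"
      using ab by (intro F[unfolded two_atom_positive_def, rule_format]) (auto simp: orthant_box_def add.commute)
    then show "hankel_psd T"
      by (simp add: T_def[abs_def])
    show "(\<lambda>n. (\<Sum>\<^sub>\<infinity>\<alpha>. f \<alpha> * coeff (curve_poly G \<alpha>) n) * (t ^ (2 * k)) ^ n) sums T (2 * k)" for k
    proof -
      have "(\<chi> i. b $ i * (\<sigma> $ i * t) ^ (2 * k) + a $ i * (- (t\<^sup>2)) ^ (2 * k)) = (\<chi> i. poly (G i) (t ^ (2 * k)))"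
      proof -
        have "(- (t\<^sup>2)) ^ (2 * k) = t ^ (2 * k) * t ^ (2 * k)"
          by (simp add: power_mult power2_eq_square power_mult_distrib)
        then show ?thesis
          by (simp only: G_def power_mult_distrib sg2) (simp add: algebra_simps)
      qed
      moreover have "F (\<chi> i. poly (G i) (t ^ (2 * k))) = power_sum f (\<chi> i. poly (G i) (t ^ (2 * k)))"
        unfolding power_sum_def by (rule infsumI[symmetric, OF f(2)]) (intro box t1)
      ultimately show ?thesis
        using power_sum_along_curve(2)[OF f(1) dom(2) summ t1[of "2 * k"]] by (simp add: T_def)
    qed
    show "(\<lambda>n. (\<Sum>\<^sub>\<infinity>\<alpha>. f \<alpha> * coeff (curve_poly g \<alpha>) n) * (t ^ (2 * k + 1)) ^ n) sums V k" for k
    proof -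
      have "(\<chi> i. b $ i * (\<sigma> $ i * t) ^ (2 * k + 1) - a $ i * (t\<^sup>2) ^ (2 * k + 1)) = (\<chi> i. poly (g i) (t ^ (2 * k + 1)))"
      proof -
        have "(t\<^sup>2) ^ (2 * k + 1) = t ^ (2 * k + 1) * t ^ (2 * k + 1)"
          by (simp only: power2_eq_square power_mult_distrib)
        moreover have "(\<sigma> $ i) ^ (2 * k + 1) = \<sigma> $ i" for i
          using sg2[of i k] by simp
        ultimately show ?thesis
          unfolding g_def by (simp only: power_mult_distrib) (simp add: algebra_simps)
      qed
      then show ?thesis
        using power_sum_along_curve(2)[OF f(1) dom(1) summ t1[of "2 * k + 1"]] by (simp only: V_def)
    qed
    show "\<bar>\<Sum>\<^sub>\<infinity>\<alpha>. f \<alpha> * coeff (curve_poly g \<alpha>) n\<bar> \<le> (\<Sum>\<^sub>\<infinity>\<alpha>. f \<alpha> * coeff (curve_poly G \<alpha>) n)" for n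
      by (rule power_sum_along_curve(1)[OF f(1) dom(1) summ])
    show "T (2 * k + 1) = V k" if "K \<le> k" for k
    proof -
      have "(- (t\<^sup>2)) ^ (2 * k + 1) = - ((t\<^sup>2) ^ (2 * k + 1))"
        by (rule power_minus_odd) simp
      then show ?thesis
        using eq[OF that] unfolding T_def V_def by simp
    qed
  qed
  then show ?thesis
    by (simp add: T_def V_def mult.assoc)
qed

text \<open>
  The series represents \<open>F\<close> on the positive orthant. Two applications of \<open>curve_comparison\<close> extend
  this to a neighbourhood of the origin and then to the whole box.
\<close>

theorem two_atom_power_series:
  fixes F :: "real ^ 'm::finite \<Rightarrow> real"
  assumes F: "two_atom_positive \<rho> F" and \<rho>: "0 < \<rho>"
  obtains f where "pos_series \<rho> f" "\<And>x. vabs x \<in> orthant_box \<rho> \<Longrightarrow> F x = power_sum f x"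
proof -
  note ray = two_atom_ray_series[OF F]
  obtain f where hp: "\<And>k x. x \<in> orthant_box \<rho> \<Longrightarrow> hom_part F k x = (\<Sum>\<alpha>\<in>multi_deg k. f \<alpha> * mpow x \<alpha>)"
    using ray_series_coeffs[OF ray \<rho>] by blast
  have f0: "0 \<le> f \<alpha>" for \<alpha>
    by (rule two_atom_coeff_nonneg[OF F \<rho> hp])
  have fs: "((\<lambda>\<alpha>. f \<alpha> * mpow x \<alpha>) has_sum F x) UNIV" if "x \<in> orthant_box \<rho>" for x
    by (rule ray_series_has_sum[OF ray that hp f0])
  have pos: "F x = power_sum f x" if "x \<in> orthant_box \<rho>" for x
    unfolding power_sum_def using infsumI[OF fs[OF that]] by simp
  obtain r where r: "0 < r" "ereal r < \<rho>"
    using ereal_dense2[OF \<rho>] by auto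
  have rb: "x \<in> orthant_box \<rho>" if "\<And>i. 0 \<le> x $ i" "\<And>i. x $ i \<le> r" for x :: "real ^ 'm"
    by (rule orthant_box_le[of "\<chi> i. r"]) (use that r in \<open>auto simp: orthant_box_def\<close>)
  have near0: "F x = power_sum f x" if x: "\<And>i. \<bar>x $ i\<bar> \<le> r / 6" for x
  proof -
    \<comment> \<open>With \<open>t = 1 / 2\<close> the first odd moment \<open>b / 2 - a / 4\<close> is \<open>x\<close>, and \<open>a / 8 \<le> b\<close> makes the later odd moments nonnegative.\<close>
    define a where "a = (\<chi> i. if x $ i < 0 then - 16 / 3 * x $ i else 0)"
    define b where "b = (\<chi> i. if x $ i < 0 then - 2 / 3 * x $ i else 2 * x $ i)"
    have "F (\<chi> i. b $ i * (\<chi> i. 1) $ i * (1 / 2) - a $ i * (1 / 2)\<^sup>2)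
        = power_sum f (\<chi> i. b $ i * (\<chi> i. 1) $ i * (1 / 2) - a $ i * (1 / 2)\<^sup>2)"
    proof (rule curve_comparison[OF F f0 fs, of a b "1 / 2" "\<chi> i. 1" 1])
      show "0 \<le> a $ i" "0 \<le> b $ i" for i
        by (auto simp: a_def b_def)
      show "a + b \<in> orthant_box \<rho>"
      proof (rule rb)
        show "0 \<le> (a + b) $ i" "(a + b) $ i \<le> r" for i
          using x[of i] r by (auto simp: a_def b_def)
      qed
      show "F (\<chi> i. b $ i * ((\<chi> i. 1) $ i * (1 / 2)) ^ (2 * k + 1) - a $ i * ((1 / 2)\<^sup>2) ^ (2 * k + 1))
        = power_sum f (\<chi> i. b $ i * ((\<chi> i. 1) $ i * (1 / 2)) ^ (2 * k + 1) - a $ i * ((1 / 2)\<^sup>2) ^ (2 * k + 1))"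
        if k: "1 \<le> k" for k
      proof (intro pos rb)
        fix i
        define h where "h = (1 / 2 :: real) ^ (2 * k + 1)"
        have "h \<le> (1 / 2) ^ 3"
          unfolding h_def using k by (intro power_decreasing) auto
        then have h: "0 \<le> h" "h \<le> 1 / 8"
          by (auto simp: h_def power3_eq_cube)
        have pt: "(\<chi> i. b $ i * ((\<chi> i. 1) $ i * (1 / 2)) ^ (2 * k + 1) - a $ i * ((1 / 2)\<^sup>2) ^ (2 * k + 1)) $ i
            = h * (b $ i - a $ i * h)"
        proof -
          have "((1 / 2 :: real)\<^sup>2) ^ (2 * k + 1) = h * h"
            by (simp only: h_def power2_eq_square power_mult_distrib)
          then show ?thesis
            by (simp add: h_def algebra_simps)
        qed
        have "a $ i * h \<le> a $ i * (1 / 8)"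
          using h by (intro mult_left_mono) (auto simp: a_def)
        also have "\<dots> \<le> b $ i"
          by (auto simp: a_def b_def)
        finally have "0 \<le> b $ i - a $ i * h"
          by simp
        then show "0 \<le> (\<chi> i. b $ i * ((\<chi> i. 1) $ i * (1 / 2)) ^ (2 * k + 1) - a $ i * ((1 / 2)\<^sup>2) ^ (2 * k + 1)) $ i"
          unfolding pt using h by simp
        have "0 \<le> a $ i * h"
          using h by (auto simp: a_def)
        then have "b $ i - a $ i * h \<le> r"
          using x[of i] r by (auto simp: b_def)
        then have "h * (b $ i - a $ i * h) \<le> 1 * r"
          using h r \<open>0 \<le> b $ i - a $ i * h\<close> by (intro mult_mono) auto
        then show "(\<chi> i. b $ i * ((\<chi> i. 1) $ i * (1 / 2)) ^ (2 * k + 1) - a $ i * ((1 / 2)\<^sup>2) ^ (2 * k + 1)) $ i \<le> r"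
          unfolding pt by simp
      qed
    qed auto
    also have "(\<chi> i. b $ i * (\<chi> i. 1) $ i * (1 / 2) - a $ i * (1 / 2)\<^sup>2) = x"
      by (auto simp: Finite_Cartesian_Product.vec_eq_iff a_def b_def power2_eq_square)
    finally show ?thesis .
  qed
  have all: "F x = power_sum f x" if x: "vabs x \<in> orthant_box \<rho>" for x
  proof -
    obtain R where R: "1 < R" "\<And>z. \<lbrakk>0 \<le> z; z < R\<rbrakk> \<Longrightarrow> 0 + z *\<^sub>R vabs x \<in> orthant_box \<rho>"
      using orthant_box_slack[of 0 "vabs x" \<rho>] x by (auto simp: vabs_def)
    \<comment> \<open>An atom of mass \<open>\<bar>x\<bar> / t\<close> at \<open>\<plusminus>t\<close> has first moment \<open>x\<close> and odd moments that shrink to the origin.\<close>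
    define t where "t = 2 / (1 + R)"
    have t: "0 < t" "t < 1" "1 / t < R"
      using R(1) by (auto simp: t_def field_simps)
    define \<sigma> :: "real ^ 'm" where "\<sigma> = (\<chi> i. if x $ i < 0 then -1 else 1)"
    define b where "b = (1 / t) *\<^sub>R vabs x"
    define M where "M = (\<Sum>i\<in>UNIV. b $ i)"
    have b0: "0 \<le> b $ i" for i
      using t by (simp add: b_def vabs_def)
    have bM: "b $ i \<le> M" for i
      unfolding M_def using b0 by (intro member_le_sum) auto
    have "(\<lambda>k. M * t ^ k) \<longlonglongrightarrow> M * 0"
      using t by (intro tendsto_intros LIMSEQ_power_zero) auto
    then have "\<forall>\<^sub>F k in sequentially. M * t ^ k < r / 6"
      using r by (intro order_tendstoD(2)) auto
    then obtain K where K: "\<And>k. K \<le> k \<Longrightarrow> M * t ^ k < r / 6"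
      by (auto simp: eventually_sequentially)
    have "F (\<chi> i. b $ i * \<sigma> $ i * t - (0 :: real ^ 'm) $ i * t\<^sup>2) = power_sum f (\<chi> i. b $ i * \<sigma> $ i * t - (0 :: real ^ 'm) $ i * t\<^sup>2)"
    proof (rule curve_comparison[OF F f0 fs _ b0 _ t(1,2), of 0 \<sigma> "Suc K"])
      show "0 + b \<in> orthant_box \<rho>"
        using R(2)[of "1 / t"] t by (simp add: b_def)
      show "\<sigma> $ i = 1 \<or> \<sigma> $ i = - 1" for i
        by (simp add: \<sigma>_def)
      show "F (\<chi> i. b $ i * (\<sigma> $ i * t) ^ (2 * k + 1) - (0 :: real ^ 'm) $ i * (t\<^sup>2) ^ (2 * k + 1))
        = power_sum f (\<chi> i. b $ i * (\<sigma> $ i * t) ^ (2 * k + 1) - (0 :: real ^ 'm) $ i * (t\<^sup>2) ^ (2 * k + 1))"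
        if "Suc K \<le> k" for k
      proof (rule near0)
        fix i
        have "\<bar>(\<sigma> $ i * t) ^ (2 * k + 1)\<bar> = t ^ (2 * k + 1)"
          using t by (auto simp: \<sigma>_def power_abs[symmetric] abs_mult simp del: power_Suc)
        moreover have "b $ i * t ^ (2 * k + 1) \<le> M * t ^ (2 * k + 1)"
          using bM t by (intro mult_right_mono) auto
        moreover have "M * t ^ (2 * k + 1) < r / 6"
          using that by (intro K) auto
        ultimately show "\<bar>(\<chi> i. b $ i * (\<sigma> $ i * t) ^ (2 * k + 1) - (0 :: real ^ 'm) $ i * (t\<^sup>2) ^ (2 * k + 1)) $ i\<bar> \<le> r / 6"
          using b0[of i] by (simp add: abs_mult del: power_Suc)
      qed
    qed auto
    also have "(\<chi> i. b $ i * \<sigma> $ i * t - (0 :: real ^ 'm) $ i * t\<^sup>2) = x"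
      using t by (auto simp: Finite_Cartesian_Product.vec_eq_iff b_def vabs_def \<sigma>_def)
    finally show ?thesis .
  qed
  have "pos_series \<rho> f"
    unfolding pos_series_def using f0 has_sum_imp_summable[OF fs] by (intro conjI allI ballI)
  then show ?thesis
    using all by (rule that)
qed

section \<open>Analyticity of multivariate power series\<close>

text \<open>
  The coefficient of \<open>y\<^sup>\<beta>\<close> in \<open>(a + y)\<^sup>\<alpha>\<close>.
\<close>

definition shift_coeff :: "real ^ 'm::finite \<Rightarrow> ('m \<Rightarrow> nat) \<Rightarrow> ('m \<Rightarrow> nat) \<Rightarrow> real" where
  "shift_coeff a \<alpha> \<beta> = (\<Prod>i\<in>UNIV. real (\<alpha> i choose \<beta> i) * a $ i ^ (\<alpha> i - \<beta> i))"

lemma mpow_shift: "((\<lambda>\<beta>. shift_coeff a \<alpha> \<beta> * mpow y \<beta>) has_sum mpow (a + y) \<alpha>) UNIV"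
proof -
  let ?B = "PiE UNIV (\<lambda>i. {..\<alpha> i})"
  have "mpow (a + y) \<alpha> = (\<Prod>i\<in>UNIV. \<Sum>k\<le>\<alpha> i. real (\<alpha> i choose k) * a $ i ^ (\<alpha> i - k) * y $ i ^ k)"
    unfolding mpow_def by (intro prod.cong refl) (simp add: add.commute[of "a $ _"] binomial_ring mult_ac)
  also have "\<dots> = (\<Sum>\<beta>\<in>?B. \<Prod>i\<in>UNIV. real (\<alpha> i choose \<beta> i) * a $ i ^ (\<alpha> i - \<beta> i) * y $ i ^ \<beta> i)"
    by (intro prod_sum_PiE) auto
  also have "\<dots> = (\<Sum>\<beta>\<in>?B. shift_coeff a \<alpha> \<beta> * mpow y \<beta>)"
    by (simp add: shift_coeff_def mpow_def prod.distrib)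
  finally have "((\<lambda>\<beta>. shift_coeff a \<alpha> \<beta> * mpow y \<beta>) has_sum mpow (a + y) \<alpha>) ?B"
    by (simp add: finite_PiE)
  then show ?thesis
  proof (rule has_sum_cong_neutral[THEN iffD1, rotated -1])
    fix \<beta> assume "\<beta> \<in> UNIV - ?B"
    then obtain i where "\<alpha> i < \<beta> i"
      by (auto simp: PiE_iff not_le)
    then show "shift_coeff a \<alpha> \<beta> * mpow y \<beta> = 0"
      unfolding shift_coeff_def by (auto simp: binomial_eq_0)
  qed auto
qed

lemma abs_mpow: "\<bar>mpow y \<beta>\<bar> = mpow (vabs y) \<beta>"
  by (simp add: mpow_def vabs_def abs_prod power_abs)

lemma abs_shift_coeff: "\<bar>shift_coeff a \<alpha> \<beta>\<bar> = shift_coeff (vabs a) \<alpha> \<beta>"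
  by (simp add: shift_coeff_def vabs_def abs_prod abs_mult power_abs)

text \<open>
  The Taylor coefficients at \<open>a\<close> of the sum of the series.
\<close>

definition local_coeff :: "(('m::finite \<Rightarrow> nat) \<Rightarrow> real) \<Rightarrow> real ^ 'm \<Rightarrow> ('m \<Rightarrow> nat) \<Rightarrow> real" where
  "local_coeff f a \<beta> = (\<Sum>\<^sub>\<infinity>\<alpha>. f \<alpha> * shift_coeff a \<alpha> \<beta>)"

lemma power_sum_local:
  assumes f: "pos_series \<rho> f" and ay: "vabs a + vabs y \<in> orthant_box \<rho>"
  shows "((\<lambda>\<beta>. local_coeff f a \<beta> * mpow y \<beta>) has_sum power_sum f (a + y)) UNIV"
    and "(\<lambda>\<alpha>. f \<alpha> * (shift_coeff a \<alpha> \<beta> * mpow y \<beta>)) summable_on UNIV"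
proof -
  note * = power_sum_rearrange[where f = f and X = "a + y" and Y = "vabs a + vabs y"
      and e = "\<lambda>\<alpha> \<beta>. shift_coeff a \<alpha> \<beta> * mpow y \<beta>" and E = "\<lambda>\<alpha> \<beta>. shift_coeff (vabs a) \<alpha> \<beta> * mpow (vabs y) \<beta>",
      OF _ _ mpow_shift mpow_shift]
  have "(\<Sum>\<^sub>\<infinity>\<alpha>. f \<alpha> * (shift_coeff a \<alpha> \<beta> * mpow y \<beta>)) = local_coeff f a \<beta> * mpow y \<beta>" for \<beta>
    unfolding local_coeff_def by (subst infsum_cmult_left'[symmetric]) (simp add: mult.assoc)
  with * show "((\<lambda>\<beta>. local_coeff f a \<beta> * mpow y \<beta>) has_sum power_sum f (a + y)) UNIV"
    using f ay by (simp add: pos_series_def abs_mult abs_mpow abs_shift_coeff)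
  show "(\<lambda>\<alpha>. f \<alpha> * (shift_coeff a \<alpha> \<beta> * mpow y \<beta>)) summable_on UNIV"
    using *(1) f ay by (simp add: pos_series_def abs_mult abs_mpow abs_shift_coeff)
qed

lemma vabs_margin:
  fixes a :: "real ^ 'm::finite"
  assumes a: "vabs a \<in> orthant_box \<rho>"
  shows "\<exists>\<epsilon>>0. \<forall>y. (\<forall>i. \<bar>y $ i\<bar> \<le> \<epsilon>) \<longrightarrow> vabs a + vabs y \<in> orthant_box \<rho>"
proof -
  have "\<exists>\<epsilon>>0. ereal (\<bar>a $ i\<bar> + \<epsilon>) < \<rho>" for i
  proof -
    have "ereal \<bar>a $ i\<bar> < \<rho>"
      using a by (simp add: orthant_box_def vabs_def)
    then obtain s where "ereal \<bar>a $ i\<bar> < ereal s" "ereal s < \<rho>"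
      using ereal_dense2 by blast
    then show ?thesis
      by (intro exI[of _ "s - \<bar>a $ i\<bar>"]) auto
  qed
  then obtain \<epsilon> where \<epsilon>: "\<And>i. 0 < \<epsilon> i" "\<And>i. ereal (\<bar>a $ i\<bar> + \<epsilon> i) < \<rho>"
    by metis
  show ?thesis
  proof (intro exI[of _ "Min (range \<epsilon>)"] conjI allI impI)
    show "0 < Min (range \<epsilon>)"
      using \<epsilon>(1) by (subst Min_gr_iff) auto
    fix y :: "real ^ 'm" assume y: "\<forall>i. \<bar>y $ i\<bar> \<le> Min (range \<epsilon>)"
    show "vabs a + vabs y \<in> orthant_box \<rho>"
    proof (rule orthant_box_le[of "\<chi> i. \<bar>a $ i\<bar> + \<epsilon> i"])
      show "(\<chi> i. \<bar>a $ i\<bar> + \<epsilon> i) \<in> orthant_box \<rho>"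
        using \<epsilon> less_imp_le[OF \<epsilon>(1)] by (simp add: orthant_box_def)
      show "(vabs a + vabs y) $ i \<le> (\<chi> i. \<bar>a $ i\<bar> + \<epsilon> i) $ i" for i
        using y[rule_format, of i] Min_le[of "range \<epsilon>" "\<epsilon> i"] by (simp add: vabs_def)
    qed (simp add: vabs_def)
  qed
qed

lemma eventually_nhds_component_le:
  fixes a :: "real ^ 'm::finite"
  assumes "0 < \<epsilon>"
  shows "\<forall>\<^sub>F x in nhds a. \<forall>i. \<bar>(x - a) $ i\<bar> \<le> \<epsilon>"
  unfolding eventually_nhds_metric
proof (intro exI[of _ \<epsilon>] conjI allI impI)
  fix x :: "real ^ 'm" and i assume "dist x a < \<epsilon>"
  then show "\<bar>(x - a) $ i\<bar> \<le> \<epsilon>"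
    using component_le_norm_cart[of "x - a" i] by (simp add: dist_norm)
qed (use assms in auto)

lemma open_vabs_box: "open {x :: real ^ 'm::finite. vabs x \<in> orthant_box \<rho>}"
proof (subst open_subopen, rule ballI)
  fix a :: "real ^ 'm" assume "a \<in> {x. vabs x \<in> orthant_box \<rho>}"
  then have a: "vabs a \<in> orthant_box \<rho>"
    by simp
  obtain \<epsilon> where \<epsilon>: "0 < \<epsilon>" "\<And>y. (\<forall>i. \<bar>y $ i\<bar> \<le> \<epsilon>) \<Longrightarrow> vabs a + vabs y \<in> orthant_box \<rho>"
    using vabs_margin[OF a] by blast
  have "x \<in> {x. vabs x \<in> orthant_box \<rho>}" if "\<forall>i. \<bar>(x - a) $ i\<bar> \<le> \<epsilon>" for x
    unfolding mem_Collect_eq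
  proof (rule orthant_box_le[OF \<epsilon>(2)])
    show "\<forall>i. \<bar>(x - a) $ i\<bar> \<le> \<epsilon>"
      using that by simp
    show "vabs x $ i \<le> (vabs a + vabs (x - a)) $ i" for i
      by (simp add: vabs_def)
  qed (simp add: vabs_def)
  then have "\<forall>\<^sub>F x in nhds a. x \<in> {x. vabs x \<in> orthant_box \<rho>}"
    using eventually_nhds_component_le[OF \<epsilon>(1), of a] by (auto elim: eventually_mono)
  then show "\<exists>T. open T \<and> a \<in> T \<and> T \<subseteq> {x. vabs x \<in> orthant_box \<rho>}"
    unfolding eventually_nhds by blast
qed

lemma power_sum_analytic:
  assumes f: "pos_series \<rho> f"
  shows "real_analytic_on {x. vabs x \<in> orthant_box \<rho>} (power_sum f)"
  unfolding real_analytic_on_def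
proof
  fix a :: "real ^ 'a" assume "a \<in> {x. vabs x \<in> orthant_box \<rho>}"
  then have a: "vabs a \<in> orthant_box \<rho>"
    by simp
  obtain \<epsilon> where \<epsilon>: "0 < \<epsilon>" "\<And>y. (\<forall>i. \<bar>y $ i\<bar> \<le> \<epsilon>) \<Longrightarrow> vabs a + vabs y \<in> orthant_box \<rho>"
    using vabs_margin[OF a] by blast
  show "\<exists>c. \<forall>\<^sub>F x in nhds a. ((\<lambda>\<alpha>. c \<alpha> * (\<Prod>i\<in>UNIV. (x $ i - a $ i) ^ \<alpha> i)) has_sum power_sum f x) UNIV"
  proof (intro exI[of _ "local_coeff f a"] eventually_mono[OF eventually_nhds_component_le[OF \<epsilon>(1), of a]])
    fix x assume "\<forall>i. \<bar>(x - a) $ i\<bar> \<le> \<epsilon>"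
    then have "vabs a + vabs (x - a) \<in> orthant_box \<rho>"
      by (intro \<epsilon>(2)) auto
    from power_sum_local(1)[OF f this]
    show "((\<lambda>\<alpha>. local_coeff f a \<alpha> * (\<Prod>i\<in>UNIV. (x $ i - a $ i) ^ \<alpha> i)) has_sum power_sum f x) UNIV"
      by (simp add: mpow_def)
  qed
qed

lemma power_sum_isCont:
  fixes f :: "('m::finite \<Rightarrow> nat) \<Rightarrow> real"
  assumes f: "pos_series \<rho> f" and a: "vabs a \<in> orthant_box \<rho>"
  shows "isCont (power_sum f) a"
proof -
  obtain \<epsilon> where \<epsilon>: "0 < \<epsilon>" "\<And>y. (\<forall>i. \<bar>y $ i\<bar> \<le> \<epsilon>) \<Longrightarrow> vabs a + vabs y \<in> orthant_box \<rho>"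
    using vabs_margin[OF a] by blast
  define e :: "real ^ 'm" where "e = (\<chi> i. \<epsilon>)"
  define Y where "Y = {x. \<forall>i. \<bar>(x - a) $ i\<bar> \<le> \<epsilon>}"
  have "vabs a + e \<in> orthant_box \<rho>"
    using \<epsilon>(2)[of e] \<epsilon>(1) by (simp add: e_def vabs_def)
  then have summ: "(\<lambda>\<alpha>. f \<alpha> * mpow (vabs a + e) \<alpha>) summable_on UNIV"
    using f by (simp add: pos_series_def)
  have "uniform_limit Y (\<lambda>A x. \<Sum>\<alpha>\<in>A. f \<alpha> * mpow x \<alpha>) (power_sum f) (finite_subsets_at_top UNIV)"
    unfolding power_sum_def[abs_def]
  proof (rule Weierstrass_m_test_general[OF _ summ])
    fix \<alpha> and x assume "x \<in> Y"
    then have "\<bar>x $ i - a $ i\<bar> \<le> \<epsilon>" for i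
      by (simp add: Y_def)
    then have x: "\<bar>x $ i\<bar> \<le> (vabs a + e) $ i" for i
      using abs_triangle_ineq2[of "x $ i" "a $ i"] order_trans[of "\<bar>x $ i\<bar> - \<bar>a $ i\<bar>"]
      by (fastforce simp: vabs_def e_def)
    have "mpow (vabs x) \<alpha> \<le> mpow (vabs a + e) \<alpha>"
      unfolding mpow_def using x by (intro prod_mono conjI power_mono) (auto simp: vabs_def)
    then show "norm (f \<alpha> * mpow x \<alpha>) \<le> f \<alpha> * mpow (vabs a + e) \<alpha>"
      using f by (simp add: abs_mult abs_mpow pos_series_def mult_left_mono)
  qed
  then have "continuous_on Y (power_sum f)"
    by (rule uniform_limit_theorem[rotated])
      (auto intro!: always_eventually continuous_intros simp: mpow_def)
  moreover have "a \<in> interior Y"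
    using eventually_nhds_component_le[OF \<epsilon>(1), of a] unfolding eventually_nhds interior_def Y_def by auto
  ultimately show ?thesis
    by (rule continuous_on_interior)
qed

lemma has_sum_multi_deg_sums:
  fixes g :: "('m::finite \<Rightarrow> nat) \<Rightarrow> real"
  assumes "(g has_sum S) UNIV"
  shows "(\<lambda>k. \<Sum>\<alpha>\<in>multi_deg k. g \<alpha>) sums S"
proof -
  have "bij_betw snd (Sigma UNIV multi_deg) (UNIV :: ('m \<Rightarrow> nat) set)"
    by (rule bij_betwI[of _ _ _ "\<lambda>\<alpha>. (sum \<alpha> UNIV, \<alpha>)"]) (auto simp: multi_deg_def)
  then have "((\<lambda>(_, \<alpha>). g \<alpha>) has_sum S) (Sigma UNIV multi_deg)"
    using has_sum_reindex_bij_betw[of snd "Sigma UNIV multi_deg" UNIV g S] assms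
    by (simp add: case_prod_unfold)
  moreover have "((\<lambda>\<alpha>. case (k, \<alpha>) of (_, \<alpha>) \<Rightarrow> g \<alpha>) has_sum (\<Sum>\<alpha>\<in>multi_deg k. g \<alpha>)) (multi_deg k)" for k
    using has_sum_finite[OF finite_multi_deg, of g] by simp
  ultimately have "((\<lambda>k. \<Sum>\<alpha>\<in>multi_deg k. g \<alpha>) has_sum S) UNIV"
    by (rule has_sum_SigmaD)
  then show ?thesis
    by (rule has_sum_imp_sums)
qed

lemma has_sum_line_sums:
  assumes "((\<lambda>\<beta>. c \<beta> * mpow (s *\<^sub>R d) \<beta>) has_sum S) UNIV"
  shows "(\<lambda>n. (\<Sum>\<beta>\<in>multi_deg n. c \<beta> * mpow d \<beta>) * s ^ n) sums S"
proof -
  have "(\<Sum>\<beta>\<in>multi_deg n. c \<beta> * mpow (s *\<^sub>R d) \<beta>) = (\<Sum>\<beta>\<in>multi_deg n. c \<beta> * mpow d \<beta>) * s ^ n" for n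
    unfolding mpow_scaleR sum_distrib_right by (intro sum.cong) (auto simp: multi_deg_def)
  with has_sum_multi_deg_sums[OF assms] show ?thesis
    by simp
qed

definition inc_index :: "'m \<Rightarrow> ('m \<Rightarrow> nat) \<Rightarrow> 'm \<Rightarrow> nat" where
  "inc_index i \<gamma> = \<gamma>(i := Suc (\<gamma> i))"

lemma shift_coeff_unit:
  "shift_coeff a (inc_index i \<gamma>) (inc_index i (\<lambda>_. 0)) = real (Suc (\<gamma> i)) * mpow a \<gamma>"
proof -
  have "shift_coeff a (inc_index i \<gamma>) (inc_index i (\<lambda>_. 0))
      = (\<Prod>j\<in>UNIV. (if j = i then real (Suc (\<gamma> i)) else 1) * a $ j ^ \<gamma> j)"
    unfolding shift_coeff_def by (intro prod.cong) (auto simp: inc_index_def)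
  also have "\<dots> = real (Suc (\<gamma> i)) * mpow a \<gamma>"
    by (simp add: prod.distrib mpow_def)
  finally show ?thesis .
qed

lemma inc_index_range: "range (inc_index i) = {\<alpha>. \<alpha> i \<noteq> 0}"
proof (rule equalityI; rule subsetI)
  fix \<alpha> :: "'a \<Rightarrow> nat" assume "\<alpha> \<in> {\<alpha>. \<alpha> i \<noteq> 0}"
  then have "\<alpha> = inc_index i (\<alpha>(i := \<alpha> i - 1))"
    by (auto simp: inc_index_def)
  then show "\<alpha> \<in> range (inc_index i)"
    by blast
qed (auto simp: inc_index_def)

lemma inj_inc_index: "inj (inc_index i)"
proof (rule injI, rule ext)
  fix \<alpha> \<beta> :: "'a \<Rightarrow> nat" and j
  assume "inc_index i \<alpha> = inc_index i \<beta>"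
  then have "inc_index i \<alpha> j = inc_index i \<beta> j"
    by simp
  then show "\<alpha> j = \<beta> j"
    by (auto simp: inc_index_def split: if_splits)
qed

text \<open>
  The derivative is the coefficient of degree one in the expansion around \<open>a\<close>. Re-indexing writes it as a
  series with nonnegative coefficients, so the class of such series is closed under
  partial differentiation.
\<close>

lemma power_sum_partial_derivative:
  fixes f :: "('m::finite \<Rightarrow> nat) \<Rightarrow> real"
  assumes f: "pos_series \<rho> f"
  obtains f' where "pos_series \<rho> f'"
    "\<And>a. vabs a \<in> orthant_box \<rho> \<Longrightarrow>
      ((\<lambda>t. power_sum f (a + t *\<^sub>R axis i 1)) has_real_derivative power_sum f' a) (at 0)"
proof -
  define f' where "f' \<gamma> = real (Suc (\<gamma> i)) * f (inc_index i \<gamma>)" for \<gamma>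
  define u where "u = inc_index i (\<lambda>_. 0)"
  have re: "((\<lambda>\<alpha>. f \<alpha> * shift_coeff a \<alpha> u) has_sum S) UNIV \<longleftrightarrow> ((\<lambda>\<gamma>. f' \<gamma> * mpow a \<gamma>) has_sum S) UNIV" for a S
  proof -
    have "((\<lambda>\<alpha>. f \<alpha> * shift_coeff a \<alpha> u) has_sum S) UNIV \<longleftrightarrow>
        ((\<lambda>\<alpha>. f \<alpha> * shift_coeff a \<alpha> u) has_sum S) (range (inc_index i))"
    proof (rule has_sum_cong_neutral)
      fix \<alpha> :: "'m \<Rightarrow> nat" assume "\<alpha> \<in> UNIV - range (inc_index i)"
      then have "\<alpha> i = 0"
        by (simp add: inc_index_range)
      then have "real (\<alpha> i choose u i) = 0"
        by (simp add: u_def inc_index_def)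
      then show "f \<alpha> * shift_coeff a \<alpha> u = 0"
        unfolding shift_coeff_def by (auto intro!: prod_zero)
    qed auto
    also have "\<dots> \<longleftrightarrow> ((\<lambda>\<gamma>. f' \<gamma> * mpow a \<gamma>) has_sum S) UNIV"
      unfolding has_sum_reindex[OF inj_inc_index]
      by (simp add: o_def u_def shift_coeff_unit f'_def mult_ac)
    finally show ?thesis .
  qed
  have summ: "(\<lambda>\<alpha>. f \<alpha> * shift_coeff a \<alpha> u) summable_on UNIV" if a: "vabs a \<in> orthant_box \<rho>" for a
  proof -
    obtain \<epsilon> where \<epsilon>: "0 < \<epsilon>" "\<And>y. (\<forall>i. \<bar>y $ i\<bar> \<le> \<epsilon>) \<Longrightarrow> vabs a + vabs y \<in> orthant_box \<rho>"
      using vabs_margin[OF a] by blast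
    have "(\<lambda>\<alpha>. f \<alpha> * (shift_coeff a \<alpha> u * mpow (\<chi> i. \<epsilon>) u) * (1 / mpow (\<chi> i. \<epsilon>) u)) summable_on UNIV"
      using \<epsilon> by (intro summable_on_cmult_left power_sum_local(2)[OF f]) auto
    moreover have "mpow (\<chi> i. \<epsilon>) u \<noteq> 0"
      using \<epsilon>(1) by (simp add: mpow_def)
    ultimately show ?thesis
      by simp
  qed
  have pos: "pos_series \<rho> f'"
    unfolding pos_series_def
  proof (intro conjI allI ballI)
    show "0 \<le> f' \<alpha>" for \<alpha>
      using f by (simp add: f'_def pos_series_def)
    fix x :: "real ^ 'm" assume x: "x \<in> orthant_box \<rho>"
    then have "vabs x = x"
      by (simp add: vabs_def orthant_box_def Finite_Cartesian_Product.vec_eq_iff)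
    then show "(\<lambda>\<alpha>. f' \<alpha> * mpow x \<alpha>) summable_on UNIV"
      using summ[of x] x re[of x] by (auto simp: summable_on_def)
  qed
  have deriv: "((\<lambda>t. power_sum f (a + t *\<^sub>R axis i 1)) has_real_derivative power_sum f' a) (at 0)"
    if a: "vabs a \<in> orthant_box \<rho>" for a
  proof -
    obtain \<epsilon> where \<epsilon>: "0 < \<epsilon>" "\<And>y. (\<forall>i. \<bar>y $ i\<bar> \<le> \<epsilon>) \<Longrightarrow> vabs a + vabs y \<in> orthant_box \<rho>"
      using vabs_margin[OF a] by blast
    define q where "q n = (\<Sum>\<beta>\<in>multi_deg n. local_coeff f a \<beta> * mpow (axis i 1) \<beta>)" for n
    have q: "(\<lambda>n. q n * t ^ n) sums power_sum f (a + t *\<^sub>R axis i 1)" if "\<bar>t\<bar> \<le> \<epsilon>" for t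
      unfolding q_def
    proof (intro has_sum_line_sums power_sum_local(1)[OF f] \<epsilon>(2))
      show "\<forall>j. \<bar>(t *\<^sub>R axis i 1) $ j\<bar> \<le> \<epsilon>"
        using that \<epsilon>(1) by (simp add: axis_def)
    qed
    have "((\<lambda>t. \<Sum>n. q n * t ^ n) has_real_derivative (\<Sum>n. diffs q n * 0 ^ n)) (at 0)"
      using \<epsilon>(1) by (intro termdiffs_strong[of _ \<epsilon>] sums_summable[OF q]) auto
    moreover have "(\<Sum>n. diffs q n * 0 ^ n) = q 1"
      by (simp add: diffs_def)
    moreover have "\<forall>\<^sub>F t in nhds 0. (\<Sum>n. q n * t ^ n) = power_sum f (a + t *\<^sub>R axis i 1)"
      unfolding eventually_nhds_metric
      using \<epsilon>(1) q by (intro exI[of _ \<epsilon>]) (auto simp: sums_iff dist_real_def)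
    ultimately have "((\<lambda>t. power_sum f (a + t *\<^sub>R axis i 1)) has_real_derivative q 1) (at 0)"
      using DERIV_cong_ev[OF refl, of "\<lambda>t. \<Sum>n. q n * t ^ n" "\<lambda>t. power_sum f (a + t *\<^sub>R axis i 1)" 0 "q 1" "q 1"] by simp
    moreover have "q 1 = power_sum f' a"
    proof -
      have u1: "u \<in> multi_deg 1"
        by (simp add: multi_deg_def u_def inc_index_def sum.remove[of UNIV i])
      have "q 1 = (\<Sum>\<beta>\<in>{u}. local_coeff f a \<beta> * mpow (axis i 1) \<beta>)"
        unfolding q_def
      proof (rule sum.mono_neutral_right[OF finite_multi_deg])
        show "\<forall>\<beta>\<in>multi_deg 1 - {u}. local_coeff f a \<beta> * mpow (axis i 1) \<beta> = 0"
        proof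
          fix \<beta> assume \<beta>: "\<beta> \<in> multi_deg 1 - {u}"
          have "\<exists>j. j \<noteq> i \<and> \<beta> j \<noteq> 0"
          proof (rule ccontr)
            assume "\<not> ?thesis"
            then have z: "\<beta> j = 0" if "j \<noteq> i" for j
              using that by blast
            then have "sum \<beta> UNIV = \<beta> i"
              by (simp add: sum.remove[of UNIV i])
            then have "\<beta> = u"
              using \<beta> z by (auto simp: multi_deg_def u_def inc_index_def)
            then show False
              using \<beta> by simp
          qed
          then obtain j where "j \<noteq> i" "\<beta> j \<noteq> 0"
            by blast
          then have "mpow (axis i 1) \<beta> = 0"
            unfolding mpow_def by (intro prod_zero) (auto simp: axis_def intro!: exI[of _ j])
          then show "local_coeff f a \<beta> * mpow (axis i 1) \<beta> = 0"
            by simp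
        qed
      qed (use u1 in auto)
      also have "mpow (axis i 1) u = 1"
        unfolding mpow_def by (intro prod.neutral) (auto simp: axis_def u_def inc_index_def)
      then have "(\<Sum>\<beta>\<in>{u}. local_coeff f a \<beta> * mpow (axis i 1) \<beta>) = local_coeff f a u"
        by simp
      also have "\<dots> = power_sum f' a"
        unfolding local_coeff_def power_sum_def
        using re[of a] has_sum_infsum[OF summ[OF a]] infsumI by metis
      finally show ?thesis .
    qed
    ultimately show ?thesis
      by simp
  qed
  show ?thesis
    by (rule that[OF pos deriv])
qed

lemma power_sum_nonneg:
  assumes "pos_series \<rho> f" "\<And>i. 0 \<le> x $ i"
  shows "0 \<le> power_sum f x"
  unfolding power_sum_def using assms
  by (intro infsum_nonneg mult_nonneg_nonneg mpow_nonneg) (auto simp: pos_series_def)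

theorem power_sum_mixed_partials:
  fixes f :: "('m::finite \<Rightarrow> nat) \<Rightarrow> real"
  assumes f: "pos_series \<rho> f" and F: "\<And>x. vabs x \<in> orthant_box \<rho> \<Longrightarrow> F x = power_sum f x"
  shows "\<exists>h. pos_series \<rho> h \<and> (\<forall>x. vabs x \<in> orthant_box \<rho> \<longrightarrow>
    mixed_partial_exists is F x \<and> mixed_partial is F x = power_sum h x)"
proof (induction "is")
  case Nil
  show ?case
    using f F by auto
next
  case (Cons i "is")
  then obtain h where h: "pos_series \<rho> h"
    "\<And>x. vabs x \<in> orthant_box \<rho> \<Longrightarrow> mixed_partial_exists is F x"
    "\<And>x. vabs x \<in> orthant_box \<rho> \<Longrightarrow> mixed_partial is F x = power_sum h x"
    by blast
  obtain h' where h': "pos_series \<rho> h'" "\<And>a. vabs a \<in> orthant_box \<rho> \<Longrightarrow>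
      ((\<lambda>t. power_sum h (a + t *\<^sub>R axis i 1)) has_real_derivative power_sum h' a) (at 0)"
    using power_sum_partial_derivative[OF h(1)] by blast
  have nbh: "\<forall>\<^sub>F y in nhds x. vabs y \<in> orthant_box \<rho>" if "vabs x \<in> orthant_box \<rho>" for x :: "real ^ 'm"
    using eventually_nhds_in_open[OF open_vabs_box, of x \<rho>] that by simp
  have deriv: "((\<lambda>t. mixed_partial is F (x + t *\<^sub>R axis i 1)) has_real_derivative power_sum h' x) (at 0)"
    if x: "vabs x \<in> orthant_box \<rho>" for x
  proof -
    have "filterlim (\<lambda>t. x + t *\<^sub>R axis i 1) (nhds x) (nhds 0)"
      by (auto intro!: tendsto_eq_intros filterlim_ident)
    then have "\<forall>\<^sub>F t in nhds 0. vabs (x + t *\<^sub>R axis i 1) \<in> orthant_box \<rho>"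
      using nbh[OF x] by (rule eventually_compose_filterlim[rotated])
    then have "\<forall>\<^sub>F t in nhds 0. power_sum h (x + t *\<^sub>R axis i 1) = mixed_partial is F (x + t *\<^sub>R axis i 1)"
      by (rule eventually_mono) (simp add: h(3))
    from DERIV_cong_ev[OF refl this refl] h'(2)[OF x] show ?thesis
      by simp
  qed
  show ?case
  proof (intro exI[of _ h'] conjI allI impI h'(1))
    fix x :: "real ^ 'm" assume x: "vabs x \<in> orthant_box \<rho>"
    show "mixed_partial_exists (i # is) F x"
      using deriv[OF x] eventually_mono[OF nbh[OF x] h(2)] by (auto simp: field_differentiable_def)
    show "mixed_partial (i # is) F x = power_sum h' x"
      using DERIV_imp_deriv[OF deriv[OF x]] by (simp add: partial_deriv_def)
  qed
qed

theorem power_sum_absolutely_monotonic: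
  fixes f :: "('m::finite \<Rightarrow> nat) \<Rightarrow> real"
  assumes f: "pos_series \<rho> f" and F: "\<And>x. vabs x \<in> orthant_box \<rho> \<Longrightarrow> F x = power_sum f x"
  shows "absolutely_monotonic_on (orthant_box \<rho>) F"
  unfolding absolutely_monotonic_on_def
proof (intro conjI ballI allI)
  have v: "vabs x \<in> orthant_box \<rho>" "\<And>i. 0 \<le> x $ i" if "x \<in> orthant_box \<rho>" for x :: "real ^ 'm"
  proof -
    show "0 \<le> x $ i" for i
      using that by (simp add: orthant_box_def)
    have "vabs x = x"
      using that by (simp add: vabs_def orthant_box_def Finite_Cartesian_Product.vec_eq_iff)
    then show "vabs x \<in> orthant_box \<rho>"
      using that by simp
  qed
  have "continuous_on (orthant_box \<rho>) (power_sum f)"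
    using v power_sum_isCont[OF f] by (intro continuous_at_imp_continuous_on) auto
  then show "continuous_on (orthant_box \<rho>) F"
    using F v by (subst continuous_on_cong[OF refl]) auto
  fix x :: "real ^ 'm" and "is" assume "x \<in> interior (orthant_box \<rho>)"
  then have x: "x \<in> orthant_box \<rho>"
    using interior_subset by blast
  obtain h where "pos_series \<rho> h" "mixed_partial_exists is F x" "mixed_partial is F x = power_sum h x"
    using power_sum_mixed_partials[OF f F, of "is"] v(1)[OF x] by blast
  then show "mixed_partial_exists is F x" "0 \<le> mixed_partial is F x"
    using power_sum_nonneg v(2)[OF x] by auto
qed

section \<open>Absolutely monotonic functions\<close>

primrec mdiff :: "(real ^ 'm::finite) list \<Rightarrow> (real ^ 'm \<Rightarrow> real) \<Rightarrow> real ^ 'm \<Rightarrow> real" where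
  "mdiff [] F x = F x"
| "mdiff (b # bs) F x = mdiff bs (\<lambda>y. F (y + b) - F y) x"

text \<open>
  The points in the open orthant whose translates by steps up to \<open>u\<close> stay in the box. A difference
  with step \<open>b\<close> is controlled on \<open>open_box \<rho> (u + b)\<close> by what is known on \<open>open_box \<rho> u\<close>.
\<close>

definition open_box :: "ereal \<Rightarrow> real ^ 'm::finite \<Rightarrow> (real ^ 'm) set" where
  "open_box \<rho> u = {x. \<forall>i. 0 < x $ i \<and> ereal (x $ i + u $ i) < \<rho>}"

lemma open_boxD:
  assumes "x \<in> open_box \<rho> (u + b)" "\<And>i. 0 \<le> b $ i"
  shows "x \<in> open_box \<rho> u" "x + b \<in> open_box \<rho> u"
proof -
  have *: "0 < x $ i" "ereal (x $ i + (u $ i + b $ i)) < \<rho>" for i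
    using assms(1) by (auto simp: open_box_def)
  have "ereal (x $ i + u $ i) < \<rho>" for i
    by (rule le_less_trans[OF _ *(2)[of i]]) (use assms(2)[of i] in simp)
  then show "x \<in> open_box \<rho> u"
    using *(1) by (simp add: open_box_def)
  have "0 < x $ i + b $ i" for i
    using *(1)[of i] assms(2)[of i] by linarith
  then show "x + b \<in> open_box \<rho> u"
    using *(2) by (simp add: open_box_def algebra_simps)
qed

text \<open>
  Go from \<open>x\<close> to \<open>x + b\<close> by changing one coordinate at a time.
\<close>

lemma partials_nonneg_mono:
  fixes h :: "real ^ 'm::finite \<Rightarrow> real"
  assumes h: "\<And>i x. x \<in> open_box \<rho> u \<Longrightarrow>
      \<exists>d\<ge>0. ((\<lambda>t. h (x + t *\<^sub>R axis i 1)) has_real_derivative d) (at 0)"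
    and b: "\<And>i. 0 \<le> b $ i" and x: "x \<in> open_box \<rho> u" "x + b \<in> open_box \<rho> u"
  shows "h x \<le> h (x + b)"
proof -
  define p where "p S = (\<chi> j. if j \<in> S then b $ j else 0)" for S :: "'m set"
  have "h x \<le> h (x + p S)" if "finite S" for S
    using that
  proof (induction S)
    case empty
    have "p {} = 0"
      by (simp add: p_def Finite_Cartesian_Product.vec_eq_iff)
    then show ?case
      by simp
  next
    case (insert i S)
    define y where "y = x + p S"
    have y: "y + t *\<^sub>R axis i 1 \<in> open_box \<rho> u" if t: "0 \<le> t" "t \<le> b $ i" for t
      unfolding open_box_def mem_Collect_eq
    proof (intro allI conjI)
      fix j
      have le: "0 \<le> (p S + t *\<^sub>R axis i 1) $ j" "(p S + t *\<^sub>R axis i 1) $ j \<le> b $ j"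
        using t b[of j] insert.hyps by (auto simp: p_def axis_def)
      have eq: "(y + t *\<^sub>R axis i 1) $ j = x $ j + (p S + t *\<^sub>R axis i 1) $ j"
        by (simp add: y_def)
      show "0 < (y + t *\<^sub>R axis i 1) $ j"
        unfolding eq using le x(1) by (simp add: open_box_def add_pos_nonneg)
      have "ereal (x $ j + b $ j + u $ j) < \<rho>"
        using x(2) by (simp add: open_box_def)
      then show "ereal ((y + t *\<^sub>R axis i 1) $ j + u $ j) < \<rho>"
        unfolding eq by (rule le_less_trans[rotated]) (use le in simp)
    qed
    have "h (y + 0 *\<^sub>R axis i 1) \<le> h (y + (b $ i) *\<^sub>R axis i 1)"
    proof (rule DERIV_nonneg_imp_nondecreasing[where f = "\<lambda>t. h (y + t *\<^sub>R axis i 1)"])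
      fix t assume t: "0 \<le> t" "t \<le> b $ i"
      obtain d where d: "0 \<le> d" "((\<lambda>s. h (y + t *\<^sub>R axis i 1 + s *\<^sub>R axis i 1)) has_real_derivative d) (at 0)"
        using h[OF y[OF t]] by blast
      have "((\<lambda>s. (\<lambda>t. h (y + t *\<^sub>R axis i 1)) (s + t)) has_real_derivative d) (at 0)"
        using d(2) by (simp add: scaleR_add_left add.assoc add.commute[of "t *\<^sub>R _"])
      then have "((\<lambda>t. h (y + t *\<^sub>R axis i 1)) has_real_derivative d) (at (0 + t))"
        unfolding DERIV_shift .
      then show "\<exists>d. ((\<lambda>t. h (y + t *\<^sub>R axis i 1)) has_real_derivative d) (at t) \<and> 0 \<le> d"
        using d(1) by auto
    qed (rule b)
    moreover have e: "y + (b $ i) *\<^sub>R axis i 1 = x + p (insert i S)"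
      using insert.hyps by (auto simp: y_def p_def axis_def Finite_Cartesian_Product.vec_eq_iff)
    ultimately have "h y \<le> h (x + p (insert i S))"
      unfolding e by simp
    then show ?case
      using insert.IH unfolding y_def by linarith
  qed
  from this[of UNIV] show ?thesis
    by (simp add: p_def)
qed

text \<open>
  The function \<open>g\<close> lists a function together with all its mixed partial derivatives. Differences with
  step \<open>b\<close> of all members of such a family form another one, and its members are nonnegative by
  monotonicity.
\<close>

lemma mdiff_nonneg_of_partials:
  fixes g :: "'m::finite list \<Rightarrow> real ^ 'm \<Rightarrow> real"
  assumes "\<And>is i x. x \<in> open_box \<rho> u \<Longrightarrow>
      ((\<lambda>t. g is (x + t *\<^sub>R axis i 1)) has_real_derivative g (i # is) x) (at 0)"
    and "\<And>is x. x \<in> open_box \<rho> u \<Longrightarrow> 0 \<le> g is x"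
    and "\<forall>b\<in>set bs. \<forall>i. 0 \<le> b $ i" and "x \<in> open_box \<rho> (u + sum_list bs)"
  shows "0 \<le> mdiff bs (g []) x"
  using assms
proof (induction bs arbitrary: g u)
  case (Cons b bs)
  have b: "\<And>i. 0 \<le> b $ i"
    using Cons.prems(3) by simp
  have "0 \<le> mdiff bs ((\<lambda>is y. g is (y + b) - g is y) []) x"
  proof (rule Cons.IH[of "u + b"])
    show "((\<lambda>t. g is (y + t *\<^sub>R axis i 1 + b) - g is (y + t *\<^sub>R axis i 1)) has_real_derivative
        g (i # is) (y + b) - g (i # is) y) (at 0)" if "y \<in> open_box \<rho> (u + b)" for "is" i y
    proof (rule DERIV_diff)
      have eq: "(\<lambda>t. g is (y + t *\<^sub>R axis i 1 + b)) = (\<lambda>t. g is (y + b + t *\<^sub>R axis i 1))"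
        by (simp add: algebra_simps)
      show "((\<lambda>t. g is (y + t *\<^sub>R axis i 1 + b)) has_real_derivative g (i # is) (y + b)) (at 0)"
        unfolding eq by (rule Cons.prems(1)[OF open_boxD(2)[OF that b]])
    qed (rule Cons.prems(1)[OF open_boxD(1)[OF that b]])
    show "0 \<le> g is (y + b) - g is y" if "y \<in> open_box \<rho> (u + b)" for "is" y
    proof -
      have "g is y \<le> g is (y + b)"
      proof (rule partials_nonneg_mono[OF _ b open_boxD[OF that b]])
        show "\<exists>d\<ge>0. ((\<lambda>t. g is (z + t *\<^sub>R axis i 1)) has_real_derivative d) (at 0)"
          if "z \<in> open_box \<rho> u" for i z
          using Cons.prems(1,2)[OF that] by (intro exI[of _ "g (i # is) z"]) simp
      qed
      then show ?thesis
        by simp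
    qed
  qed (use Cons.prems in \<open>auto simp: add.assoc\<close>)
  then show ?case
    by simp
qed (simp add: open_box_def)

lemma mdiff_tendsto:
  fixes F :: "real ^ 'm::finite \<Rightarrow> real"
  assumes "\<And>y. \<lbrakk>\<And>i. 0 \<le> y $ i; y + u \<in> orthant_box \<rho>\<rbrakk> \<Longrightarrow> ((\<lambda>\<epsilon>. F (y + \<epsilon> *\<^sub>R e)) \<longlongrightarrow> F y) (at_right 0)"
    and "\<And>i. 0 \<le> u $ i" and "\<forall>b\<in>set bs. \<forall>i. 0 \<le> b $ i"
    and "\<And>i. 0 \<le> y $ i" and "y + (u + sum_list bs) \<in> orthant_box \<rho>"
  shows "((\<lambda>\<epsilon>. mdiff bs F (y + \<epsilon> *\<^sub>R e)) \<longlongrightarrow> mdiff bs F y) (at_right 0)"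
  using assms
proof (induction bs arbitrary: F u)
  case (Cons b bs)
  have b: "\<And>i. 0 \<le> b $ i"
    using Cons.prems(3) by simp
  have "((\<lambda>\<epsilon>. mdiff bs (\<lambda>y. F (y + b) - F y) (y + \<epsilon> *\<^sub>R e)) \<longlongrightarrow> mdiff bs (\<lambda>y. F (y + b) - F y) y) (at_right 0)"
  proof (rule Cons.IH[of "u + b"])
    fix z assume z: "\<And>i. 0 \<le> z $ i" "z + (u + b) \<in> orthant_box \<rho>"
    show "((\<lambda>\<epsilon>. F (z + \<epsilon> *\<^sub>R e + b) - F (z + \<epsilon> *\<^sub>R e)) \<longlongrightarrow> F (z + b) - F z) (at_right 0)"
    proof (rule tendsto_diff)
      have "((\<lambda>\<epsilon>. F (z + b + \<epsilon> *\<^sub>R e)) \<longlongrightarrow> F (z + b)) (at_right 0)"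
      proof (rule Cons.prems(1))
        show "0 \<le> (z + b) $ i" for i
          using z(1)[of i] b[of i] by simp
        show "z + b + u \<in> orthant_box \<rho>"
          using z(2) by (simp add: algebra_simps)
      qed
      then show "((\<lambda>\<epsilon>. F (z + \<epsilon> *\<^sub>R e + b)) \<longlongrightarrow> F (z + b)) (at_right 0)"
        by (simp add: algebra_simps)
      show "((\<lambda>\<epsilon>. F (z + \<epsilon> *\<^sub>R e)) \<longlongrightarrow> F z) (at_right 0)"
        by (intro Cons.prems(1) z orthant_box_le[OF z(2)]) (use z(1) b Cons.prems(2) in auto)
    qed
  qed (use Cons.prems b in \<open>auto simp: add.assoc\<close>)
  then show ?case
    by simp
qed simp

text \<open>
  In the interior this follows from \<open>mdiff_nonneg_of_partials\<close>. At the boundary of the orthant,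
  move slightly inwards and use continuity.
\<close>

lemma absolutely_monotonic_mdiff_nonneg:
  fixes F :: "real ^ 'm::finite \<Rightarrow> real"
  assumes F: "absolutely_monotonic_on (orthant_box \<rho>) F"
    and bs: "\<forall>b\<in>set bs. \<forall>i. 0 \<le> b $ i"
    and x: "\<And>i. 0 \<le> x $ i" "x + sum_list bs \<in> orthant_box \<rho>"
  shows "0 \<le> mdiff bs F x"
proof -
  have "open (\<Inter>i\<in>UNIV. {x :: real ^ 'm. x $ i > 0})"
    by (intro open_INT ballI open_halfspace_component_gt_cart) simp
  then have "open ((\<Inter>i\<in>UNIV. {x :: real ^ 'm. x $ i > 0}) \<inter> {x. vabs x \<in> orthant_box \<rho>})"
    by (intro open_Int open_vabs_box)
  moreover have "(\<Inter>i\<in>UNIV. {x :: real ^ 'm. x $ i > 0}) \<inter> {x. vabs x \<in> orthant_box \<rho>} = open_box \<rho> 0"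
    by (auto simp: open_box_def orthant_box_def vabs_def abs_of_pos)
  moreover have "open_box \<rho> 0 \<subseteq> (orthant_box \<rho> :: (real ^ 'm) set)"
    by (auto simp: open_box_def orthant_box_def less_imp_le)
  ultimately have int: "open_box \<rho> 0 \<subseteq> interior (orthant_box \<rho> :: (real ^ 'm) set)"
    by (simp add: interior_maximal)
  have ex: "mixed_partial_exists is F y" and nn: "0 \<le> mixed_partial is F y" if "y \<in> open_box \<rho> 0" for "is" y
  proof -
    have "y \<in> interior (orthant_box \<rho>)"
      using int that by blast
    then have "mixed_partial_exists is F y \<and> 0 \<le> mixed_partial is F y"
      using F unfolding absolutely_monotonic_on_def by simp
    then show "mixed_partial_exists is F y" "0 \<le> mixed_partial is F y"
      by simp_all
  qed
  have inner: "0 \<le> mdiff bs F y" if "y \<in> open_box \<rho> (sum_list bs)" for y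
  proof -
    have "0 \<le> mdiff bs (mixed_partial [] F) y"
    proof (rule mdiff_nonneg_of_partials[where u = 0 and g = "\<lambda>is. mixed_partial is F"])
      fix "is" i and y :: "real ^ 'm" assume "y \<in> open_box \<rho> 0"
      then have "mixed_partial_exists (i # is) F y"
        by (rule ex)
      then show "((\<lambda>t. mixed_partial is F (y + t *\<^sub>R axis i 1)) has_real_derivative mixed_partial (i # is) F y) (at 0)"
        by (simp add: partial_deriv_def DERIV_deriv_iff_field_differentiable)
    qed (use nn bs that in auto)
    then show ?thesis
      by simp
  qed
  define e :: "real ^ 'm" where "e = (\<chi> i. 1)"
  define X where "X = x + sum_list bs"
  have sum0: "0 \<le> sum_list bs $ i" for i
    using bs by (induction bs) auto
  have "((\<lambda>\<epsilon>. mdiff bs F (x + \<epsilon> *\<^sub>R e)) \<longlongrightarrow> mdiff bs F x) (at_right 0)"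
  proof (rule mdiff_tendsto[of 0 \<rho>])
    fix y :: "real ^ 'm" assume y: "\<And>i. 0 \<le> y $ i" "y + 0 \<in> orthant_box \<rho>"
    have vy: "vabs y = y"
      using y(1) by (simp add: vabs_def Finite_Cartesian_Product.vec_eq_iff)
    obtain \<epsilon>0 where \<epsilon>0: "0 < \<epsilon>0" "\<And>z. (\<forall>i. \<bar>z $ i\<bar> \<le> \<epsilon>0) \<Longrightarrow> vabs y + vabs z \<in> orthant_box \<rho>"
      using vabs_margin[of y \<rho>] y(2) vy by auto
    have "filterlim (\<lambda>\<epsilon>. y + \<epsilon> *\<^sub>R e) (at y within orthant_box \<rho>) (at_right 0)"
      unfolding filterlim_at
    proof (intro conjI)
      show "\<forall>\<^sub>F \<epsilon> in at_right 0. y + \<epsilon> *\<^sub>R e \<in> orthant_box \<rho> \<and> y + \<epsilon> *\<^sub>R e \<noteq> y"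
        unfolding eventually_at_right_field
      proof (intro exI[of _ \<epsilon>0] conjI allI impI \<epsilon>0(1))
        fix \<epsilon> :: real assume \<epsilon>: "0 < \<epsilon>" "\<epsilon> < \<epsilon>0"
        have "vabs y + vabs (\<epsilon> *\<^sub>R e) \<in> orthant_box \<rho>"
          using \<epsilon> by (intro \<epsilon>0(2)) (simp add: e_def)
        moreover have "vabs (\<epsilon> *\<^sub>R e) = \<epsilon> *\<^sub>R e"
          using \<epsilon> by (simp add: vabs_def e_def Finite_Cartesian_Product.vec_eq_iff)
        ultimately show "y + \<epsilon> *\<^sub>R e \<in> orthant_box \<rho>"
          by (simp add: vy)
        show "y + \<epsilon> *\<^sub>R e \<noteq> y"
          using \<epsilon> by (simp add: e_def Finite_Cartesian_Product.vec_eq_iff)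
      qed
      show "((\<lambda>\<epsilon>. y + \<epsilon> *\<^sub>R e) \<longlongrightarrow> y) (at_right 0)"
        by (auto intro!: tendsto_eq_intros)
    qed
    moreover have "(F \<longlongrightarrow> F y) (at y within orthant_box \<rho>)"
      using F y(2) by (simp add: absolutely_monotonic_on_def continuous_on_def)
    ultimately show "((\<lambda>\<epsilon>. F (y + \<epsilon> *\<^sub>R e)) \<longlongrightarrow> F y) (at_right 0)"
      by (rule filterlim_compose[rotated])
  qed (use bs x in auto)
  moreover have "\<forall>\<^sub>F \<epsilon> in at_right 0. 0 \<le> mdiff bs F (x + \<epsilon> *\<^sub>R e)"
  proof -
    have vX: "vabs X = X"
      using x(1) sum0 by (simp add: vabs_def X_def Finite_Cartesian_Product.vec_eq_iff)
    obtain \<epsilon>0 where \<epsilon>0: "0 < \<epsilon>0" "\<And>z. (\<forall>i. \<bar>z $ i\<bar> \<le> \<epsilon>0) \<Longrightarrow> vabs X + vabs z \<in> orthant_box \<rho>"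
      using vabs_margin[of X \<rho>] x(2) vX by (auto simp: X_def)
    show ?thesis
      unfolding eventually_at_right_field
    proof (intro exI[of _ \<epsilon>0] conjI allI impI \<epsilon>0(1) inner)
      fix \<epsilon> :: real assume \<epsilon>: "0 < \<epsilon>" "\<epsilon> < \<epsilon>0"
      have "vabs X + vabs (\<epsilon> *\<^sub>R e) \<in> orthant_box \<rho>"
        using \<epsilon> by (intro \<epsilon>0(2)) (simp add: e_def)
      then have "ereal (X $ i + \<epsilon>) < \<rho>" for i
        using \<epsilon> unfolding vX by (simp add: orthant_box_def vabs_def e_def)
      moreover have "0 < x $ i + \<epsilon>" for i
        using x(1)[of i] \<epsilon> by linarith
      ultimately show "x + \<epsilon> *\<^sub>R e \<in> open_box \<rho> (sum_list bs)"
        by (simp add: open_box_def X_def e_def algebra_simps)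
    qed
  qed
  ultimately show ?thesis
    by (intro tendsto_lowerbound) auto
qed

definition mdiff_positive :: "ereal \<Rightarrow> (real ^ 'm::finite \<Rightarrow> real) \<Rightarrow> bool" where
  "mdiff_positive \<rho> F \<longleftrightarrow> (\<forall>bs x. (\<forall>b\<in>set bs. \<forall>i. 0 \<le> b $ i) \<and> (\<forall>i. 0 \<le> x $ i) \<and>
      x + sum_list bs \<in> orthant_box \<rho> \<longrightarrow> 0 \<le> mdiff bs F x)"

lemma fdiff_line: "fdiff n h (\<lambda>z. F (a + z *\<^sub>R b)) u = mdiff (replicate n (h *\<^sub>R b)) F (a + u *\<^sub>R b)"
proof (induction n arbitrary: F)
  case (Suc n)
  have "fdiff (Suc n) h (\<lambda>z. F (a + z *\<^sub>R b)) u = fdiff n h (\<lambda>z. F (a + z *\<^sub>R b + h *\<^sub>R b) - F (a + z *\<^sub>R b)) u"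
    unfolding fdiff_Suc_left by (simp add: scaleR_add_left add.assoc)
  then show ?case
    using Suc[of "\<lambda>y. F (y + h *\<^sub>R b) - F y"] by simp
qed simp

lemma mdiff_positive_ray_series:
  fixes F :: "real ^ 'm::finite \<Rightarrow> real"
  assumes F: "mdiff_positive \<rho> F"
  shows "ray_series \<rho> F"
  unfolding ray_series_def
proof (intro allI impI)
  fix a b :: "real ^ 'm" and R :: real
  assume H: "(\<forall>i. 0 \<le> a $ i \<and> 0 \<le> b $ i) \<and> 0 < R \<and> (\<forall>z. 0 \<le> z \<and> z < R \<longrightarrow> a + z *\<^sub>R b \<in> orthant_box \<rho>)"
  obtain c where "\<And>n. 0 \<le> c n" "\<And>x. \<lbrakk>0 \<le> x; x < R\<rbrakk> \<Longrightarrow> (\<lambda>n. c n * x ^ n) sums F (a + x *\<^sub>R b)"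
  proof (rule Bernstein_abs_monotone[of R "\<lambda>z. F (a + z *\<^sub>R b)"])
    fix n :: nat and h u :: real assume u: "0 \<le> u" "0 < h" "u + real n * h < R"
    have "sum_list (replicate n (h *\<^sub>R b)) = (real n * h) *\<^sub>R b"
      by (induction n) (simp_all add: scaleR_add_left algebra_simps)
    then have e: "a + u *\<^sub>R b + sum_list (replicate n (h *\<^sub>R b)) = a + (u + real n * h) *\<^sub>R b"
      by (simp add: algebra_simps)
    have "a + u *\<^sub>R b + sum_list (replicate n (h *\<^sub>R b)) \<in> orthant_box \<rho>"
      unfolding e using H u by (auto intro: add_nonneg_nonneg)
    then show "0 \<le> fdiff n h (\<lambda>z. F (a + z *\<^sub>R b)) u"
      unfolding fdiff_line using H u by (intro F[unfolded mdiff_positive_def, rule_format]) auto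
  qed (use H in auto)
  then show "\<exists>c. (\<forall>n. 0 \<le> c n) \<and> (\<forall>z. 0 \<le> z \<and> z < R \<longrightarrow> (\<lambda>n. c n * z ^ n) sums F (a + z *\<^sub>R b))"
    by blast
qed

lemma mdiff_add: "mdiff bs (\<lambda>x. F x + G x) x = mdiff bs F x + mdiff bs G x"
proof (induction bs arbitrary: F G)
  case (Cons b bs)
  show ?case
    using Cons[of "\<lambda>y. F (y + b) - F y" "\<lambda>y. G (y + b) - G y"] by (simp add: algebra_simps)
qed simp

lemma mdiff_cmult: "mdiff bs (\<lambda>x. c * F x) x = c * mdiff bs F x"
proof (induction bs arbitrary: F)
  case (Cons b bs)
  show ?case
    using Cons[of "\<lambda>y. F (y + b) - F y"] by (simp add: algebra_simps)
qed simp

lemma mdiff_sum: "mdiff bs (\<lambda>x. \<Sum>i\<in>A. F i x) x = (\<Sum>i\<in>A. mdiff bs (F i) x)"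
proof -
  have "mdiff bs (\<lambda>x. 0) x = 0"
    using mdiff_cmult[of bs 0 "\<lambda>_. 0"] by simp
  then show ?thesis
    by (induction A rule: infinite_finite_induct) (simp_all add: mdiff_add)
qed

lemma mdiff_abs_le:
  assumes "\<And>y. \<lbrakk>\<And>i. x $ i \<le> y $ i; \<And>i. y $ i \<le> (x + sum_list bs) $ i\<rbrakk> \<Longrightarrow> \<bar>G y\<bar> \<le> C"
    and "\<forall>b\<in>set bs. \<forall>i. 0 \<le> b $ i"
  shows "\<bar>mdiff bs G x\<bar> \<le> 2 ^ length bs * C"
  using assms
proof (induction bs arbitrary: G C)
  case (Cons b bs)
  have "\<bar>mdiff bs (\<lambda>y. G (y + b) - G y) x\<bar> \<le> 2 ^ length bs * (2 * C)"
  proof (rule Cons.IH)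
    fix y assume y: "\<And>i. x $ i \<le> y $ i" "\<And>i. y $ i \<le> (x + sum_list bs) $ i"
    have b: "0 \<le> b $ i" for i
      using Cons.prems(2) by simp
    have "\<bar>G (y + b)\<bar> \<le> C"
    proof (rule Cons.prems(1))
      show "x $ i \<le> (y + b) $ i" "(y + b) $ i \<le> (x + sum_list (b # bs)) $ i" for i
        using y[of i] b[of i] by auto
    qed
    moreover have "\<bar>G y\<bar> \<le> C"
    proof (rule Cons.prems(1))
      show "x $ i \<le> y $ i" "y $ i \<le> (x + sum_list (b # bs)) $ i" for i
        using y[of i] b[of i] by auto
    qed
    ultimately show "\<bar>G (y + b) - G y\<bar> \<le> 2 * C"
      by linarith
  qed (use Cons.prems in auto)
  then show ?case
    by simp
qed simp

lemma mdiff_scale: "mdiff (map ((*\<^sub>R) s) bs) F (s *\<^sub>R x) = mdiff bs (\<lambda>x. F (s *\<^sub>R x)) x"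
proof (induction bs arbitrary: F)
  case (Cons b bs)
  show ?case
    using Cons[of "\<lambda>y. F (y + s *\<^sub>R b) - F y"] by (simp add: scaleR_add_right)
qed simp

text \<open>
  Differences in coordinate directions act on the factors separately.
\<close>

lemma mdiff_product:
  fixes g :: "'m::finite \<Rightarrow> real \<Rightarrow> real"
  shows "mdiff (map (\<lambda>i. s *\<^sub>R axis i 1) xs) (\<lambda>x. \<Prod>j\<in>UNIV. g j (x $ j)) x
    = (\<Prod>j\<in>UNIV. fdiff (count_list xs j) s (g j) (x $ j))"
proof (induction xs arbitrary: g)
  case (Cons i xs)
  define g' where "g' j = (if j = i then (\<lambda>y. g i (y + s) - g i y) else g j)" for j
  have split: "(\<Prod>j\<in>UNIV. h j) = h i * (\<Prod>j\<in>UNIV - {i}. h j)" for h :: "'m \<Rightarrow> real"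
    by (simp add: prod.remove)
  have "(\<Prod>j\<in>UNIV. g j ((y + s *\<^sub>R axis i 1) $ j)) - (\<Prod>j\<in>UNIV. g j (y $ j)) = (\<Prod>j\<in>UNIV. g' j (y $ j))" for y
  proof -
    have "(\<Prod>j\<in>UNIV - {i}. g j ((y + s *\<^sub>R axis i 1) $ j)) = (\<Prod>j\<in>UNIV - {i}. g j (y $ j))"
      "(\<Prod>j\<in>UNIV - {i}. g' j (y $ j)) = (\<Prod>j\<in>UNIV - {i}. g j (y $ j))"
      by (auto intro!: prod.cong simp: axis_def g'_def)
    then show ?thesis
      unfolding split[of "\<lambda>j. g j ((y + s *\<^sub>R axis i 1) $ j)"] split[of "\<lambda>j. g j (y $ j)"] split[of "\<lambda>j. g' j (y $ j)"]
      by (simp add: g'_def axis_def left_diff_distrib)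
  qed
  then have "mdiff (map (\<lambda>i. s *\<^sub>R axis i 1) (i # xs)) (\<lambda>x. \<Prod>j\<in>UNIV. g j (x $ j)) x
      = mdiff (map (\<lambda>i. s *\<^sub>R axis i 1) xs) (\<lambda>x. \<Prod>j\<in>UNIV. g' j (x $ j)) x"
    by simp
  also have "\<dots> = (\<Prod>j\<in>UNIV. fdiff (count_list xs j) s (g' j) (x $ j))"
    by (rule Cons)
  also have "\<dots> = (\<Prod>j\<in>UNIV. fdiff (count_list (i # xs) j) s (g j) (x $ j))"
    by (intro prod.cong refl) (auto simp: g'_def fdiff_Suc_left simp del: fdiff.simps)
  finally show ?case .
qed simp

lemma fdiff_mean_value:
  assumes "\<And>n x. (g n has_real_derivative g (Suc n) x) (at x)" and h: "0 < h"
  shows "\<exists>\<xi>. fdiff n h (g 0) u = h ^ n * g n \<xi>"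
  using assms(1)
proof (induction n arbitrary: g)
  case (Suc n)
  have "\<exists>\<xi>. fdiff n h ((\<lambda>n x. g n (x + h) - g n x) 0) u = h ^ n * (\<lambda>n x. g n (x + h) - g n x) n \<xi>"
  proof (rule Suc.IH)
    show "((\<lambda>x. g n (x + h) - g n x) has_real_derivative g (Suc n) (x + h) - g (Suc n) x) (at x)" for n x
    proof (rule DERIV_diff)
      show "((\<lambda>x. g n (x + h)) has_real_derivative g (Suc n) (x + h)) (at x)"
        using Suc.prems[of n "x + h"] by (simp add: DERIV_shift)
    qed (rule Suc.prems)
  qed
  then obtain \<xi> where \<xi>: "fdiff (Suc n) h (g 0) u = h ^ n * (g n (\<xi> + h) - g n \<xi>)"
    unfolding fdiff_Suc_left by blast
  have "\<exists>z>\<xi>. z < \<xi> + h \<and> g n (\<xi> + h) - g n \<xi> = (\<xi> + h - \<xi>) * g (Suc n) z"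
    by (rule MVT2) (use h in simp, rule Suc.prems)
  then obtain \<zeta> where "g n (\<xi> + h) - g n \<xi> = (\<xi> + h - \<xi>) * g (Suc n) \<zeta>"
    by blast
  then show ?case
    using \<xi> by (intro exI[of _ \<zeta>]) simp
qed auto

lemma fdiff_monomial:
  assumes h: "0 < h"
  shows "m < k \<Longrightarrow> fdiff k h (\<lambda>y. y ^ m) u = 0" "0 < fdiff k h (\<lambda>y. y ^ k) u"
proof -
  define g where "g m n y = (if n \<le> m then fact m / fact (m - n) * y ^ (m - n) else 0)" for m n :: nat and y :: real
  have g0: "g m 0 = (\<lambda>y. y ^ m)" for m
    by (simp add: g_def fun_eq_iff)
  have g': "(g m n has_real_derivative g m (Suc n) y) (at y)" for m n y
  proof (cases "n < m")
    case True
    then obtain d where d: "m = Suc (n + d)"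
      using less_imp_Suc_add by blast
    have gn: "g m n = (\<lambda>y. fact m / fact (Suc d) * y ^ Suc d)"
      by (simp add: g_def d fun_eq_iff)
    have "(g m n has_real_derivative fact m / fact (Suc d) * (real (Suc d) * y ^ d)) (at y)"
      unfolding gn by (rule DERIV_cmult) (use DERIV_pow[of "Suc d" y] in simp)
    moreover have "fact m / fact (Suc d) * (real (Suc d) * y ^ d) = g m (Suc n) y"
      by (simp add: g_def d del: of_nat_Suc)
    ultimately show ?thesis
      by simp
  next
    case False
    then have c: "g m n = (\<lambda>y. if n = m then fact m else 0)" and "g m (Suc n) y = 0"
      by (auto simp: g_def fun_eq_iff)
    then show ?thesis
      unfolding c by simp
  qed
  have mv: "\<exists>\<xi>. fdiff k h (\<lambda>y. y ^ m) u = h ^ k * g m k \<xi>" for m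
    using fdiff_mean_value[of "g m" h k u, OF g' h] by (simp add: g0)
  show "fdiff k h (\<lambda>y. y ^ m) u = 0" if "m < k"
    using mv[of m] that by (auto simp: g_def)
  show "0 < fdiff k h (\<lambda>y. y ^ k) u"
    using mv[of k] h by (auto simp: g_def)
qed

text \<open>
  The counterpart of \<open>two_atom_coeff_nonneg\<close>. Taking \<open>\<alpha> i\<close> differences in each direction \<open>i\<close> annihilates every
  monomial of degree at most \<open>|\<alpha>|\<close> other than \<open>x\<^sup>\<alpha>\<close>, because some exponent is smaller than
  the number of differences taken in that direction.
\<close>

lemma mdiff_positive_coeff_nonneg:
  fixes F :: "real ^ 'm::finite \<Rightarrow> real"
  assumes F: "mdiff_positive \<rho> F" and \<rho>: "0 < \<rho>"
    and f: "\<And>k x. x \<in> orthant_box \<rho> \<Longrightarrow> hom_part F k x = (\<Sum>\<alpha>\<in>multi_deg k. f \<alpha> * mpow x \<alpha>)"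
  shows "0 \<le> f \<alpha>"
proof -
  note ray = mdiff_positive_ray_series[OF F]
  obtain r where r: "0 < r" "ereal r < \<rho>"
    using ereal_dense2[OF \<rho>] by auto
  define n where "n = sum \<alpha> UNIV"
  \<comment> \<open>The step is so small that all \<open>|\<alpha>|\<close> steps together stay in the box.\<close>
  define s where "s = r / real (Suc n)"
  have s: "0 < s"
    using r by (simp add: s_def)
  obtain xs where "mset xs = (\<Sum>i\<in>UNIV. replicate_mset (\<alpha> i) i)"
    using ex_mset by blast
  then have "count (mset xs) j = (\<Sum>i\<in>UNIV. if i = j then \<alpha> i else 0)" for j
    by (simp add: count_sum)
  then have xs: "count_list xs j = \<alpha> j" for j
    by (simp add: count_mset)
  define bs :: "(real ^ 'm) list" where "bs = map (\<lambda>i. s *\<^sub>R axis i 1) xs"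
  have bs0: "\<forall>b\<in>set bs. \<forall>i. 0 \<le> b $ i"
    using s by (auto simp: bs_def axis_def)
  have "sum_list (map (\<lambda>i. s *\<^sub>R axis i (1::real)) ys) $ j = s * real (count_list ys j)" for ys and j :: 'm
    by (induction ys) (auto simp: axis_def algebra_simps)
  then have X: "sum_list bs $ j = s * real (\<alpha> j)" for j
    by (simp add: bs_def xs)
  have Xr: "sum_list bs $ j \<le> (\<chi> i. r) $ j" for j
  proof -
    have "\<alpha> j \<le> n"
      unfolding n_def by (intro member_le_sum) auto
    then have "s * real (\<alpha> j) \<le> s * real (Suc n)"
      using s by (intro mult_left_mono) auto
    then show ?thesis
      by (simp add: X s_def)
  qed
  have rb: "(\<chi> i. r) \<in> orthant_box \<rho>"
    using r by (simp add: orthant_box_def)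
  have Xb: "sum_list bs \<in> orthant_box \<rho>"
    by (rule orthant_box_le[OF rb _ Xr]) (use s in \<open>simp add: X\<close>)
  define M where "M = F (sum_list bs)"
  define \<kappa> where "\<kappa> \<beta> = mdiff bs (\<lambda>x. mpow x \<beta>) 0" for \<beta>
  have \<kappa>: "\<kappa> \<beta> = (\<Prod>j\<in>UNIV. fdiff (\<alpha> j) s (\<lambda>y. y ^ \<beta> j) 0)" for \<beta>
    using mdiff_product[of s xs "\<lambda>j y. y ^ \<beta> j" 0] by (simp add: \<kappa>_def bs_def xs mpow_def)
  have \<kappa>\<alpha>: "0 < \<kappa> \<alpha>"
    unfolding \<kappa> by (intro prod_pos) (simp add: fdiff_monomial(2)[OF s])
  have \<kappa>0: "\<kappa> \<beta> = 0" if "\<beta> \<noteq> \<alpha>" "sum \<beta> UNIV \<le> n" for \<beta>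
  proof -
    have "\<exists>j. \<beta> j < \<alpha> j"
    proof (rule ccontr)
      assume "\<not> ?thesis"
      then have le: "\<alpha> j \<le> \<beta> j" for j
        by (simp add: not_less)
      moreover obtain j where "\<beta> j \<noteq> \<alpha> j"
        using \<open>\<beta> \<noteq> \<alpha>\<close> by (auto simp: fun_eq_iff)
      ultimately have "sum \<alpha> UNIV < sum \<beta> UNIV"
        by (intro sum_strict_mono_ex1) (auto intro!: exI[of _ j] simp: order.strict_iff_order)
      then show False
        using that(2) by (simp add: n_def)
    qed
    then show ?thesis
      unfolding \<kappa> using fdiff_monomial(1)[OF s] by (intro prod_zero) auto
  qed
  have "0 \<le> f \<alpha> * \<kappa> \<alpha>"
  proof (rule leading_coeff_nonneg[of 1 _ n "2 ^ length bs * M"])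
    fix \<epsilon> :: real assume \<epsilon>: "0 < \<epsilon>" "\<epsilon> \<le> 1"
    define T where "T x = (\<Sum>l<Suc n. \<Sum>\<beta>\<in>multi_deg l. (\<epsilon> ^ l * f \<beta>) * mpow x \<beta>)" for x
    have "sum_list (map ((*\<^sub>R) \<epsilon>) bs) = \<epsilon> *\<^sub>R sum_list bs"
      by (induction bs) (simp_all add: scaleR_add_right)
    then have "0 \<le> mdiff (map ((*\<^sub>R) \<epsilon>) bs) F (\<epsilon> *\<^sub>R 0)"
      using \<epsilon> bs0 orthant_box_scale[OF Xb, of \<epsilon>]
      by (intro F[unfolded mdiff_positive_def, rule_format]) auto
    also have "\<dots> = mdiff bs (\<lambda>x. T x + (F (\<epsilon> *\<^sub>R x) - T x)) 0"
      unfolding mdiff_scale by simp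
    also have "\<dots> = mdiff bs T 0 + mdiff bs (\<lambda>x. F (\<epsilon> *\<^sub>R x) - T x) 0"
      by (rule mdiff_add)
    also have "mdiff bs T 0 = (\<Sum>l<Suc n. \<Sum>\<beta>\<in>multi_deg l. (\<epsilon> ^ l * f \<beta>) * \<kappa> \<beta>)"
      unfolding T_def[abs_def] mdiff_sum mdiff_cmult \<kappa>_def ..
    also have "\<dots> = (\<Sum>l<Suc n. if l = n then f \<alpha> * \<kappa> \<alpha> * \<epsilon> ^ n else 0)"
    proof (intro sum.cong refl)
      fix l assume l: "l \<in> {..<Suc n}"
      have "(\<Sum>\<beta>\<in>multi_deg l. (\<epsilon> ^ l * f \<beta>) * \<kappa> \<beta>) = (\<Sum>\<beta>\<in>multi_deg l. if \<beta> = \<alpha> then f \<alpha> * \<kappa> \<alpha> * \<epsilon> ^ n else 0)"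
      proof (intro sum.cong refl)
        fix \<beta> :: "'m \<Rightarrow> nat" assume "\<beta> \<in> multi_deg l"
        then show "(\<epsilon> ^ l * f \<beta>) * \<kappa> \<beta> = (if \<beta> = \<alpha> then f \<alpha> * \<kappa> \<alpha> * \<epsilon> ^ n else 0)"
          using \<kappa>0[of \<beta>] l by (auto simp: multi_deg_def n_def)
      qed
      also have "\<dots> = (if l = n then f \<alpha> * \<kappa> \<alpha> * \<epsilon> ^ n else 0)"
        unfolding sum.delta[OF finite_multi_deg] by (auto simp: multi_deg_def n_def)
      finally show "(\<Sum>\<beta>\<in>multi_deg l. (\<epsilon> ^ l * f \<beta>) * \<kappa> \<beta>) = \<dots>" .
    qed
    also have "\<dots> = f \<alpha> * \<kappa> \<alpha> * \<epsilon> ^ n"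
      by simp
    also have "mdiff bs (\<lambda>x. F (\<epsilon> *\<^sub>R x) - T x) 0 \<le> 2 ^ length bs * (M * \<epsilon> ^ Suc n)"
    proof (rule order_trans[OF abs_ge_self mdiff_abs_le[OF _ bs0]])
      fix y :: "real ^ 'm" assume y: "\<And>i. 0 $ i \<le> y $ i" "\<And>i. y $ i \<le> (0 + sum_list bs) $ i"
      have yb: "y \<in> orthant_box \<rho>"
        using y by (intro orthant_box_le[OF Xb]) auto
      have "F y \<le> F (y + (sum_list bs - y))"
        using y Xb by (intro ray_series_mono[OF ray]) auto
      then have FM: "F y \<le> M"
        by (simp add: M_def)
      have "T y = (\<Sum>l<Suc n. hom_part F l y * \<epsilon> ^ l)"
        unfolding T_def f[OF yb] sum_distrib_right by (simp add: mult_ac)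
      then have "\<bar>F (\<epsilon> *\<^sub>R y) - T y\<bar> \<le> F y * \<epsilon> ^ Suc n"
        using hom_part_truncation[OF ray yb, of \<epsilon> "Suc n"] \<epsilon> by simp
      also have "\<dots> \<le> M * \<epsilon> ^ Suc n"
        using FM \<epsilon> by (intro mult_right_mono) auto
      finally show "\<bar>F (\<epsilon> *\<^sub>R y) - T y\<bar> \<le> M * \<epsilon> ^ Suc n" .
    qed
    finally show "0 \<le> f \<alpha> * \<kappa> \<alpha> * \<epsilon> ^ n + 2 ^ length bs * M * \<epsilon> ^ Suc n"
      by (simp add: mult_ac)
  qed simp
  then show ?thesis
    using \<kappa>\<alpha> by (metis mult_le_cancel_right_pos mult_zero_left)
qed

subsection \<open>Analytic continuation along segments\<close>

lemma power_series_left_zero: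
  fixes c :: "nat \<Rightarrow> real"
  assumes r: "0 < r" and D: "\<And>s. \<bar>s - s0\<bar> \<le> r \<Longrightarrow> (\<lambda>n. c n * (s - s0) ^ n) sums D s"
    and zero: "\<And>s. \<lbrakk>s0 - r \<le> s; s < s0\<rbrakk> \<Longrightarrow> D s = 0"
  shows "\<bar>s - s0\<bar> \<le> r \<Longrightarrow> D s = 0"
proof -
  have "c n * (- r) ^ n = 0" for n
  proof (rule power_series_coeffs_below_order[of "\<lambda>n. c n * (- r) ^ n" "\<lambda>z. D (s0 - r * z)" 0 "Suc n" n])
    show "(\<lambda>n. c n * (- r) ^ n * z ^ n) sums D (s0 - r * z)" if z: "0 \<le> z" "z \<le> 1" for z
    proof -
      have "\<bar>(s0 - r * z) - s0\<bar> \<le> r"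
        using r z by (simp add: abs_mult mult_left_le)
      from D[OF this] show ?thesis
        by (simp add: power_mult_distrib[symmetric] mult.assoc)
    qed
    show "\<bar>D (s0 - r * z)\<bar> \<le> 0 * z ^ Suc n" if "0 < z" "z \<le> 1" for z
      using that r by (subst zero) (auto simp: mult_left_le)
  qed simp
  then have "c n = 0" for n
    using r by simp
  then show "D s = 0" if "\<bar>s - s0\<bar> \<le> r"
    using D[OF that] sums_unique2[of "\<lambda>_. 0"] by (simp add: sums_iff)
qed

text \<open>
  Consider the supremum of the parameters below which \<open>D\<close> vanishes. The local power series there
  vanishes to the left, hence identically, so the supremum is \<open>1\<close>.
\<close>

lemma analytic_segment_zero:
  fixes D :: "real \<Rightarrow> real"
  assumes loc: "\<And>s0. \<lbrakk>0 \<le> s0; s0 \<le> 1\<rbrakk> \<Longrightarrow>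
      \<exists>c r. 0 < r \<and> (\<forall>s. \<bar>s - s0\<bar> \<le> r \<longrightarrow> (\<lambda>n. c n * (s - s0) ^ n) sums D s)"
    and \<delta>: "0 < \<delta>" "\<And>s. \<lbrakk>0 \<le> s; s < \<delta>\<rbrakk> \<Longrightarrow> D s = 0"
  shows "D 1 = 0"
proof -
  define S where "S = {s. 0 \<le> s \<and> s \<le> 1 \<and> (\<forall>u. 0 \<le> u \<and> u < s \<longrightarrow> D u = 0)}"
  define m where "m = Sup S"
  have bdd: "bdd_above S"
    unfolding S_def by (intro bdd_aboveI[of _ 1]) auto
  have mem: "min \<delta> 1 \<in> S"
    using \<delta> by (auto simp: S_def)
  have m: "min \<delta> 1 \<le> m" "m \<le> 1"
    unfolding m_def using mem bdd by (auto intro!: cSup_upper cSup_least simp: S_def)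
  have m0: "0 < m"
    using m \<delta> by linarith
  have below: "D u = 0" if u: "0 \<le> u" "u < m" for u
  proof -
    obtain s where "s \<in> S" "u < s"
      using u(2) less_cSup_iff[OF _ bdd, of u] mem unfolding m_def by blast
    then show ?thesis
      using u by (simp add: S_def)
  qed
  obtain c r where r: "0 < r" and c: "\<And>s. \<bar>s - m\<bar> \<le> r \<Longrightarrow> (\<lambda>n. c n * (s - m) ^ n) sums D s"
    using loc[of m] m m0 by auto
  define r' where "r' = min r m"
  have near: "D s = 0" if "\<bar>s - m\<bar> \<le> r'" for s
  proof (rule power_series_left_zero[of r' m c D])
    show "0 < r'"
      using r m0 by (simp add: r'_def)
    show "(\<lambda>n. c n * (s - m) ^ n) sums D s" if "\<bar>s - m\<bar> \<le> r'" for s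
      using that by (intro c) (simp add: r'_def)
    show "D s = 0" if "m - r' \<le> s" "s < m" for s
      using that by (intro below) (auto simp: r'_def)
  qed (rule that)
  have "m = 1"
  proof (rule ccontr)
    assume "m \<noteq> 1"
    define s where "s = min 1 (m + r')"
    have s: "m < s" "s \<le> 1" "s \<le> m + r'"
      using \<open>m \<noteq> 1\<close> m r m0 by (auto simp: s_def r'_def)
    have "D u = 0" if "0 \<le> u" "u < s" for u
      using below[of u] near[of u] that s by (cases "u < m") auto
    then have "s \<in> S"
      using s m0 by (auto simp: S_def)
    then have "s \<le> m"
      unfolding m_def by (intro cSup_upper bdd)
    then show False
      using s by simp
  qed
  then show ?thesis
    using near[of 1] r m0 by (simp add: r'_def)
qed

lemma real_analytic_on_line:
  fixes G :: "real ^ 'm::finite \<Rightarrow> real"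
  assumes G: "real_analytic_on U G" and a: "a \<in> U"
  shows "\<exists>c r. 0 < r \<and> (\<forall>s. \<bar>s\<bar> \<le> r \<longrightarrow> (\<lambda>n. c n * s ^ n) sums G (a + s *\<^sub>R d))"
proof -
  obtain c where "\<forall>\<^sub>F x in nhds a. ((\<lambda>\<alpha>. c \<alpha> * (\<Prod>i\<in>UNIV. (x $ i - a $ i) ^ \<alpha> i)) has_sum G x) UNIV"
    using G a unfolding real_analytic_on_def by blast
  moreover have "filterlim (\<lambda>s. a + s *\<^sub>R d) (nhds a) (nhds 0)"
    by (auto intro!: tendsto_eq_intros filterlim_ident)
  ultimately have "\<forall>\<^sub>F s in nhds 0. ((\<lambda>\<alpha>. c \<alpha> * (\<Prod>i\<in>UNIV. ((a + s *\<^sub>R d) $ i - a $ i) ^ \<alpha> i)) has_sum G (a + s *\<^sub>R d)) UNIV"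
    by (rule eventually_compose_filterlim)
  then obtain r where r: "0 < r" "\<And>s. dist s 0 < r \<Longrightarrow>
      ((\<lambda>\<alpha>. c \<alpha> * (\<Prod>i\<in>UNIV. ((a + s *\<^sub>R d) $ i - a $ i) ^ \<alpha> i)) has_sum G (a + s *\<^sub>R d)) UNIV"
    unfolding eventually_nhds_metric by blast
  have "(\<lambda>n. (\<Sum>\<beta>\<in>multi_deg n. c \<beta> * mpow d \<beta>) * s ^ n) sums G (a + s *\<^sub>R d)" if "\<bar>s\<bar> \<le> r / 2" for s
  proof (rule has_sum_line_sums)
    show "((\<lambda>\<beta>. c \<beta> * mpow (s *\<^sub>R d) \<beta>) has_sum G (a + s *\<^sub>R d)) UNIV"
      using r(2)[of s] that r(1) by (simp add: mpow_def)
  qed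
  then show ?thesis
    using r(1) by (intro exI[of _ "\<lambda>n. \<Sum>\<beta>\<in>multi_deg n. c \<beta> * mpow d \<beta>"] exI[of _ "r / 2"]) auto
qed

text \<open>
  Differences give the series on the positive orthant. A segment that starts inside the open
  orthant carries the identity of \<open>G\<close> and the sum of the series to any point of the box.
\<close>

theorem absolutely_monotonic_power_series:
  fixes F G :: "real ^ 'm::finite \<Rightarrow> real"
  assumes \<rho>: "0 < \<rho>" and F: "absolutely_monotonic_on (orthant_box \<rho>) F"
    and G: "real_analytic_on {x. vabs x \<in> orthant_box \<rho>} G"
    and FG: "\<And>x. vabs x \<in> orthant_box \<rho> \<Longrightarrow> F x = G x"
  obtains f where "pos_series \<rho> f" "\<And>x. vabs x \<in> orthant_box \<rho> \<Longrightarrow> F x = power_sum f x"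
proof -
  have md: "mdiff_positive \<rho> F"
    unfolding mdiff_positive_def using absolutely_monotonic_mdiff_nonneg[OF F] by blast
  note ray = mdiff_positive_ray_series[OF md]
  obtain f where hp: "\<And>k x. x \<in> orthant_box \<rho> \<Longrightarrow> hom_part F k x = (\<Sum>\<alpha>\<in>multi_deg k. f \<alpha> * mpow x \<alpha>)"
    using ray_series_coeffs[OF ray \<rho>] by blast
  have f0: "0 \<le> f \<alpha>" for \<alpha>
    by (rule mdiff_positive_coeff_nonneg[OF md \<rho> hp])
  have fs: "((\<lambda>\<alpha>. f \<alpha> * mpow x \<alpha>) has_sum F x) UNIV" if "x \<in> orthant_box \<rho>" for x
    by (rule ray_series_has_sum[OF ray that hp f0])
  have ps: "pos_series \<rho> f"
    using f0 has_sum_imp_summable[OF fs] by (simp add: pos_series_def)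
  have pos: "F x = power_sum f x" if "x \<in> orthant_box \<rho>" for x
    unfolding power_sum_def using infsumI[OF fs[OF that]] by simp
  have all: "F x = power_sum f x" if x: "vabs x \<in> orthant_box \<rho>" for x
  proof -
    obtain r where r: "0 < r" "ereal r < \<rho>"
      using ereal_dense2[OF \<rho>] by auto
    \<comment> \<open>The segment from \<open>p\<close> to \<open>x\<close> starts in the interior of the orthant.\<close>
    define p :: "real ^ 'm" where "p = (\<chi> i. r)"
    define D where "D s = G (p + s *\<^sub>R (x - p)) - power_sum f (p + s *\<^sub>R (x - p))" for s
    have seg: "vabs (p + s *\<^sub>R (x - p)) \<in> orthant_box \<rho>" if s: "0 \<le> s" "s \<le> 1" for s
    proof -
      have "ereal \<bar>p $ i + s * (x $ i - p $ i)\<bar> < \<rho>" for i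
      proof -
        have "p $ i + s * (x $ i - p $ i) = (1 - s) * r + s * x $ i"
          by (simp add: p_def algebra_simps)
        also have "\<bar>\<dots>\<bar> \<le> (1 - s) * r + s * \<bar>x $ i\<bar>"
          using s r by (intro order_trans[OF abs_triangle_ineq]) (simp add: abs_mult)
        also have "\<dots> \<le> (1 - s) * max r \<bar>x $ i\<bar> + s * max r \<bar>x $ i\<bar>"
          using s by (intro add_mono mult_left_mono) auto
        also have "\<dots> = max r \<bar>x $ i\<bar>"
          by (simp add: algebra_simps)
        finally have "ereal \<bar>p $ i + s * (x $ i - p $ i)\<bar> \<le> ereal (max r \<bar>x $ i\<bar>)"
          by (simp only: ereal_less_eq(3))
        also have "\<dots> < \<rho>"
          using r(2) x by (auto simp: max_def orthant_box_def vabs_def)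
        finally show ?thesis .
      qed
      then show ?thesis
        by (simp add: orthant_box_def vabs_def)
    qed
    have "D 1 = 0"
    proof (rule analytic_segment_zero)
      fix s0 :: real assume s0: "0 \<le> s0" "s0 \<le> 1"
      let ?a = "p + s0 *\<^sub>R (x - p)"
      obtain c r where r: "0 < r" "\<And>s. \<bar>s\<bar> \<le> r \<Longrightarrow> (\<lambda>n. c n * s ^ n) sums G (?a + s *\<^sub>R (x - p))"
        using real_analytic_on_line[OF G, of ?a "x - p"] seg[OF s0] by auto
      obtain c' r' where r': "0 < r'" "\<And>s. \<bar>s\<bar> \<le> r' \<Longrightarrow> (\<lambda>n. c' n * s ^ n) sums power_sum f (?a + s *\<^sub>R (x - p))"
        using real_analytic_on_line[OF power_sum_analytic[OF ps], of ?a "x - p"] seg[OF s0] by auto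
      have "(\<lambda>n. (c n - c' n) * (s - s0) ^ n) sums D s" if "\<bar>s - s0\<bar> \<le> min r r'" for s
      proof -
        have e: "?a + (s - s0) *\<^sub>R (x - p) = p + s *\<^sub>R (x - p)"
          by (simp add: scaleR_diff_left)
        have "(\<lambda>n. c n * (s - s0) ^ n - c' n * (s - s0) ^ n) sums D s"
          using sums_diff[OF r(2)[of "s - s0"] r'(2)[of "s - s0"]] that unfolding D_def e by auto
        then show ?thesis
          by (simp add: left_diff_distrib)
      qed
      then show "\<exists>c r. 0 < r \<and> (\<forall>s. \<bar>s - s0\<bar> \<le> r \<longrightarrow> (\<lambda>n. c n * (s - s0) ^ n) sums D s)"
        using r(1) r'(1) by (intro exI[of _ "\<lambda>n. c n - c' n"] exI[of _ "min r r'"]) auto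
    next
      define M where "M = (\<Sum>i\<in>UNIV. \<bar>x $ i - r\<bar>)"
      have M: "\<bar>x $ i - r\<bar> \<le> M" for i
        unfolding M_def by (rule member_le_sum) auto
      have M0: "0 \<le> M"
        unfolding M_def by (intro sum_nonneg) auto
      show "0 < min 1 (r / (M + 1))"
        using r M0 by simp
      fix s :: real assume s: "0 \<le> s" "s < min 1 (r / (M + 1))"
      have "0 \<le> (p + s *\<^sub>R (x - p)) $ i" for i
      proof -
        have "\<bar>s * (x $ i - r)\<bar> \<le> s * (M + 1)"
          using s M[of i] by (simp add: abs_mult mult_left_mono)
        also have "\<dots> \<le> r"
          using s M0 by (simp add: field_simps)
        finally show ?thesis
          by (simp add: p_def)
      qed
      then have "vabs (p + s *\<^sub>R (x - p)) = p + s *\<^sub>R (x - p)"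
        by (simp add: vabs_def Finite_Cartesian_Product.vec_eq_iff)
      then show "D s = 0"
        using seg[of s] s pos[of "p + s *\<^sub>R (x - p)"] FG[of "p + s *\<^sub>R (x - p)"] by (simp add: D_def)
    qed
    then show ?thesis
      using FG[OF x] by (simp add: D_def)
  qed
  show ?thesis
    using that[OF ps all] by blast
qed

section \<open>Positive semidefinite matrices\<close>

text \<open>
  Matrices are functions of which only the entries with indices below \<open>N\<close> matter. This lets an
  induction on \<open>N\<close> keep the same function.
\<close>

definition psd_kernel :: "nat \<Rightarrow> (nat \<Rightarrow> nat \<Rightarrow> real) \<Rightarrow> bool" where
  "psd_kernel N K \<longleftrightarrow> (\<forall>i<N. \<forall>j<N. K i j = K j i) \<and>
     (\<forall>v. 0 \<le> (\<Sum>i<N. \<Sum>j<N. v i * v j * K i j))"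

lemma psd_mats_iff:
  "A \<in> psd_mats N I \<longleftrightarrow> A \<in> carrier_mat N N \<and> (\<forall>i<N. \<forall>j<N. A $$ (i, j) \<in> I) \<and>
     psd_kernel N (\<lambda>i j. A $$ (i, j))"
proof (cases "A \<in> carrier_mat N N")
  case True
  then have dim: "dim_row A = N" "dim_col A = N"
    by auto
  have sym: "transpose_mat A = A \<longleftrightarrow> (\<forall>i<N. \<forall>j<N. A $$ (i, j) = A $$ (j, i))"
    using dim by (auto simp: mat_eq_iff)
  have elems: "elements_mat A \<subseteq> I \<longleftrightarrow> (\<forall>i<N. \<forall>j<N. A $$ (i, j) \<in> I)"
    unfolding elements_mat_def dim image_subset_iff subset_iff by fastforce
  have form: "scalar_prod v (A *\<^sub>v v) = (\<Sum>i<N. \<Sum>j<N. vec_index v i * vec_index v j * A $$ (i, j))"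
    if "v \<in> carrier_vec N" for v
  proof -
    have "scalar_prod v (A *\<^sub>v v) = (\<Sum>i<N. vec_index v i * (\<Sum>j<N. A $$ (i, j) * vec_index v j))"
      using that dim by (simp add: scalar_prod_def lessThan_atLeast0)
    then show ?thesis
      by (simp add: sum_distrib_left mult_ac)
  qed
  have quad: "(\<forall>v\<in>carrier_vec N. 0 \<le> scalar_prod v (A *\<^sub>v v)) \<longleftrightarrow>
      (\<forall>v. 0 \<le> (\<Sum>i<N. \<Sum>j<N. v i * v j * A $$ (i, j)))"
  proof (intro iffI allI ballI)
    fix v :: "nat \<Rightarrow> real" assume "\<forall>v\<in>carrier_vec N. 0 \<le> scalar_prod v (A *\<^sub>v v)"
    then have "0 \<le> scalar_prod (Matrix.vec N v) (A *\<^sub>v Matrix.vec N v)"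
      by simp
    then show "0 \<le> (\<Sum>i<N. \<Sum>j<N. v i * v j * A $$ (i, j))"
      by (simp add: form)
  qed (simp add: form)
  show ?thesis
    unfolding psd_mats_def psd_kernel_def using True sym elems quad by auto
qed (simp add: psd_mats_def)

lemma sum_square_Suc:
  fixes G :: "nat \<Rightarrow> nat \<Rightarrow> real"
  shows "(\<Sum>i<Suc n. \<Sum>j<Suc n. G i j)
    = (\<Sum>i<n. \<Sum>j<n. G i j) + (\<Sum>i<n. G i n) + (\<Sum>j<n. G n j) + G n n"
  by (simp add: sum.distrib)

text \<open>
  Cholesky decomposition: split off the rank-one kernel formed from the last row; the Schur
  complement remains positive semidefinite. If the last diagonal entry \<open>c\<close> is \<open>0\<close>, then the whole
  last row is \<open>0\<close>, and division by zero gives the correct value \<open>0\<close>.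
\<close>

lemma psd_kernel_gram:
  assumes "psd_kernel N K"
  shows "\<exists>g :: nat \<Rightarrow> nat \<Rightarrow> real. \<forall>i<N. \<forall>j<N. K i j = (\<Sum>k<N. g k i * g k j)"
  using assms
proof (induction N arbitrary: K)
  case (Suc n)
  define c where "c = K n n"
  have sym: "K i j = K j i" if "i < Suc n" "j < Suc n" for i j
    using Suc.prems that unfolding psd_kernel_def by blast
  have quad: "0 \<le> (\<Sum>i<n. \<Sum>j<n. v i * v j * K i j) + 2 * x * (\<Sum>i<n. v i * K i n) + x\<^sup>2 * c" for v x
  proof -
    define w where "w = v(n := x)"
    have "0 \<le> (\<Sum>i<Suc n. \<Sum>j<Suc n. w i * w j * K i j)"
      using Suc.prems unfolding psd_kernel_def by blast
    also have "\<dots> = (\<Sum>i<n. \<Sum>j<n. v i * v j * K i j) + (\<Sum>i<n. v i * x * K i n) + (\<Sum>j<n. x * v j * K n j) + x * x * c"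
      unfolding sum_square_Suc by (simp add: w_def c_def)
    also have "(\<Sum>j<n. x * v j * K n j) = x * (\<Sum>i<n. v i * K i n)"
      unfolding sum_distrib_left by (intro sum.cong refl) (simp add: sym[of n])
    also have "(\<Sum>i<n. v i * x * K i n) = x * (\<Sum>i<n. v i * K i n)"
      unfolding sum_distrib_left by (simp add: mult_ac)
    finally show ?thesis
      by (simp add: power2_eq_square)
  qed
  have c0: "0 \<le> c"
    using quad[of "\<lambda>_. 0" 1] by simp
  have K0: "K i n = 0" if "c = 0" "i < n" for i
  proof -
    have "K i n = 0" if nn: "\<And>x. 0 \<le> K i i + 2 * x * K i n"
    proof (rule ccontr)
      assume "K i n \<noteq> 0"
      then have "2 * (- (K i i + 1) / (2 * K i n)) * K i n = - (K i i + 1)"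
        by simp
      then show False
        using nn[of "- (K i i + 1) / (2 * K i n)"] by linarith
    qed
    moreover have "0 \<le> K i i + 2 * x * K i n" for x
    proof -
      have "(\<Sum>k<n. (if k = i then 1 else 0) * K k n) = K i n"
        using \<open>i < n\<close> by (simp add: if_distrib[of "\<lambda>u. u * _"] cong: if_cong)
      moreover have "(\<Sum>k<n. \<Sum>l<n. (if k = i then 1 else 0) * (if l = i then 1 else 0) * K k l) = K i i"
      proof -
        have "(\<Sum>l<n. (if k = i then 1 else 0) * (if l = i then 1 else 0) * K k l) = (if k = i then K k i else 0)" for k
          using \<open>i < n\<close> by (simp add: if_distrib[of "\<lambda>u. u * _"] cong: if_cong)
        then show ?thesis
          using \<open>i < n\<close> by simp
      qed
      ultimately show ?thesis
        using quad[of "\<lambda>k. if k = i then 1 else 0" x] \<open>c = 0\<close> by simp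
    qed
    ultimately show ?thesis .
  qed
  \<comment> \<open>The Schur complement of the last diagonal entry.\<close>
  define K' where "K' i j = K i j - K i n * K j n / c" for i j
  have "psd_kernel n K'"
    unfolding psd_kernel_def
  proof (intro conjI allI impI)
    show "K' i j = K' j i" if "i < n" "j < n" for i j
      using sym[of i j] that by (simp add: K'_def mult.commute)
    fix v :: "nat \<Rightarrow> real"
    define S where "S = (\<Sum>i<n. v i * K i n)"
    have "(\<Sum>i<n. \<Sum>j<n. v i * v j * K' i j) = (\<Sum>i<n. \<Sum>j<n. v i * v j * K i j) - S * S / c"
      unfolding S_def sum_product K'_def
      by (simp add: right_diff_distrib sum_subtractf sum_divide_distrib mult_ac)
    also have "0 \<le> \<dots>"
      \<comment> \<open>The quadratic form is minimal in its last variable at \<open>- S / c\<close>.\<close>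
      using quad[of v "- S / c"] c0 by (cases "c = 0") (simp_all add: S_def[symmetric] power2_eq_square)
    finally show "0 \<le> (\<Sum>i<n. \<Sum>j<n. v i * v j * K' i j)" .
  qed
  then obtain g :: "nat \<Rightarrow> nat \<Rightarrow> real" where g: "\<And>i j. \<lbrakk>i < n; j < n\<rbrakk> \<Longrightarrow> K' i j = (\<Sum>k<n. g k i * g k j)"
    using Suc.IH by blast
  define h where "h k i = (if k < n then (if i < n then g k i else 0) else K i n / sqrt c)" for k i
  have last: "h n i * h n j = K i n * K j n / c" for i j
    using c0 by (simp add: h_def)
  have Kn: "K i n * K n n / c = K i n" if "i \<le> n" for i
    using K0[of i] that by (cases "c = 0"; cases "i = n") (auto simp: c_def)
  have "K i j = (\<Sum>k<Suc n. h k i * h k j)" if ij: "i < Suc n" "j < Suc n" for i j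
  proof (cases "i < n \<and> j < n")
    case True
    then have "(\<Sum>k<n. h k i * h k j) = K' i j"
      by (simp add: g h_def)
    then show ?thesis
      by (simp add: last K'_def)
  next
    case False
    then have "(\<Sum>k<n. h k i * h k j) = 0"
      by (intro sum.neutral) (auto simp: h_def)
    moreover have "K i j = K i n * K j n / c"
    proof (cases "j = n")
      case True
      then show ?thesis
        using Kn[of i] ij by simp
    next
      case j: False
      then have "i = n"
        using False ij by auto
      then show ?thesis
        using Kn[of j] ij sym[of n j] by (simp add: mult.commute)
    qed
    ultimately show ?thesis
      by (simp add: last)
  qed
  then show ?case
    by blast
qed simp

text \<open>
  The Schur product theorem: with a Gram representation of \<open>K\<close>, the quadratic form of the product is a
  sum of values of the quadratic form of \<open>L\<close>.
\<close>

lemma psd_kernel_mult: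
  assumes K: "psd_kernel N K" and L: "psd_kernel N L"
  shows "psd_kernel N (\<lambda>i j. K i j * L i j)"
  unfolding psd_kernel_def
proof (intro conjI allI impI)
  show "K i j * L i j = K j i * L j i" if "i < N" "j < N" for i j
    using K L that unfolding psd_kernel_def by metis
  fix v :: "nat \<Rightarrow> real"
  obtain g :: "nat \<Rightarrow> nat \<Rightarrow> real" where g: "\<And>i j. \<lbrakk>i < N; j < N\<rbrakk> \<Longrightarrow> K i j = (\<Sum>k<N. g k i * g k j)"
    using psd_kernel_gram[OF K] by blast
  have "(\<Sum>i<N. \<Sum>j<N. v i * v j * (K i j * L i j))
    = (\<Sum>i<N. \<Sum>j<N. \<Sum>k<N. (v i * g k i) * (v j * g k j) * L i j)"
    by (intro sum.cong refl) (simp add: g sum_distrib_left sum_distrib_right mult_ac)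
  also have "\<dots> = (\<Sum>k<N. \<Sum>i<N. \<Sum>j<N. (v i * g k i) * (v j * g k j) * L i j)"
  proof -
    have "(\<Sum>i<N. \<Sum>j<N. \<Sum>k<N. X i j k) = (\<Sum>i<N. \<Sum>k<N. \<Sum>j<N. X i j k)" for X :: "nat \<Rightarrow> nat \<Rightarrow> nat \<Rightarrow> real"
      by (intro sum.cong refl sum.swap)
    also have "(\<Sum>i<N. \<Sum>k<N. \<Sum>j<N. X i j k) = (\<Sum>k<N. \<Sum>i<N. \<Sum>j<N. X i j k)" for X :: "nat \<Rightarrow> nat \<Rightarrow> nat \<Rightarrow> real"
      by (rule sum.swap)
    finally show ?thesis .
  qed
  also have "0 \<le> \<dots>"
  proof (rule sum_nonneg)
    fix k
    show "0 \<le> (\<Sum>i<N. \<Sum>j<N. (v i * g k i) * (v j * g k j) * L i j)"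
      using L unfolding psd_kernel_def by (elim conjE allE[of _ "\<lambda>i. v i * g k i"])
  qed
  finally show "0 \<le> (\<Sum>i<N. \<Sum>j<N. v i * v j * (K i j * L i j))" .
qed

lemma psd_kernel_1: "psd_kernel N (\<lambda>i j. 1)"
proof -
  have "(\<Sum>i<N. \<Sum>j<N. v i * v j * 1) = (\<Sum>i<N. v i)\<^sup>2" for v :: "nat \<Rightarrow> real"
    by (simp add: power2_eq_square sum_product)
  then show ?thesis
    by (simp add: psd_kernel_def)
qed

lemma psd_kernel_mpow:
  assumes "\<And>l. psd_kernel N (K l)"
  shows "psd_kernel N (\<lambda>i j. mpow (\<chi> l. K l i j) \<alpha>)"
proof -
  have pow: "psd_kernel N (\<lambda>i j. K l i j ^ n)" for l n
    by (induction n) (auto simp: psd_kernel_1 psd_kernel_mult assms)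
  have "psd_kernel N (\<lambda>i j. \<Prod>l\<in>S. K l i j ^ \<alpha> l)" for S
    by (induction S rule: infinite_finite_induct) (auto simp: psd_kernel_1 psd_kernel_mult pow)
  then show ?thesis
    by (simp add: mpow_def)
qed

lemma has_sum_finite_sum:
  fixes f :: "'b \<Rightarrow> 'a \<Rightarrow> real"
  assumes "\<And>i. i \<in> A \<Longrightarrow> (f i has_sum s i) B"
  shows "((\<lambda>x. \<Sum>i\<in>A. f i x) has_sum (\<Sum>i\<in>A. s i)) B"
  using assms by (induction A rule: infinite_finite_induct) (auto intro: has_sum_add)

lemma power_sum_has_sum:
  assumes f: "pos_series \<rho> f" and x: "vabs x \<in> orthant_box \<rho>"
  shows "((\<lambda>\<alpha>. f \<alpha> * mpow x \<alpha>) has_sum power_sum f x) UNIV"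
proof -
  have "(\<lambda>\<alpha>. f \<alpha> * mpow (vabs x) \<alpha>) summable_on UNIV"
    using f x by (simp add: pos_series_def)
  then have "(\<lambda>\<alpha>. f \<alpha> * mpow x \<alpha>) summable_on UNIV"
    by (rule summable_on_abs_dominated) (use f in \<open>simp add: abs_mult abs_mpow pos_series_def\<close>)
  then show ?thesis
    unfolding power_sum_def by (rule has_sum_infsum)
qed

lemma psd_kernel_power_sum:
  assumes f: "pos_series \<rho> f" and K: "\<And>l. psd_kernel N (K l)"
    and box: "\<And>i j. \<lbrakk>i < N; j < N\<rbrakk> \<Longrightarrow> vabs (\<chi> l. K l i j) \<in> orthant_box \<rho>"
  shows "psd_kernel N (\<lambda>i j. power_sum f (\<chi> l. K l i j))"
  unfolding psd_kernel_def
proof (intro conjI allI impI)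
  show "power_sum f (\<chi> l. K l i j) = power_sum f (\<chi> l. K l j i)" if "i < N" "j < N" for i j
  proof -
    have "K l i j = K l j i" for l
      using K[of l] that unfolding psd_kernel_def by blast
    then show ?thesis
      by simp
  qed
  fix v :: "nat \<Rightarrow> real"
  have "((\<lambda>\<alpha>. \<Sum>i<N. \<Sum>j<N. v i * v j * (f \<alpha> * mpow (\<chi> l. K l i j) \<alpha>)) has_sum
      (\<Sum>i<N. \<Sum>j<N. v i * v j * power_sum f (\<chi> l. K l i j))) UNIV"
    by (intro has_sum_finite_sum has_sum_cmult_right power_sum_has_sum[OF f] box) auto
  then show "0 \<le> (\<Sum>i<N. \<Sum>j<N. v i * v j * power_sum f (\<chi> l. K l i j))"
  proof (rule has_sum_nonneg)
    fix \<alpha>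
    have "0 \<le> (\<Sum>i<N. \<Sum>j<N. v i * v j * mpow (\<chi> l. K l i j) \<alpha>)"
      using psd_kernel_mpow[of N K \<alpha>, OF K] unfolding psd_kernel_def by blast
    then have "0 \<le> f \<alpha> * (\<Sum>i<N. \<Sum>j<N. v i * v j * mpow (\<chi> l. K l i j) \<alpha>)"
      using f by (simp add: pos_series_def)
    then show "0 \<le> (\<Sum>i<N. \<Sum>j<N. v i * v j * (f \<alpha> * mpow (\<chi> l. K l i j) \<alpha>))"
      by (simp add: sum_distrib_left mult_ac)
  qed
qed

lemma symm_interval_iff: "x \<in> symm_interval \<rho> \<longleftrightarrow> ereal \<bar>x\<bar> < \<rho>"
  by (cases \<rho>) (auto simp: symm_interval_def)

lemma vabs_box_iff: "vabs x \<in> orthant_box \<rho> \<longleftrightarrow> (\<forall>i. x $ i \<in> symm_interval \<rho>)"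
  by (simp add: vabs_def orthant_box_def symm_interval_iff)

theorem power_sum_preserves_psd:
  assumes f: "pos_series \<rho> f" and F: "\<And>x. vabs x \<in> orthant_box \<rho> \<Longrightarrow> F x = power_sum f x"
    and A: "\<And>l. A l \<in> psd_mats N (symm_interval \<rho>)"
  shows "mat_transform N F A \<in> psd_mats N UNIV"
proof -
  have ent: "\<And>i j l. \<lbrakk>i < N; j < N\<rbrakk> \<Longrightarrow> A l $$ (i, j) \<in> symm_interval \<rho>"
    and psd: "\<And>l. psd_kernel N (\<lambda>i j. A l $$ (i, j))"
    using A by (auto simp: psd_mats_iff)
  have box: "vabs (\<chi> l. A l $$ (i, j)) \<in> orthant_box \<rho>" if "i < N" "j < N" for i j
    using ent that by (simp add: vabs_box_iff)
  have K: "psd_kernel N (\<lambda>i j. power_sum f (\<chi> l. A l $$ (i, j)))"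
    by (rule psd_kernel_power_sum[OF f psd box])
  have eq: "mat_transform N F A $$ (i, j) = power_sum f (\<chi> l. A l $$ (i, j))" if "i < N" "j < N" for i j
    using that F[OF box] by (simp add: mat_transform_def)
  have "psd_kernel N (\<lambda>i j. mat_transform N F A $$ (i, j))"
    using K by (simp add: psd_kernel_def eq)
  then show ?thesis
    by (simp add: psd_mats_iff mat_transform_def)
qed

lemma riesz_square: "riesz \<tau> (p * p) = (\<Sum>i\<le>degree p. \<Sum>j\<le>degree p. coeff p i * coeff p j * \<tau> (i + j))"
proof -
  have mono: "riesz \<tau> (monom c k) = c * \<tau> k" for c k
  proof -
    have "riesz \<tau> (monom c k) = (\<Sum>i\<le>k. coeff (monom c k) i * \<tau> i)"
      by (rule riesz_upto) (rule degree_monom_le)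
    also have "\<dots> = (\<Sum>i\<le>k. if i = k then c * \<tau> k else 0)"
      by (intro sum.cong) auto
    finally show ?thesis
      by simp
  qed
  have "riesz \<tau> (p * p) = riesz \<tau> ((\<Sum>i\<le>degree p. monom (coeff p i) i) * (\<Sum>j\<le>degree p. monom (coeff p j) j))"
    by (simp only: poly_as_sum_of_monoms)
  also have "\<dots> = (\<Sum>i\<le>degree p. \<Sum>j\<le>degree p. riesz \<tau> (monom (coeff p i * coeff p j) (i + j)))"
    unfolding sum_product mult_monom riesz_sum ..
  finally show ?thesis
    unfolding mono .
qed

text \<open>
  The Hankel matrices of a two-atom measure are sums of two matrices of rank one, and \<open>F\<close> maps them
  to the Hankel matrices of the transformed sequence.
\<close>

theorem psd_preserver_two_atom:
  fixes F :: "real ^ 'm::finite \<Rightarrow> real"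
  assumes F: "\<And>N A. \<lbrakk>1 \<le> N; \<And>l. A l \<in> psd_mats N (symm_interval \<rho>)\<rbrakk> \<Longrightarrow> mat_transform N F A \<in> psd_mats N UNIV"
  shows "two_atom_positive \<rho> F"
  unfolding two_atom_positive_def
proof (intro allI impI)
  fix a b u v :: "real ^ 'm"
  assume H: "\<forall>i. 0 \<le> a $ i \<and> 0 \<le> b $ i \<and> ereal (a $ i + b $ i) < \<rho> \<and> \<bar>u $ i\<bar> \<le> 1 \<and> \<bar>v $ i\<bar> \<le> 1"
  define s where "s l k = a $ l * u $ l ^ k + b $ l * v $ l ^ k" for l k
  show "hankel_psd (\<lambda>k. F (\<chi> l. a $ l * u $ l ^ k + b $ l * v $ l ^ k))"
    unfolding hankel_psd_def
  proof
    fix p :: "real poly"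
    define N where "N = Suc (degree p)"
    define A where "A l = Matrix.mat N N (\<lambda>(i, j). s l (i + j))" for l
    have "A l \<in> psd_mats N (symm_interval \<rho>)" for l
      unfolding psd_mats_iff
    proof (intro conjI allI impI)
      show "A l \<in> carrier_mat N N"
        by (simp add: A_def)
      show "A l $$ (i, j) \<in> symm_interval \<rho>" if "i < N" "j < N" for i j
      proof -
        have "\<bar>s l k\<bar> \<le> a $ l * 1 + b $ l * 1" for k
          unfolding s_def using H
          by (intro order_trans[OF abs_triangle_ineq] add_mono)
            (auto simp: abs_mult power_abs intro!: mult_left_le power_le_one)
        then have "ereal \<bar>s l (i + j)\<bar> \<le> ereal (a $ l + b $ l)"
          by simp
        also have "\<dots> < \<rho>"
          using H by blast
        finally show ?thesis
          using that by (simp add: A_def symm_interval_iff)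
      qed
      show "psd_kernel N (\<lambda>i j. A l $$ (i, j))"
        unfolding psd_kernel_def
      proof (intro conjI allI impI)
        show "A l $$ (i, j) = A l $$ (j, i)" if "i < N" "j < N" for i j
          using that by (simp add: A_def add.commute)
        fix w :: "nat \<Rightarrow> real"
        have "(\<Sum>i<N. \<Sum>j<N. w i * w j * A l $$ (i, j))
          = a $ l * (\<Sum>i<N. w i * u $ l ^ i)\<^sup>2 + b $ l * (\<Sum>i<N. w i * v $ l ^ i)\<^sup>2"
          unfolding power2_eq_square sum_product
          by (simp add: A_def s_def power_add sum_distrib_left sum.distrib[symmetric] algebra_simps)
        also have "0 \<le> \<dots>"
          using H by simp
        finally show "0 \<le> (\<Sum>i<N. \<Sum>j<N. w i * w j * A l $$ (i, j))" .
      qed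
    qed
    then have "mat_transform N F A \<in> psd_mats N UNIV"
      by (intro F) (auto simp: N_def)
    then have "psd_kernel N (\<lambda>i j. mat_transform N F A $$ (i, j))"
      by (simp add: psd_mats_iff)
    then have "0 \<le> (\<Sum>i<N. \<Sum>j<N. coeff p i * coeff p j * mat_transform N F A $$ (i, j))"
      unfolding psd_kernel_def by blast
    also have "\<dots> = (\<Sum>i<N. \<Sum>j<N. coeff p i * coeff p j * F (\<chi> l. s l (i + j)))"
      by (intro sum.cong refl) (simp add: mat_transform_def A_def)
    also have "\<dots> = riesz (\<lambda>k. F (\<chi> l. s l k)) (p * p)"
      unfolding riesz_square N_def lessThan_Suc_atMost ..
    finally show "0 \<le> riesz (\<lambda>k. F (\<chi> l. a $ l * u $ l ^ k + b $ l * v $ l ^ k)) (p * p)"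
      by (simp only: s_def)
  qed
qed

section \<open>Operations on moment sequences\<close>

text \<open>
  The measure \<open>\<Sum> w\<^sub>n \<nu>\<^sub>n\<close> is obtained by integrating the kernel \<open>\<nu>\<close> against the weighted counting
  measure. Its integrals are available for nonnegative integrands only, so \<open>x\<^sup>k\<close> is written as the
  difference of \<open>x\<^sup>k + 1 + x\<^sup>2\<^sup>k\<close> and \<open>1 + x\<^sup>2\<^sup>k\<close>, both nonnegative.
\<close>

lemma mixture_of_measures:
  assumes adm: "\<And>n::nat. admissible (\<nu> n)" and prob: "\<And>n. prob_space (\<nu> n)" and w: "\<And>n. 0 \<le> w n"
    and t: "\<And>k. (\<lambda>n. w n * moment (\<nu> n) k) sums t k"
  shows "\<exists>N. admissible N \<and> (\<forall>k. moment N k = t k)"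
proof -
  define M where "M = density (count_space (UNIV :: nat set)) (\<lambda>n. ennreal (w n))"
  define N where "N = M \<bind> \<nu>"
  have sets_\<nu>: "sets (\<nu> n) = sets borel" for n
    using adm by (simp add: admissible_def)
  have \<nu>_meas: "\<nu> \<in> measurable M (subprob_algebra borel)"
    by (auto simp: M_def space_subprob_algebra sets_\<nu> prob intro: prob_space_imp_subprob_space)
  have sets_N: "sets N = sets borel"
    unfolding N_def by (rule sets_bind) (auto simp: sets_\<nu> M_def)
  have key: "integrable N g \<and> integral\<^sup>L N g = s"
    if g: "g \<in> borel_measurable borel" "\<And>x. 0 \<le> g x" "\<And>n. integrable (\<nu> n) g"
      and s: "(\<lambda>n. w n * integral\<^sup>L (\<nu> n) g) sums s" for g :: "real \<Rightarrow> real" and s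
  proof -
    have nn: "0 \<le> w n * integral\<^sup>L (\<nu> n) g" for n
      by (simp add: w g(2))
    have s0: "0 \<le> s"
      using s nn by (auto simp: sums_iff intro: suminf_nonneg)
    have "(\<integral>\<^sup>+x. ennreal (g x) \<partial>N) = (\<integral>\<^sup>+n. \<integral>\<^sup>+x. ennreal (g x) \<partial>\<nu> n \<partial>M)"
      unfolding N_def by (rule nn_integral_bind[OF _ \<nu>_meas]) (use g(1) in measurable)
    also have "\<dots> = (\<integral>\<^sup>+n. ennreal (integral\<^sup>L (\<nu> n) g) \<partial>M)"
      by (intro nn_integral_cong nn_integral_eq_integral g(3)) (simp add: g(2))
    also have "\<dots> = (\<integral>\<^sup>+n. ennreal (w n * integral\<^sup>L (\<nu> n) g) \<partial>count_space UNIV)"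
      unfolding M_def by (simp add: nn_integral_density ennreal_mult w g(2))
    also have "\<dots> = (\<Sum>n. ennreal (w n * integral\<^sup>L (\<nu> n) g))"
      by (rule nn_integral_count_space_nat)
    also have "\<dots> = ennreal s"
      using s by (intro suminf_ennreal_eq nn)
    finally have *: "(\<integral>\<^sup>+x. ennreal (g x) \<partial>N) = ennreal s" .
    have "g \<in> borel_measurable N"
      using g(1) sets_N measurable_cong_sets by blast
    then show ?thesis
      using nn_integral_eq_integrable[of g N s] * g(2) s0 by simp
  qed
  have int_\<nu>: "integrable (\<nu> n) (\<lambda>x. x ^ k)" for n k
    using adm by (simp add: admissible_def)
  have one: "integrable N (\<lambda>x. 1 :: real) \<and> integral\<^sup>L N (\<lambda>x. 1 :: real) = t 0"
  proof (rule key)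
    show "integrable (\<nu> n) (\<lambda>x. 1 :: real)" for n
      using int_\<nu>[of n 0] by simp
    show "(\<lambda>n. w n * integral\<^sup>L (\<nu> n) (\<lambda>x. 1 :: real)) sums t 0"
      using t[of 0] by (simp add: moment_def)
  qed auto
  have even: "integrable N (\<lambda>x. x ^ (2 * k)) \<and> integral\<^sup>L N (\<lambda>x. x ^ (2 * k)) = t (2 * k)" for k
    using t[of "2 * k"] int_\<nu>[of _ "2 * k"] by (intro key) (simp_all add: moment_def)
  have all: "integrable N (\<lambda>x. x ^ k) \<and> integral\<^sup>L N (\<lambda>x. x ^ k) = t k" for k
  proof -
    let ?g = "\<lambda>x::real. x ^ k + (1 + x ^ (2 * k))"
    have int_g: "integrable (\<nu> n) ?g" for n
      using int_\<nu>[of n 0] by (intro Bochner_Integration.integrable_add int_\<nu>) simp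
    have "0 \<le> ?g x" for x
    proof -
      have "x ^ (2 * k) = (x ^ k)\<^sup>2"
        by (simp add: power_even_eq)
      moreover have "0 \<le> (x ^ k)\<^sup>2 + 2 * x ^ k + 1"
        using zero_le_power2[of "x ^ k + 1"] by (simp add: power2_sum)
      moreover have "0 \<le> (x ^ k)\<^sup>2"
        by simp
      ultimately show ?thesis
        by linarith
    qed
    moreover have "(\<lambda>n. w n * integral\<^sup>L (\<nu> n) ?g) sums (t k + (t 0 + t (2 * k)))"
    proof -
      have "integral\<^sup>L (\<nu> n) ?g = moment (\<nu> n) k + (moment (\<nu> n) 0 + moment (\<nu> n) (2 * k))" for n
        using int_\<nu>[of n k] int_\<nu>[of n 0] int_\<nu>[of n "2 * k"] by (simp add: moment_def)
      then show ?thesis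
        using sums_add[OF t[of k] sums_add[OF t[of 0] t[of "2 * k"]]] by (simp add: distrib_left)
    qed
    ultimately have g: "integrable N ?g \<and> integral\<^sup>L N ?g = t k + (t 0 + t (2 * k))"
      by (intro key[of ?g] int_g) simp_all
    have rest: "integrable N (\<lambda>x. 1 + x ^ (2 * k))" "integral\<^sup>L N (\<lambda>x. 1 + x ^ (2 * k)) = t 0 + t (2 * k)"
      using one even[of k] Bochner_Integration.integral_add[of N "\<lambda>_. 1 :: real" "\<lambda>x. x ^ (2 * k)"] by auto
    have "integrable N (\<lambda>x. ?g x - (1 + x ^ (2 * k)))"
      using g rest by (intro Bochner_Integration.integrable_diff) auto
    moreover have "integral\<^sup>L N (\<lambda>x. ?g x - (1 + x ^ (2 * k))) = t k"
      using g rest by (subst Bochner_Integration.integral_diff) auto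
    ultimately show ?thesis
      by simp
  qed
  then show ?thesis
    using sets_N by (auto simp: admissible_def moment_def)
qed

lemma mixture_of_measures_countable:
  fixes \<nu> :: "'c::countable \<Rightarrow> real measure"
  assumes adm: "\<And>\<alpha>. admissible (\<nu> \<alpha>)" and prob: "\<And>\<alpha>. prob_space (\<nu> \<alpha>)" and w: "\<And>\<alpha>. 0 \<le> w \<alpha>"
    and t: "\<And>k. ((\<lambda>\<alpha>. w \<alpha> * moment (\<nu> \<alpha>) k) has_sum t k) UNIV"
  shows "\<exists>N. admissible N \<and> (\<forall>k. moment N k = t k)"
proof (rule mixture_of_measures)
  \<comment> \<open>Natural numbers that encode no index get weight \<open>0\<close>.\<close>
  define w' where "w' n = (if n \<in> range (to_nat :: 'c \<Rightarrow> nat) then w (from_nat n) else 0)" for n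
  show "admissible (\<nu> (from_nat n))" "prob_space (\<nu> (from_nat n))" "0 \<le> w' n" for n
    by (simp_all add: adm prob w w'_def)
  show "(\<lambda>n. w' n * moment (\<nu> (from_nat n)) k) sums t k" for k
  proof (rule has_sum_imp_sums)
    have "((\<lambda>n. w' n * moment (\<nu> (from_nat n)) k) has_sum t k) (range (to_nat :: 'c \<Rightarrow> nat))"
      using t[of k] by (subst has_sum_reindex) (auto simp: o_def w'_def)
    then show "((\<lambda>n. w' n * moment (\<nu> (from_nat n)) k) has_sum t k) UNIV"
      by (rule has_sum_cong_neutral[THEN iffD1, rotated -1]) (auto simp: w'_def)
  qed
qed

definition prob_moments :: "(nat \<Rightarrow> real) \<Rightarrow> bool" where
  "prob_moments s \<longleftrightarrow> (\<exists>\<pi>. prob_space \<pi> \<and> admissible \<pi> \<and> (\<forall>k. moment \<pi> k = s k))"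

lemma prob_moments_1: "prob_moments (\<lambda>_. 1)"
  unfolding prob_moments_def
proof (intro exI[of _ "return borel (1::real)"] conjI allI)
  show "prob_space (return borel (1::real))"
    by (intro prob_space_return) simp
  then interpret prob_space "return borel (1::real)" .
  have ae: "AE x in return borel (1::real). x ^ k = 1" for k
    by (subst AE_return) auto
  have "integrable (return borel (1::real)) (\<lambda>x. x ^ k)" for k
    by (subst integrable_cong_AE[OF _ _ ae]) auto
  then show "admissible (return borel (1::real))"
    by (simp add: admissible_def)
  show "moment (return borel 1) k = 1" for k
    unfolding moment_def by (subst integral_return) auto
qed

text \<open>
  The moments of the product of two independent random variables.
\<close>

lemma prob_moments_mult:
  assumes "prob_moments s" "prob_moments s'"
  shows "prob_moments (\<lambda>k. s k * s' k)"
proof -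
  obtain \<pi> where \<pi>: "prob_space \<pi>" "admissible \<pi>" "\<And>k. moment \<pi> k = s k"
    using assms(1) by (auto simp: prob_moments_def)
  obtain \<pi>' where \<pi>': "prob_space \<pi>'" "admissible \<pi>'" "\<And>k. moment \<pi>' k = s' k"
    using assms(2) by (auto simp: prob_moments_def)
  interpret A: prob_space \<pi> by fact
  interpret B: prob_space \<pi>' by fact
  interpret pair_prob_space \<pi> \<pi>' ..
  have [measurable_cong]: "sets \<pi> = sets borel" "sets \<pi>' = sets borel"
    using \<pi>(2) \<pi>'(2) by (auto simp: admissible_def)
  have int: "integrable \<pi> (\<lambda>x. x ^ k)" "integrable \<pi>' (\<lambda>x. x ^ k)" for k
    using \<pi>(2) \<pi>'(2) by (auto simp: admissible_def)
  have meas: "(\<lambda>z. fst z * snd z) \<in> measurable (\<pi> \<Otimes>\<^sub>M \<pi>') (borel :: real measure)"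
    by measurable
  define Q where "Q = distr (\<pi> \<Otimes>\<^sub>M \<pi>') borel (\<lambda>z. fst z * snd z)"
  have int_pair: "integrable (\<pi> \<Otimes>\<^sub>M \<pi>') (\<lambda>z. (fst z * snd z) ^ k)" for k
  proof (rule Fubini_integrable)
    show "(\<lambda>z. (fst z * snd z) ^ k) \<in> borel_measurable (\<pi> \<Otimes>\<^sub>M \<pi>')"
      by measurable
    show "AE x in \<pi>. integrable \<pi>' (\<lambda>y. (fst (x, y) * snd (x, y)) ^ k)"
      using int(2) by (simp add: power_mult_distrib)
    have "integrable \<pi> (\<lambda>x. \<bar>x ^ k\<bar> * (\<integral>y. \<bar>y ^ k\<bar> \<partial>\<pi>'))"
      using int(1) by (intro integrable_mult_left integrable_abs)
    then show "integrable \<pi> (\<lambda>x. \<integral>y. norm ((fst (x, y) * snd (x, y)) ^ k) \<partial>\<pi>')"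
      by (simp add: power_mult_distrib abs_mult)
  qed
  have mom: "moment Q k = s k * s' k" for k
  proof -
    have "moment Q k = (\<integral>z. (fst z * snd z) ^ k \<partial>(\<pi> \<Otimes>\<^sub>M \<pi>'))"
      unfolding Q_def moment_def by (rule integral_distr[OF meas]) simp
    also have "\<dots> = (\<integral>x. \<integral>y. (x * y) ^ k \<partial>\<pi>' \<partial>\<pi>)"
      using integral_fst'[OF int_pair[of k]] by simp
    also have "\<dots> = s k * s' k"
      by (simp add: power_mult_distrib \<pi>(3)[symmetric] \<pi>'(3)[symmetric] moment_def)
    finally show ?thesis .
  qed
  have "prob_space Q"
    unfolding Q_def by (rule prob_space_distr[OF meas])
  moreover have "admissible Q"
    unfolding admissible_def Q_def using int_pair by (simp add: integrable_distr_eq[OF meas])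
  ultimately show ?thesis
    using mom by (auto simp: prob_moments_def)
qed

lemma prob_moments_prod_power:
  assumes "\<And>l. prob_moments (s l)"
  shows "prob_moments (\<lambda>k. \<Prod>l\<in>S. s l k ^ \<alpha> l)"
proof -
  have "prob_moments (\<lambda>k. s l k ^ n)" for l n
    by (induction n) (auto simp: prob_moments_1 prob_moments_mult assms)
  then show ?thesis
    by (induction S rule: infinite_finite_induct) (auto simp: prob_moments_1 prob_moments_mult)
qed

text \<open>
  Divide by the total mass. If the mass is zero, then all moments are \<open>0\<close> and any sequence \<open>s\<close> serves.
\<close>

lemma admissible_normalized:
  assumes "admissible \<mu>"
  shows "0 \<le> moment \<mu> 0 \<and> (\<exists>s. prob_moments s \<and> (\<forall>k. moment \<mu> k = moment \<mu> 0 * s k))"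
proof -
  have int: "integrable \<mu> (\<lambda>x. x ^ k)" for k
    using assms by (simp add: admissible_def)
  have sets: "sets \<mu> = sets borel"
    using assms by (simp add: admissible_def)
  have meas: "(\<lambda>x. x ^ k) \<in> borel_measurable \<mu>" for k
    using int by blast
  interpret finite_measure \<mu>
    by (rule finite_measureI) (use int[of 0] in \<open>simp add: integrable_iff_bounded\<close>)
  define m where "m = moment \<mu> 0"
  have m: "m = measure \<mu> (space \<mu>)"
    by (simp add: m_def moment_def)
  have m0: "0 \<le> m"
    by (simp add: m)
  have "\<exists>s. prob_moments s \<and> (\<forall>k. moment \<mu> k = m * s k)"
  proof (cases "m = 0")
    case True
    then have "emeasure \<mu> (space \<mu>) = 0"
      by (simp add: m emeasure_eq_measure)
    then have "AE x in \<mu>. x ^ k = 0" for k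
      by (intro AE_I[of _ _ "space \<mu>"]) auto
    then have "moment \<mu> k = 0" for k
      unfolding moment_def by (rule integral_eq_zero_AE)
    then show ?thesis
      using prob_moments_1 True by auto
  next
    case False
    with m0 have mp: "0 < m"
      by simp
    define \<pi> where "\<pi> = density \<mu> (\<lambda>_. ennreal (1 / m))"
    have "emeasure \<pi> (space \<pi>) = ennreal (1 / m) * emeasure \<mu> (space \<mu>)"
      unfolding \<pi>_def by (simp add: emeasure_density_const)
    also have "\<dots> = 1"
      using mp by (simp add: emeasure_eq_measure m[symmetric] ennreal_mult[symmetric])
    finally have "prob_space \<pi>"
      by (rule prob_spaceI)
    moreover have "admissible \<pi>"
      unfolding admissible_def \<pi>_def using int mp sets by (simp add: integrable_density meas)
    moreover have "moment \<pi> k = moment \<mu> k / m" for k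
      unfolding moment_def \<pi>_def using mp by (subst integral_density) (simp_all add: meas)
    ultimately show ?thesis
      using mp by (intro exI[of _ "\<lambda>k. moment \<mu> k / m"]) (auto simp: prob_moments_def)
  qed
  then show ?thesis
    using m0 by (simp add: m_def)
qed

section \<open>Convergent conic combinations in finite dimension\<close>

text \<open>
  Finitely many of the vectors \<open>(v \<alpha> 0, \<dots>, v \<alpha> (L - 1))\<close> span all of them, with coefficients that are
  bounded by the size of the vector represented. When an entry is added, either the representation
  persists or one vector with nonzero residual \<open>r\<close> corrects all others.
\<close>

lemma finite_spanning_bounded:
  fixes v :: "'c \<Rightarrow> nat \<Rightarrow> real"
  shows "\<exists>B C \<kappa>. finite B \<and> B \<subseteq> S \<and> 0 \<le> C \<and>
    (\<forall>\<alpha>\<in>S. \<forall>k<L. v \<alpha> k = (\<Sum>\<beta>\<in>B. \<kappa> \<alpha> \<beta> * v \<beta> k)) \<and>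
    (\<forall>\<alpha>\<in>S. \<forall>\<beta>\<in>B. \<bar>\<kappa> \<alpha> \<beta>\<bar> \<le> C * (\<Sum>k<L. \<bar>v \<alpha> k\<bar>))"
proof (induction L)
  case 0
  show ?case
    by (intro exI[of _ "{}"] exI[of _ 0]) auto
next
  case (Suc L)
  obtain B C \<kappa> where B: "finite B" "B \<subseteq> S" and C: "0 \<le> C"
    and \<kappa>_all: "\<forall>\<alpha>\<in>S. \<forall>k<L. v \<alpha> k = (\<Sum>\<beta>\<in>B. \<kappa> \<alpha> \<beta> * v \<beta> k)"
    and bnd_all: "\<forall>\<alpha>\<in>S. \<forall>\<beta>\<in>B. \<bar>\<kappa> \<alpha> \<beta>\<bar> \<le> C * (\<Sum>k<L. \<bar>v \<alpha> k\<bar>)"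
    using Suc.IH by (elim exE conjE) (rule that)
  have \<kappa>: "v \<alpha> k = (\<Sum>\<beta>\<in>B. \<kappa> \<alpha> \<beta> * v \<beta> k)" if "\<alpha> \<in> S" "k < L" for \<alpha> k
    using \<kappa>_all that by (elim ballE allE impE) auto
  have bnd: "\<bar>\<kappa> \<alpha> \<beta>\<bar> \<le> C * (\<Sum>k<L. \<bar>v \<alpha> k\<bar>)" if "\<alpha> \<in> S" "\<beta> \<in> B" for \<alpha> \<beta>
    using bnd_all that by (elim ballE) auto
  define n where "n \<alpha> = (\<Sum>k<Suc L. \<bar>v \<alpha> k\<bar>)" for \<alpha>
  have n0: "0 \<le> n \<alpha>" for \<alpha>
    by (simp add: n_def sum_nonneg)
  have bnd': "\<bar>\<kappa> \<alpha> \<beta>\<bar> \<le> C * n \<alpha>" if "\<alpha> \<in> S" "\<beta> \<in> B" for \<alpha> \<beta>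
  proof -
    have "C * (\<Sum>k<L. \<bar>v \<alpha> k\<bar>) \<le> C * n \<alpha>"
      using C by (intro mult_left_mono) (simp_all add: n_def)
    then show ?thesis
      using bnd[OF that] by linarith
  qed
  define r where "r \<alpha> = v \<alpha> L - (\<Sum>\<beta>\<in>B. \<kappa> \<alpha> \<beta> * v \<beta> L)" for \<alpha>
  show ?case
  proof (cases "\<forall>\<alpha>\<in>S. r \<alpha> = 0")
    case True
    have "v \<alpha> k = (\<Sum>\<beta>\<in>B. \<kappa> \<alpha> \<beta> * v \<beta> k)" if "\<alpha> \<in> S" "k < Suc L" for \<alpha> k
      using \<kappa>[of \<alpha> k] True that by (cases "k = L") (auto simp: r_def)
    then show ?thesis
      using B C bnd'[unfolded n_def]
      by (intro exI[of _ B] exI[of _ C] exI[of _ \<kappa>] conjI ballI allI impI)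
  next
    case False
    then obtain \<alpha>0 where \<alpha>0: "\<alpha>0 \<in> S" "r \<alpha>0 \<noteq> 0"
      by blast
    define c where "c \<alpha> = r \<alpha> / r \<alpha>0" for \<alpha>
    define \<kappa>' where "\<kappa>' \<alpha> \<beta> = (if \<beta> \<in> B then \<kappa> \<alpha> \<beta> - c \<alpha> * \<kappa> \<alpha>0 \<beta> else 0) + (if \<beta> = \<alpha>0 then c \<alpha> else 0)" for \<alpha> \<beta>
    define D where "D = 1 + C * (\<Sum>\<beta>\<in>B. \<bar>v \<beta> L\<bar>)"
    define E where "E = D / \<bar>r \<alpha>0\<bar>"
    define C' where "C' = C + E * (C * n \<alpha>0) + E"
    have D0: "0 \<le> D"
      using C by (simp add: D_def sum_nonneg)
    then have E0: "0 \<le> E"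
      by (simp add: E_def)
    have c_bnd: "\<bar>c \<alpha>\<bar> \<le> E * n \<alpha>" if "\<alpha> \<in> S" for \<alpha>
    proof -
      have "\<bar>\<Sum>\<beta>\<in>B. \<kappa> \<alpha> \<beta> * v \<beta> L\<bar> \<le> (\<Sum>\<beta>\<in>B. C * n \<alpha> * \<bar>v \<beta> L\<bar>)"
        using bnd'[OF that] by (intro order_trans[OF sum_abs] sum_mono) (auto simp: abs_mult intro: mult_right_mono)
      also have "\<dots> = n \<alpha> * (C * (\<Sum>\<beta>\<in>B. \<bar>v \<beta> L\<bar>))"
        by (simp add: sum_distrib_left mult_ac)
      finally have "\<bar>r \<alpha>\<bar> \<le> \<bar>v \<alpha> L\<bar> + n \<alpha> * (C * (\<Sum>\<beta>\<in>B. \<bar>v \<beta> L\<bar>))"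
        unfolding r_def by linarith
      also have "\<bar>v \<alpha> L\<bar> \<le> n \<alpha>"
        by (simp add: n_def sum_nonneg)
      finally have "\<bar>r \<alpha>\<bar> \<le> D * n \<alpha>"
        by (simp add: D_def distrib_left mult.commute distrib_right)
      then show ?thesis
        by (simp add: c_def E_def divide_right_mono)
    qed
    have span: "v \<alpha> k = (\<Sum>\<beta>\<in>insert \<alpha>0 B. \<kappa>' \<alpha> \<beta> * v \<beta> k)" if "\<alpha> \<in> S" "k < Suc L" for \<alpha> k
    proof -
      have "(\<Sum>\<beta>\<in>insert \<alpha>0 B. \<kappa>' \<alpha> \<beta> * v \<beta> k)
        = (\<Sum>\<beta>\<in>insert \<alpha>0 B. if \<beta> \<in> B then (\<kappa> \<alpha> \<beta> - c \<alpha> * \<kappa> \<alpha>0 \<beta>) * v \<beta> k else 0)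
          + (\<Sum>\<beta>\<in>insert \<alpha>0 B. if \<beta> = \<alpha>0 then c \<alpha> * v \<beta> k else 0)"
        unfolding sum.distrib[symmetric] by (intro sum.cong refl) (simp add: \<kappa>'_def distrib_right)
      also have "(\<Sum>\<beta>\<in>insert \<alpha>0 B. if \<beta> \<in> B then (\<kappa> \<alpha> \<beta> - c \<alpha> * \<kappa> \<alpha>0 \<beta>) * v \<beta> k else 0)
        = (\<Sum>\<beta>\<in>B. (\<kappa> \<alpha> \<beta> - c \<alpha> * \<kappa> \<alpha>0 \<beta>) * v \<beta> k)"
        using B(1) by (intro sum.mono_neutral_cong_right) auto
      also have "\<dots> = (\<Sum>\<beta>\<in>B. \<kappa> \<alpha> \<beta> * v \<beta> k) - c \<alpha> * (\<Sum>\<beta>\<in>B. \<kappa> \<alpha>0 \<beta> * v \<beta> k)"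
        by (simp add: left_diff_distrib sum_subtractf sum_distrib_left mult.assoc)
      also have "(\<Sum>\<beta>\<in>insert \<alpha>0 B. if \<beta> = \<alpha>0 then c \<alpha> * v \<beta> k else 0) = c \<alpha> * v \<alpha>0 k"
        using B(1) by simp
      finally have eq: "(\<Sum>\<beta>\<in>insert \<alpha>0 B. \<kappa>' \<alpha> \<beta> * v \<beta> k)
        = (\<Sum>\<beta>\<in>B. \<kappa> \<alpha> \<beta> * v \<beta> k) + c \<alpha> * (v \<alpha>0 k - (\<Sum>\<beta>\<in>B. \<kappa> \<alpha>0 \<beta> * v \<beta> k))"
        by (simp add: right_diff_distrib)
      show ?thesis
      proof (cases "k = L")
        case True
        have "c \<alpha> * r \<alpha>0 = r \<alpha>"
          using \<alpha>0 by (simp add: c_def)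
        then show ?thesis
          unfolding True eq[unfolded True] r_def by linarith
      next
        case False
        then have "k < L"
          using that by simp
        then show ?thesis
          unfolding eq using \<kappa>[OF that(1)] \<kappa>[OF \<alpha>0(1)] by simp
      qed
    qed
    have bound: "\<bar>\<kappa>' \<alpha> \<beta>\<bar> \<le> C' * n \<alpha>" if "\<alpha> \<in> S" "\<beta> \<in> insert \<alpha>0 B" for \<alpha> \<beta>
    proof -
      have "\<bar>if \<beta> \<in> B then \<kappa> \<alpha> \<beta> - c \<alpha> * \<kappa> \<alpha>0 \<beta> else 0\<bar> \<le> C * n \<alpha> + (E * n \<alpha>) * (C * n \<alpha>0)"
      proof (cases "\<beta> \<in> B")
        case True
        have "\<bar>c \<alpha> * \<kappa> \<alpha>0 \<beta>\<bar> \<le> (E * n \<alpha>) * (C * n \<alpha>0)"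
          unfolding abs_mult using c_bnd[OF that(1)] bnd'[OF \<alpha>0(1) True] E0 n0 by (intro mult_mono) auto
        then show ?thesis
          using True bnd'[OF that(1) True] by simp
      next
        case False
        then show ?thesis
          using C E0 n0 by simp
      qed
      moreover have "\<bar>if \<beta> = \<alpha>0 then c \<alpha> else 0\<bar> \<le> E * n \<alpha>"
        using c_bnd[OF that(1)] E0 n0 by simp
      ultimately have "\<bar>\<kappa>' \<alpha> \<beta>\<bar> \<le> C * n \<alpha> + (E * n \<alpha>) * (C * n \<alpha>0) + E * n \<alpha>"
        unfolding \<kappa>'_def by linarith
      then show ?thesis
        by (simp add: C'_def algebra_simps)
    qed
    have "0 \<le> C'"
      using C E0 n0 by (simp add: C'_def)
    moreover have "finite (insert \<alpha>0 B)" "insert \<alpha>0 B \<subseteq> S"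
      using B \<alpha>0 by auto
    ultimately show ?thesis
      using span bound[unfolded n_def]
      by (intro exI[of _ "insert \<alpha>0 B"] exI[of _ C'] exI[of _ \<kappa>'] conjI ballI allI impI)
  qed
qed

text \<open>
  Let \<open>B\<close> be a finite spanning subset of the indices of positive weight. The terms outside a large finite set
  \<open>A\<close> are rewritten in terms of \<open>B\<close>. As the tail is small, this changes the weights on \<open>B\<close> by less
  than their size, so they remain nonnegative.
\<close>

lemma convergent_conic_combination:
  fixes v :: "'c \<Rightarrow> nat \<Rightarrow> real"
  assumes w: "\<And>\<alpha>. 0 \<le> w \<alpha>" and t: "\<And>k. k < L \<Longrightarrow> ((\<lambda>\<alpha>. w \<alpha> * v \<alpha> k) has_sum t k) UNIV"
  shows "\<exists>A d. finite A \<and> (\<forall>\<alpha>. 0 \<le> d \<alpha>) \<and> (\<forall>k<L. t k = (\<Sum>\<alpha>\<in>A. d \<alpha> * v \<alpha> k))"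
proof -
  define S where "S = {\<alpha>. 0 < w \<alpha>}"
  have w0: "w \<alpha> = 0" if "\<alpha> \<notin> S" for \<alpha>
    using that w[of \<alpha>] by (simp add: S_def)
  obtain B C \<kappa> where B: "finite B" "B \<subseteq> S" and C: "0 \<le> C"
    and \<kappa>_all: "\<forall>\<alpha>\<in>S. \<forall>k<L. v \<alpha> k = (\<Sum>\<beta>\<in>B. \<kappa> \<alpha> \<beta> * v \<beta> k)"
    and bnd_all: "\<forall>\<alpha>\<in>S. \<forall>\<beta>\<in>B. \<bar>\<kappa> \<alpha> \<beta>\<bar> \<le> C * (\<Sum>k<L. \<bar>v \<alpha> k\<bar>)"
    using finite_spanning_bounded[of S L v] by (elim exE conjE) (rule that)
  have \<kappa>: "v \<alpha> k = (\<Sum>\<beta>\<in>B. \<kappa> \<alpha> \<beta> * v \<beta> k)" if "\<alpha> \<in> S" "k < L" for \<alpha> k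
    using \<kappa>_all that by (elim ballE allE impE) auto
  have bnd: "\<bar>\<kappa> \<alpha> \<beta>\<bar> \<le> C * (\<Sum>k<L. \<bar>v \<alpha> k\<bar>)" if "\<alpha> \<in> S" "\<beta> \<in> B" for \<alpha> \<beta>
    using bnd_all that by (elim ballE) auto
  define n where "n \<alpha> = (\<Sum>k<L. \<bar>v \<alpha> k\<bar>)" for \<alpha>
  have n0: "0 \<le> n \<alpha>" for \<alpha>
    by (simp add: n_def sum_nonneg)
  have tS: "((\<lambda>\<alpha>. w \<alpha> * v \<alpha> k) has_sum t k) S" if "k < L" for k
    using t[OF that] by (rule has_sum_cong_neutral[THEN iffD1, rotated -1]) (auto simp: w0)
  have sum_n: "(\<lambda>\<alpha>. w \<alpha> * n \<alpha>) summable_on S"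
  proof -
    have "((\<lambda>\<alpha>. \<Sum>k<L. \<bar>w \<alpha> * v \<alpha> k\<bar>) has_sum (\<Sum>k<L. \<Sum>\<^sub>\<infinity>\<alpha>\<in>S. \<bar>w \<alpha> * v \<alpha> k\<bar>)) S"
    proof (rule has_sum_finite_sum)
      fix k assume "k \<in> {..<L}"
      then have "(\<lambda>\<alpha>. w \<alpha> * v \<alpha> k) summable_on S"
        using tS by (auto simp: summable_on_def)
      then have "(\<lambda>\<alpha>. \<bar>w \<alpha> * v \<alpha> k\<bar>) summable_on S"
        using summable_on_iff_abs_summable_on_real by fastforce
      then show "((\<lambda>\<alpha>. \<bar>w \<alpha> * v \<alpha> k\<bar>) has_sum (\<Sum>\<^sub>\<infinity>\<alpha>\<in>S. \<bar>w \<alpha> * v \<alpha> k\<bar>)) S"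
        by (rule has_sum_infsum)
    qed
    then have "((\<lambda>\<alpha>. w \<alpha> * n \<alpha>) has_sum (\<Sum>k<L. \<Sum>\<^sub>\<infinity>\<alpha>\<in>S. \<bar>w \<alpha> * v \<alpha> k\<bar>)) S"
      by (simp add: n_def abs_mult w sum_distrib_left)
    then show ?thesis
      by (auto simp: summable_on_def)
  qed
  obtain \<epsilon> where \<epsilon>: "0 < \<epsilon>" "\<And>\<beta>. \<beta> \<in> B \<Longrightarrow> C * \<epsilon> \<le> w \<beta>"
  proof -
    define \<epsilon>0 where "\<epsilon>0 = Min (insert 1 (w ` B))"
    have pos: "0 < \<epsilon>0"
      using B by (auto simp: \<epsilon>0_def S_def)
    have le: "\<epsilon>0 \<le> w \<beta>" if "\<beta> \<in> B" for \<beta>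
      unfolding \<epsilon>0_def using B(1) that by (intro Min_le) auto
    have "C * (\<epsilon>0 / (C + 1)) \<le> \<epsilon>0"
      using C pos by (simp add: field_simps)
    then show thesis
      using pos C le by (intro that[of "\<epsilon>0 / (C + 1)"]) (auto intro: order_trans)
  qed
  obtain A0 where A0: "finite A0" "A0 \<subseteq> S" "dist (sum (\<lambda>\<alpha>. w \<alpha> * n \<alpha>) A0) (\<Sum>\<^sub>\<infinity>\<alpha>\<in>S. w \<alpha> * n \<alpha>) \<le> \<epsilon>"
    using infsum_finite_approximation[OF sum_n \<epsilon>(1)] by blast
  define A where "A = A0 \<union> B"
  have A: "finite A" "A \<subseteq> S" "B \<subseteq> A"
    using A0 B by (auto simp: A_def)
  have tail: "(\<lambda>\<alpha>. w \<alpha> * n \<alpha>) summable_on (S - A)"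
    using sum_n by (rule summable_on_subset_banach) auto
  have tail_le: "(\<Sum>\<^sub>\<infinity>\<alpha>\<in>S - A. w \<alpha> * n \<alpha>) \<le> \<epsilon>"
  proof -
    have "(\<Sum>\<^sub>\<infinity>\<alpha>\<in>S - A. w \<alpha> * n \<alpha>) = (\<Sum>\<^sub>\<infinity>\<alpha>\<in>S. w \<alpha> * n \<alpha>) - (\<Sum>\<alpha>\<in>A. w \<alpha> * n \<alpha>)"
      using infsum_Diff[OF sum_n _ A(2)] A(1) by simp
    moreover have "(\<Sum>\<alpha>\<in>A0. w \<alpha> * n \<alpha>) \<le> (\<Sum>\<alpha>\<in>A. w \<alpha> * n \<alpha>)"
      using A(1) w n0 by (intro sum_mono2) (auto simp: A_def)
    ultimately show ?thesis
      using A0(3) by (simp add: dist_real_def)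
  qed
  \<comment> \<open>The total contribution of the tail to the weight of \<open>\<beta>\<close>.\<close>
  define e where "e \<beta> = (\<Sum>\<^sub>\<infinity>\<alpha>\<in>S - A. w \<alpha> * \<kappa> \<alpha> \<beta>)" for \<beta>
  have dom: "\<bar>w \<alpha> * \<kappa> \<alpha> \<beta>\<bar> \<le> C * (w \<alpha> * n \<alpha>)" if "\<alpha> \<in> S" "\<beta> \<in> B" for \<alpha> \<beta>
    using mult_left_mono[OF bnd[OF that] w[of \<alpha>]] w[of \<alpha>] by (simp add: abs_mult n_def mult_ac)
  have dom_sum: "(\<lambda>\<alpha>. C * (w \<alpha> * n \<alpha>)) summable_on (S - A)"
    using tail by (rule summable_on_cmult_right)
  have e_abs: "(\<lambda>\<alpha>. \<bar>w \<alpha> * \<kappa> \<alpha> \<beta>\<bar>) summable_on (S - A)" if "\<beta> \<in> B" for \<beta>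
    using dom_sum by (rule summable_on_comparison_test) (use dom that in auto)
  have e_sum: "((\<lambda>\<alpha>. w \<alpha> * \<kappa> \<alpha> \<beta>) has_sum e \<beta>) (S - A)" if "\<beta> \<in> B" for \<beta>
    unfolding e_def using e_abs[OF that] summable_on_iff_abs_summable_on_real
    by (intro has_sum_infsum) fastforce
  have e_bound: "- e \<beta> \<le> w \<beta>" if "\<beta> \<in> B" for \<beta>
  proof -
    have "((\<lambda>\<alpha>. - (w \<alpha> * \<kappa> \<alpha> \<beta>)) has_sum - e \<beta>) (S - A)"
      using e_sum[OF that] by (simp add: has_sum_uminus)
    moreover have "((\<lambda>\<alpha>. C * (w \<alpha> * n \<alpha>)) has_sum C * (\<Sum>\<^sub>\<infinity>\<alpha>\<in>S - A. w \<alpha> * n \<alpha>)) (S - A)"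
      using tail by (intro has_sum_cmult_right has_sum_infsum)
    ultimately have "- e \<beta> \<le> C * (\<Sum>\<^sub>\<infinity>\<alpha>\<in>S - A. w \<alpha> * n \<alpha>)"
    proof (rule has_sum_mono)
      fix \<alpha> assume "\<alpha> \<in> S - A"
      then show "- (w \<alpha> * \<kappa> \<alpha> \<beta>) \<le> C * (w \<alpha> * n \<alpha>)"
        using dom[of \<alpha> \<beta>] that by auto
    qed
    also have "\<dots> \<le> C * \<epsilon>"
      using tail_le C by (rule mult_left_mono)
    also have "\<dots> \<le> w \<beta>"
      by (rule \<epsilon>(2)[OF that])
    finally show ?thesis .
  qed
  define d where "d \<alpha> = w \<alpha> + (if \<alpha> \<in> B then e \<alpha> else 0)" for \<alpha>
  have d0: "0 \<le> d \<alpha>" for \<alpha>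
    using e_bound[of \<alpha>] w[of \<alpha>] unfolding d_def by (cases "\<alpha> \<in> B") auto
  have "t k = (\<Sum>\<alpha>\<in>A. d \<alpha> * v \<alpha> k)" if k: "k < L" for k
  proof -
    have "((\<lambda>\<alpha>. \<Sum>\<beta>\<in>B. w \<alpha> * \<kappa> \<alpha> \<beta> * v \<beta> k) has_sum (\<Sum>\<beta>\<in>B. e \<beta> * v \<beta> k)) (S - A)"
      by (intro has_sum_finite_sum has_sum_cmult_left e_sum)
    moreover have "(\<Sum>\<beta>\<in>B. w \<alpha> * \<kappa> \<alpha> \<beta> * v \<beta> k) = w \<alpha> * v \<alpha> k" if "\<alpha> \<in> S - A" for \<alpha>
      using \<kappa>[of \<alpha> k] k that by (simp add: sum_distrib_left mult.assoc)
    ultimately have "((\<lambda>\<alpha>. w \<alpha> * v \<alpha> k) has_sum (\<Sum>\<beta>\<in>B. e \<beta> * v \<beta> k)) (S - A)"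
      by (rule has_sum_cong[THEN iffD1, rotated])
    then have "((\<lambda>\<alpha>. w \<alpha> * v \<alpha> k) has_sum ((\<Sum>\<beta>\<in>B. e \<beta> * v \<beta> k) + (\<Sum>\<alpha>\<in>A. w \<alpha> * v \<alpha> k))) ((S - A) \<union> A)"
      using A(1) by (intro has_sum_Un_disjoint) (auto simp: has_sum_finite)
    moreover have "(S - A) \<union> A = S"
      using A(2) by blast
    ultimately have "t k = (\<Sum>\<beta>\<in>B. e \<beta> * v \<beta> k) + (\<Sum>\<alpha>\<in>A. w \<alpha> * v \<alpha> k)"
      using has_sum_unique[OF _ tS[OF k]] by simp
    also have "(\<Sum>\<beta>\<in>B. e \<beta> * v \<beta> k) = (\<Sum>\<beta>\<in>A. if \<beta> \<in> B then e \<beta> * v \<beta> k else 0)"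
      using A by (intro sum.mono_neutral_cong_left) auto
    finally have "t k = (\<Sum>\<alpha>\<in>A. (if \<alpha> \<in> B then e \<alpha> * v \<alpha> k else 0) + w \<alpha> * v \<alpha> k)"
      by (simp add: sum.distrib)
    also have "\<dots> = (\<Sum>\<alpha>\<in>A. d \<alpha> * v \<alpha> k)"
      by (intro sum.cong refl) (simp add: d_def distrib_right)
    finally show ?thesis .
  qed
  then show ?thesis
    using A(1) d0 by (intro exI[of _ A] exI[of _ d] conjI allI impI)
qed

section \<open>Transforms of moment sequences\<close>

text \<open>
  Up to the factors from total masses, a monomial maps tuples of moment sequences to moment
  sequences of probability measures \<open>\<nu> \<alpha>\<close>, and the transform is the combination of these with weights
  \<open>w \<alpha>\<close>. If it converges in all entries, the mixture of the \<open>\<nu> \<alpha>\<close> represents it. If it breaks off before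
  index \<open>L\<close>, the mixture may fail to have higher moments; the combination is then first replaced by a finite one.
\<close>

theorem power_sum_preserves_moments:
  fixes F :: "real ^ 'm::finite \<Rightarrow> real"
  assumes f: "pos_series \<rho> f" and F: "\<And>x. vabs x \<in> orthant_box \<rho> \<Longrightarrow> F x = power_sum f x"
    and \<sigma>: "\<And>l. \<sigma> l \<in> bounded_moment_seqs \<rho> K"
  shows "seq_transform F \<sigma> \<in> truncated_moment_seqs"
proof -
  have "\<exists>\<mu>. admissible \<mu> \<and>
      \<sigma> l = (\<lambda>k. if \<forall>j\<le>k. moment \<mu> j \<in> symm_interval \<rho> then Some (moment \<mu> k) else None)" for l
    using \<sigma>[of l] by (simp only: bounded_moment_seqs_def mem_Collect_eq) (elim exE conjE, intro exI conjI)
  then have "\<forall>l. \<exists>\<mu>. admissible \<mu> \<and>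
      \<sigma> l = (\<lambda>k. if \<forall>j\<le>k. moment \<mu> j \<in> symm_interval \<rho> then Some (moment \<mu> k) else None)"
    by (rule allI)
  from choice[OF this] obtain \<mu> where \<mu>: "\<forall>l. admissible (\<mu> l) \<and>
      \<sigma> l = (\<lambda>k. if \<forall>j\<le>k. moment (\<mu> l) j \<in> symm_interval \<rho> then Some (moment (\<mu> l) k) else None)"
    by (rule exE)
  have adm: "admissible (\<mu> l)" for l
    using \<mu> by (rule allE) (erule conjunct1)
  have \<sigma>_eq: "\<sigma> l = (\<lambda>k. if \<forall>j\<le>k. moment (\<mu> l) j \<in> symm_interval \<rho> then Some (moment (\<mu> l) k) else None)" for l
    using \<mu> by (rule allE) (erule conjunct2)
  have "\<exists>s. prob_moments s \<and> (\<forall>k. moment (\<mu> l) k = moment (\<mu> l) 0 * s k)" for l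
    using admissible_normalized[OF adm[of l]] by blast
  then have "\<exists>s. \<forall>l. prob_moments (s l) \<and> (\<forall>k. moment (\<mu> l) k = moment (\<mu> l) 0 * s l k)"
    by (rule choice[OF allI])
  then obtain s where s_all: "\<forall>l. prob_moments (s l) \<and> (\<forall>k. moment (\<mu> l) k = moment (\<mu> l) 0 * s l k)"
    by (rule exE)
  have s: "prob_moments (s l)" for l
    using s_all by blast
  have moment_eq: "moment (\<mu> l) k = moment (\<mu> l) 0 * s l k" for l k
    using s_all by blast
  define v where "v \<alpha> k = (\<Prod>l\<in>UNIV. s l k ^ \<alpha> l)" for \<alpha> :: "'m \<Rightarrow> nat" and k
  have "prob_moments (v \<alpha>)" for \<alpha>
    unfolding v_def by (rule prob_moments_prod_power) (rule s)
  then have "\<exists>\<pi>. prob_space \<pi> \<and> admissible \<pi> \<and> (\<forall>k. moment \<pi> k = v \<alpha> k)" for \<alpha>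
    by (simp add: prob_moments_def)
  then have "\<exists>\<nu>. \<forall>\<alpha>. prob_space (\<nu> \<alpha>) \<and> admissible (\<nu> \<alpha>) \<and> (\<forall>k. moment (\<nu> \<alpha>) k = v \<alpha> k)"
    by (rule choice[OF allI])
  then obtain \<nu> where \<nu>_all: "\<forall>\<alpha>. prob_space (\<nu> \<alpha>) \<and> admissible (\<nu> \<alpha>) \<and> (\<forall>k. moment (\<nu> \<alpha>) k = v \<alpha> k)"
    by (rule exE)
  have \<nu>: "prob_space (\<nu> \<alpha>)" "admissible (\<nu> \<alpha>)" "moment (\<nu> \<alpha>) k = v \<alpha> k" for \<alpha> k
    using spec[OF \<nu>_all, of \<alpha>] by auto
  define w where "w \<alpha> = f \<alpha> * (\<Prod>l\<in>UNIV. moment (\<mu> l) 0 ^ \<alpha> l)" for \<alpha>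
  have w0: "0 \<le> w \<alpha>" for \<alpha>
    using f admissible_normalized[OF adm] by (simp add: w_def pos_series_def prod_nonneg)
  define x where "x k = (\<chi> l. moment (\<mu> l) k)" for k
  have term_eq: "f \<alpha> * mpow (x k) \<alpha> = w \<alpha> * v \<alpha> k" for \<alpha> k
  proof -
    have "mpow (x k) \<alpha> = (\<Prod>l\<in>UNIV. (moment (\<mu> l) 0 * s l k) ^ \<alpha> l)"
      unfolding mpow_def x_def using moment_eq[of _ k] by simp
    then show ?thesis
      by (simp add: w_def v_def power_mult_distrib prod.distrib)
  qed
  define good where "good k \<longleftrightarrow> (\<forall>l. \<forall>j\<le>k. moment (\<mu> l) j \<in> symm_interval \<rho>)" for k
  have good_sum: "((\<lambda>\<alpha>. w \<alpha> * v \<alpha> k) has_sum F (x k)) UNIV" if "good k" for k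
  proof -
    have "vabs (x k) \<in> orthant_box \<rho>"
      using that by (auto simp: vabs_box_iff good_def x_def)
    then have "((\<lambda>\<alpha>. f \<alpha> * mpow (x k) \<alpha>) has_sum F (x k)) UNIV"
      using power_sum_has_sum[OF f, of "x k"] F[of "x k"] by simp
    then show ?thesis
      by (simp only: term_eq)
  qed
  have tr: "seq_transform F \<sigma> = (\<lambda>k. if good k then Some (F (x k)) else None)"
  proof
    fix k
    show "seq_transform F \<sigma> k = (if good k then Some (F (x k)) else None)"
    proof (cases "good k")
      case True
      then have "\<sigma> l k = Some (moment (\<mu> l) k)" for l
        by (simp add: good_def \<sigma>_eq)
      then show ?thesis
        using True by (simp add: seq_transform_def x_def)
    next
      case False
      then obtain l j where "j \<le> k" "moment (\<mu> l) j \<notin> symm_interval \<rho>"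
        unfolding good_def by blast
      then have "\<sigma> l k = None"
        by (auto simp: \<sigma>_eq)
      then show ?thesis
        using False by (auto simp: seq_transform_def)
    qed
  qed
  show ?thesis
  proof (cases "\<forall>k. good k")
    case True
    then obtain N where "admissible N" "\<And>k. moment N k = F (x k)"
      using mixture_of_measures_countable[of \<nu> w "\<lambda>k. F (x k)"] \<nu> w0 good_sum by auto
    then show ?thesis
      unfolding truncated_moment_seqs_def tr mem_Collect_eq using True
      by (intro exI[of _ N] exI[of _ \<infinity>] conjI) simp_all
  next
    case False
    define L where "L = (LEAST k. \<not> good k)"
    obtain k0 where "\<not> good k0"
      using False by blast
    then have L: "\<not> good L"
      unfolding L_def by (rule LeastI[of "\<lambda>k. \<not> good k"])
    have below: "good k" if "k < L" for k
      using not_less_Least[OF that[unfolded L_def]] by (rule notnotD)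
    have above: "good L" if "good k" "\<not> k < L" for k
      unfolding good_def
    proof (intro allI impI)
      fix l j assume "j \<le> L"
      then have "j \<le> k"
        using that(2) by simp
      then show "moment (\<mu> l) j \<in> symm_interval \<rho>"
        using that(1)[unfolded good_def] by blast
    qed
    have good_iff: "good k \<longleftrightarrow> k < L" for k
      using below above L by (cases "k < L") auto
    have "\<exists>A d. finite A \<and> (\<forall>\<alpha>. 0 \<le> d \<alpha>) \<and> (\<forall>k<L. F (x k) = (\<Sum>\<alpha>\<in>A. d \<alpha> * v \<alpha> k))"
    proof (rule convergent_conic_combination[where w = w])
      show "((\<lambda>\<alpha>. w \<alpha> * v \<alpha> k) has_sum F (x k)) UNIV" if "k < L" for k
        using that by (intro good_sum) (simp add: good_iff)
    qed (rule w0)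
    then obtain A d where A: "finite A" and d: "\<forall>\<alpha>. 0 \<le> d \<alpha>"
      and t: "\<forall>k<L. F (x k) = (\<Sum>\<alpha>\<in>A. d \<alpha> * v \<alpha> k)"
      by (elim exE conjE) (rule that)
    have "\<exists>N. admissible N \<and> (\<forall>k. moment N k = (\<Sum>\<alpha>\<in>A. d \<alpha> * v \<alpha> k))"
    proof (rule mixture_of_measures_countable)
      show "0 \<le> (if \<alpha> \<in> A then d \<alpha> else 0)" for \<alpha>
        using d by simp
      show "((\<lambda>\<alpha>. (if \<alpha> \<in> A then d \<alpha> else 0) * moment (\<nu> \<alpha>) k) has_sum (\<Sum>\<alpha>\<in>A. d \<alpha> * v \<alpha> k)) UNIV" for k
      proof -
        have "((\<lambda>\<alpha>. d \<alpha> * v \<alpha> k) has_sum (\<Sum>\<alpha>\<in>A. d \<alpha> * v \<alpha> k)) A"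
          using A by (simp add: has_sum_finite)
        then show ?thesis
          by (rule has_sum_cong_neutral[THEN iffD1, rotated -1]) (auto simp: \<nu>)
      qed
    qed (simp_all add: \<nu>)
    then obtain N where N: "admissible N" "\<forall>k. moment N k = (\<Sum>\<alpha>\<in>A. d \<alpha> * v \<alpha> k)"
      by (elim exE conjE) (rule that)
    have "(\<lambda>k. if good k then Some (F (x k)) else None) = (\<lambda>k. if enat k < enat L then Some (moment N k) else None)"
      using N(2) t by (intro ext) (simp add: good_iff)
    then show ?thesis
      unfolding truncated_moment_seqs_def tr mem_Collect_eq using N(1)
      by (intro exI[of _ N] exI[of _ "enat L"] conjI)
  qed
qed

lemma riesz_moment_square:
  assumes "admissible \<mu>"
  shows "riesz (moment \<mu>) (p * p) = (\<integral>x. (poly p x)\<^sup>2 \<partial>\<mu>)"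
proof -
  have int: "integrable \<mu> (\<lambda>x. x ^ k)" for k
    using assms by (simp add: admissible_def)
  have "(\<integral>x. (poly p x)\<^sup>2 \<partial>\<mu>) = (\<integral>x. (\<Sum>i\<le>degree p. \<Sum>j\<le>degree p. coeff p i * coeff p j * x ^ (i + j)) \<partial>\<mu>)"
    by (intro Bochner_Integration.integral_cong refl)
      (simp add: poly_altdef power2_eq_square sum_product power_add mult_ac)
  also have "\<dots> = (\<Sum>i\<le>degree p. \<Sum>j\<le>degree p. coeff p i * coeff p j * moment \<mu> (i + j))"
    using int by (simp add: moment_def)
  finally show ?thesis
    by (simp add: riesz_square)
qed

lemma two_atom_measure:
  fixes a b u v :: real
  assumes "0 \<le> a" "0 \<le> b"
  obtains \<mu> where "admissible \<mu>" "\<And>k. moment \<mu> k = a * u ^ k + b * v ^ k" "\<And>S. \<lbrakk>S \<in> sets borel; u \<in> S; v \<in> S\<rbrakk> \<Longrightarrow> AE x in \<mu>. x \<in> S"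
proof -
  define P where "P = point_measure (UNIV :: bool set) (\<lambda>c. ennreal (if c then a else b))"
  define g where "g = (\<lambda>c. if c then u else v)"
  define \<mu> where "\<mu> = distr P borel g"
  have g: "g \<in> measurable P borel"
    by (simp add: P_def point_measure_def)
  have "integrable P h" for h :: "bool \<Rightarrow> real"
    unfolding P_def by (rule integrable_point_measure_finite) simp
  then have "admissible \<mu>"
    by (simp add: admissible_def \<mu>_def integrable_distr_eq[OF g])
  moreover have "moment \<mu> k = a * u ^ k + b * v ^ k" for k
  proof -
    have "moment \<mu> k = (\<integral>c. g c ^ k \<partial>P)"
      unfolding moment_def \<mu>_def by (rule integral_distr[OF g]) simp
    also have "\<dots> = (\<Sum>c\<in>UNIV. (if c then a else b) *\<^sub>R g c ^ k)"
      unfolding P_def using assms by (intro lebesgue_integral_point_measure_finite) auto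
    finally show ?thesis
      by (simp add: UNIV_bool g_def add.commute)
  qed
  moreover have "AE x in \<mu>. x \<in> S" if "S \<in> sets borel" "u \<in> S" "v \<in> S" for S
    unfolding \<mu>_def using that by (subst AE_distr_iff[OF g]) (auto simp: g_def)
  ultimately show thesis
    by (rule that)
qed

text \<open>
  The moments of two-atom measures with small mass all lie in \<open>(-\<rho>, \<rho>)\<close>, so the sequences are not truncated,
  and the transformed sequence is the full moment sequence of a measure, for which \<open>L(p\<^sup>2)\<close> is the
  integral of \<open>p\<^sup>2\<close>.
\<close>

theorem moment_preserver_two_atom:
  fixes F :: "real ^ 'm::finite \<Rightarrow> real"
  assumes \<delta>: "0 \<le> \<delta>"
    and F: "seq_transform F \<in> (UNIV \<rightarrow> bounded_moment_seqs \<rho> {-1..1 + \<delta>}) \<rightarrow> truncated_moment_seqs"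
  shows "two_atom_positive \<rho> F"
  unfolding two_atom_positive_def
proof (intro allI impI)
  fix a b u v :: "real ^ 'm"
  assume H: "\<forall>i. 0 \<le> a $ i \<and> 0 \<le> b $ i \<and> ereal (a $ i + b $ i) < \<rho> \<and> \<bar>u $ i\<bar> \<le> 1 \<and> \<bar>v $ i\<bar> \<le> 1"
  define s where "s l k = a $ l * u $ l ^ k + b $ l * v $ l ^ k" for l k
  have s: "s l k \<in> symm_interval \<rho>" for l k
  proof -
    have "\<bar>s l k\<bar> \<le> a $ l * 1 + b $ l * 1"
      unfolding s_def using H
      by (intro order_trans[OF abs_triangle_ineq] add_mono)
        (auto simp: abs_mult power_abs intro!: mult_left_le power_le_one)
    then have "ereal \<bar>s l k\<bar> \<le> ereal (a $ l + b $ l)"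
      by simp
    also have "\<dots> < \<rho>"
      using H by blast
    finally show ?thesis
      by (simp add: symm_interval_iff)
  qed
  have "(\<lambda>k. Some (s l k)) \<in> bounded_moment_seqs \<rho> {-1..1 + \<delta>}" for l
  proof -
    obtain \<mu> where \<mu>: "admissible \<mu>" "\<And>k. moment \<mu> k = a $ l * u $ l ^ k + b $ l * v $ l ^ k"
      "\<And>S. \<lbrakk>S \<in> sets borel; u $ l \<in> S; v $ l \<in> S\<rbrakk> \<Longrightarrow> AE x in \<mu>. x \<in> S"
    proof -
      have "0 \<le> a $ l" "0 \<le> b $ l"
        using H by blast+
      from two_atom_measure[OF this, of "u $ l" "v $ l"] show thesis
        using \<open>\<And>\<mu>. \<lbrakk>admissible \<mu>; \<And>k. moment \<mu> k = a $ l * u $ l ^ k + b $ l * v $ l ^ k;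
          \<And>S. \<lbrakk>S \<in> sets borel; u $ l \<in> S; v $ l \<in> S\<rbrakk> \<Longrightarrow> AE x in \<mu>. x \<in> S\<rbrakk> \<Longrightarrow> thesis\<close> .
    qed
    have "\<bar>u $ l\<bar> \<le> 1" "\<bar>v $ l\<bar> \<le> 1"
      using H by blast+
    then have "AE x in \<mu>. x \<in> {-1..1 + \<delta>}"
      using \<delta> by (intro \<mu>(3)) auto
    moreover have "moment \<mu> k = s l k" for k
      by (simp add: \<mu>(2) s_def)
    ultimately show ?thesis
      unfolding bounded_moment_seqs_def mem_Collect_eq using \<mu>(1) s
      by (intro exI[of _ \<mu>] conjI) simp_all
  qed
  then have "seq_transform F (\<lambda>l k. Some (s l k)) \<in> truncated_moment_seqs"
    by (intro funcset_mem[OF F]) simp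
  moreover have "seq_transform F (\<lambda>l k. Some (s l k)) = (\<lambda>k. Some (F (\<chi> l. s l k)))"
    by (simp add: seq_transform_def)
  ultimately have "\<exists>\<mu> L. admissible \<mu> \<and>
      (\<lambda>k. Some (F (\<chi> l. s l k))) = (\<lambda>k. if enat k < L then Some (moment \<mu> k) else None)"
    by (simp only: truncated_moment_seqs_def mem_Collect_eq)
  then obtain \<mu> L where \<mu>: "admissible \<mu>"
    and eq: "(\<lambda>k. Some (F (\<chi> l. s l k))) = (\<lambda>k. if enat k < L then Some (moment \<mu> k) else None)"
    by (elim exE conjE) (rule that)
  have mom: "F (\<chi> l. s l k) = moment \<mu> k" for k
    using fun_cong[OF eq, of k] by (simp split: if_splits)
  show "hankel_psd (\<lambda>k. F (\<chi> l. a $ l * u $ l ^ k + b $ l * v $ l ^ k))"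
    unfolding s_def[symmetric] mom hankel_psd_def by (simp add: riesz_moment_square[OF \<mu>])
qed

section \<open>Equivalence of the four conditions\<close>

theorem theorem9p11:
  fixes F :: "real ^ 'm::finite \<Rightarrow> real" and \<rho> :: ereal and I :: "real set"
  assumes "0 < \<rho>" and "I = symm_interval \<rho>"
  defines "cond1 \<equiv> \<exists>\<delta>::real. \<delta> > 0 \<and>
      seq_transform F \<in> (UNIV \<rightarrow> bounded_moment_seqs \<rho> {-1..1 + \<delta>}) \<rightarrow> truncated_moment_seqs"
    and "cond2 \<equiv> \<forall>\<delta>::real. \<delta> > 0 \<longrightarrow>
      seq_transform F \<in> (UNIV \<rightarrow> bounded_moment_seqs \<rho> {-1..1 + \<delta>}) \<rightarrow> truncated_moment_seqs"
    and "cond3 \<equiv> \<forall>N::nat. N \<ge> 1 \<longrightarrow>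
      mat_transform N F \<in> (UNIV \<rightarrow> psd_mats N I) \<rightarrow> psd_mats N UNIV"
    and "cond4 \<equiv>
      absolutely_monotonic_on {x. \<forall>i. 0 \<le> x $ i \<and> ereal (x $ i) < \<rho>} F \<and>
      (\<exists>G. real_analytic_on {x. \<forall>i. x $ i \<in> I} G \<and> (\<forall>x. (\<forall>i. x $ i \<in> I) \<longrightarrow> F x = G x))"
  shows "(cond1 \<longleftrightarrow> cond2) \<and> (cond2 \<longleftrightarrow> cond3) \<and> (cond3 \<longleftrightarrow> cond4)"
proof -
  \<comment> \<open>The representation to which each of the four conditions is shown to be equivalent.\<close>
  define rep where "rep \<longleftrightarrow> (\<exists>f. pos_series \<rho> f \<and> (\<forall>x. vabs x \<in> orthant_box \<rho> \<longrightarrow> F x = power_sum f x))"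
  have orthant: "{x :: real ^ 'm. \<forall>i. 0 \<le> x $ i \<and> ereal (x $ i) < \<rho>} = orthant_box \<rho>"
    by (simp add: orthant_box_def)
  have box: "{x :: real ^ 'm. \<forall>i. x $ i \<in> I} = {x. vabs x \<in> orthant_box \<rho>}"
    by (simp add: vabs_box_iff \<open>I = symm_interval \<rho>\<close>)
  have box_iff: "(\<forall>i. x $ i \<in> I) \<longleftrightarrow> vabs x \<in> orthant_box \<rho>" for x :: "real ^ 'm"
    by (simp add: vabs_box_iff \<open>I = symm_interval \<rho>\<close>)
  have two_atom_rep: rep if "two_atom_positive \<rho> F"
  proof (rule two_atom_power_series[OF that \<open>0 < \<rho>\<close>])
    fix f :: "('m \<Rightarrow> nat) \<Rightarrow> real"
    assume "pos_series \<rho> f" "\<And>x. vabs x \<in> orthant_box \<rho> \<Longrightarrow> F x = power_sum f x"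
    then show rep
      unfolding rep_def by (intro exI[of _ f] conjI allI impI)
  qed
  have "cond1 \<Longrightarrow> rep"
  proof -
    assume cond1
    then obtain \<delta> where "0 < \<delta>"
      "seq_transform F \<in> (UNIV \<rightarrow> bounded_moment_seqs \<rho> {-1..1 + \<delta>}) \<rightarrow> truncated_moment_seqs"
      unfolding cond1_def by (elim exE conjE) (rule that)
    then show rep
      by (intro two_atom_rep moment_preserver_two_atom[of \<delta>]) simp_all
  qed
  moreover have "cond3 \<Longrightarrow> rep"
  proof -
    assume c: cond3
    show rep
    proof (intro two_atom_rep psd_preserver_two_atom)
      fix N :: nat and A :: "'m \<Rightarrow> real Matrix.mat"
      assume "1 \<le> N" and A: "\<And>l. A l \<in> psd_mats N (symm_interval \<rho>)"
      then have "mat_transform N F \<in> (UNIV \<rightarrow> psd_mats N I) \<rightarrow> psd_mats N UNIV"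
        using c by (simp add: cond3_def)
      then show "mat_transform N F A \<in> psd_mats N UNIV"
        by (rule funcset_mem) (simp add: A \<open>I = symm_interval \<rho>\<close>)
    qed
  qed
  moreover have "cond4 \<Longrightarrow> rep"
  proof -
    assume cond4
    then obtain G where mono: "absolutely_monotonic_on (orthant_box \<rho>) F"
      and G: "real_analytic_on {x. vabs x \<in> orthant_box \<rho>} G" "\<forall>x. vabs x \<in> orthant_box \<rho> \<longrightarrow> F x = G x"
      unfolding cond4_def orthant box box_iff by (elim exE conjE) (rule that)
    show rep
    proof (rule absolutely_monotonic_power_series[OF \<open>0 < \<rho>\<close> mono G(1)])
      show "F x = G x" if "vabs x \<in> orthant_box \<rho>" for x
        using G(2) that by simp
      fix f assume "pos_series \<rho> f" "\<And>x. vabs x \<in> orthant_box \<rho> \<Longrightarrow> F x = power_sum f x"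
      then show rep
        unfolding rep_def by (intro exI[of _ f] conjI allI impI)
    qed
  qed
  moreover have "rep \<Longrightarrow> cond2 \<and> cond3 \<and> cond4"
  proof -
    assume rep
    then obtain f where f: "pos_series \<rho> f" and F_all: "\<forall>x. vabs x \<in> orthant_box \<rho> \<longrightarrow> F x = power_sum f x"
      unfolding rep_def by (elim exE conjE) (rule that)
    have F: "F x = power_sum f x" if "vabs x \<in> orthant_box \<rho>" for x
      using F_all that by simp
    have cond2
      unfolding cond2_def
      by (intro allI impI funcsetI power_sum_preserves_moments[OF f F]) (auto simp: Pi_iff)
    moreover have cond3
      unfolding cond3_def
      by (intro allI impI funcsetI power_sum_preserves_psd[OF f F]) (auto simp: Pi_iff \<open>I = symm_interval \<rho>\<close>)
    moreover have cond4
      unfolding cond4_def orthant box box_iff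
      using power_sum_absolutely_monotonic[OF f F] power_sum_analytic[OF f] F_all
      by (intro conjI exI[of _ "power_sum f"])
    ultimately show ?thesis
      by simp
  qed
  moreover have "cond2 \<Longrightarrow> cond1"
    unfolding cond1_def cond2_def by (rule exI[of _ 1], rule conjI, simp, drule spec[of _ 1], erule mp, simp)
  ultimately show ?thesis
    by argo
qed

end
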